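(* Let $(V,g)$ satisfy the assumptions (1)--(7) listed in the context, with central charge $c$, top weight $h$ of $V^-$, and $d=\dim V_h$. (1) If $V_h$ forms a conformal $2$-design based on $V^{0,+}$, then for any $a^0\in V_2$, $$\mathrm{tr}_{V_h}\mathrm{o}(a^0)=\frac{2hd}{c}(a^0|\omega).$$ (2) If $V_h$ forms a conformal $4$-design based on $V^{0,+}$, then for any $a^0,a^1\in V_2$, $$\mathrm{tr}_{V_h}\mathrm{o}(a^0)\mathrm{o}(a^1)=\frac{4hd(5h+1)}{c(5c+22)}(a^0|\omega)(a^1|\omega)+\frac{2hd(22h-c)}{c(5c+22)}(a^0|a^1).$$ (3) If $V_h$ forms a conformal $6$-design based on $V^{0,+}$, then for any $a^0,a^1,a^2\in V_2$, $$\mathrm{tr}_{V_h}\mathrm{o}(a^0)\mathrm{o}(a^1)\mathrm{o}(a^2)=D_6(c)^{-1}\Big(F^{(3)}_0(a^0|\omega)(a^1|\omega)(a^2|\omega)+F^{(3)}_1\,\mathrm{Sym}\,(a^0|\omega)(a^1|a^2)+F^{(3)}_2(a^0|a^1|a^2)\Big).$$ (4) If $V_h$ forms a conformal $8$-design based on $V^{0,+}$, then for any $a^0,a^1,a^2,a^3\in V_2$, $$\begin{aligned}\mathrm{tr}_{V_h}\mathrm{o}(a^0)\mathrm{o}(a^1)\mathrm{o}(a^2)\mathrm{o}(a^3)=D_8(c)^{-1}\Big(&F^{(4)}_0(a^0|\omega)(a^1|\omega)(a^2|\omega)(a^3|\omega)+F^{(4)}_1\,\mathrm{Sym}\,(a^0|\omega)(a^1|\omega)(a^2|a^3)\\&+F^{(4)}_2\,\mathrm{Sym}\,(a^0|\omega)(a^1|a^2|a^3)+F^{(4)}_3\,\mathrm{Sym}\,(a^0|a^1)(a^2|a^3)\\&+F^{(4)}_4(a^0a^1|a^2a^3)+F^{(4)}_5(a^0a^2|a^1a^3)+F^{(4)}_6(a^0a^3|a^1a^2)\Big).\end{aligned}$$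 (5) If $V_h$ forms a conformal $10$-design based on $V^{0,+}$, then for any $a^0,a^1,a^2,a^3,a^4\in V_2$, $$\begin{aligned} &\mathrm{tr}_{V_h}\mathrm{o}(a^0)\mathrm{o}(a^1)\mathrm{o}(a^2)\mathrm{o}(a^3)\mathrm{o}(a^4)\\ &=D_{10}(c)^{-1}\Big(F^{(5)}_0(a^0|\omega)(a^1|\omega)(a^2|\omega)(a^3|\omega)(a^4|\omega)+F^{(5)}_1\,\mathrm{Sym}\,(a^0|\omega)(a^1|\omega)(a^2|\omega)(a^3|a^4)\\ &\quad+F^{(5)}_2\,\mathrm{Sym}\,(a^0|\omega)(a^1|\omega)(a^2|a^3|a^4)+F^{(5)}_3\,\mathrm{Sym}\,(a^0|\omega)(a^1|a^2)(a^3|a^4)\\ &\quad+F^{(5)}_4\big((a^0|\omega)(a^1a^2|a^3a^4)+(a^1|\omega)(a^0a^2|a^3a^4)+(a^2|\omega)(a^0a^1|a^3a^4)\\ &\qquad\qquad+(a^3|\omega)(a^0a^1|a^2a^4)+(a^4|\omega)(a^0a^1|a^2a^3)\big)\\ &\quad+F^{(5)}_5\big((a^0|\omega)(a^1a^3|a^2a^4)+(a^1|\omega)(a^0a^3|a^2a^4)+(a^2|\omega)(a^0a^3|a^1a^4)\\ &\qquad\qquad+(a^3|\omega)(a^0a^2|a^1a^4)+(a^4|\omega)(a^0a^2|a^1a^3)\big)\\ &\quad+F^{(5)}_6\big((a^0|\omega)(a^1a^4|a^2a^3)+(a^1|\omega)(a^0a^4|a^2a^3)+(a^2|\omega)(a^0a^4|a^1a^3)\\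 &\qquad\qquad+(a^3|\omega)(a^0a^4|a^1a^2)+(a^4|\omega)(a^0a^3|a^1a^2)\big)\\ &\quad+F^{(5)}_7\,\mathrm{Sym}\,(a^0|a^1)(a^2|a^3|a^4)+F^{(5)}_8(a^0a^1a^2a^3a^4)+{\sum}^{*}F^{(5)}_{i_0i_1i_2i_3i_4}(a^{i_0}a^{i_1}|a^{i_2}|a^{i_3}a^{i_4})\Big). \end{aligned}$$ Here the polynomials $D_n$, the coefficients $F^{(t)}_{\bullet}\in\mathbb{Q}[c,d,h]$, and the symbols $\mathrm{Sym}$, ${\sum}^{*}$, $(x|y|z)$, $(a^0a^1a^2a^3a^4)$ are those defined in the context.
   Context: All vector spaces are over $\mathbb{C}$. For a vertex operator superalgebra (SVOA) $V=V^0\oplus V^1$ ($V^0$ even, $V^1$ odd, $V^1=0$ allowed) write $Y(a,z)=\sum_{n\in\mathbb{Z}}a_{(n)}z^{-n-1}$; let $\mathbf{1}$ be the vacuum, $\omega$ the conformal vector, $c$ the central charge, $L(n)=\omega_{(n+1)}$, and $\mathrm{wt}(a)$ the $L(0)$-weight of a homogeneous $a$. The zero-mode is $\mathrm{o}(a)=a_{(\mathrm{wt}(a)-1)}$ for homogeneous $a$, extended linearly. $V$ is of CFT-type if its $L(0)$-weights are non-negative and its weight $0$ subspace is $\mathbb{C}\mathbf{1}$. $\langle\omega\rangle$ is the subalgebra generated by $\omega$. Put $\zeta^r=e^{r\pi\sqrt{-1}}$. Assumptions on $(V,g)$: $V$ is an SVOA of CFT-type, $g$ is an involution of $V$, $V^{\pm}=\{a\in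 V\mid ga=\pm a\}$, and: (1) $V$ is self-dual. (2) $V^0=\bigoplus_{n\ge0}V_n$ and $V^1=\bigoplus_{n\ge0}V_{n+k/2}$ with a non-negative $k\in\mathbb{Z}$ (if $V^1\neq0$), where subscripts denote $L(0)$-weights. (3) $V^+=V_0\oplus V_2\oplus(\bigoplus_{n>2}V_n)$ and $V^-=V_h\oplus(\bigoplus_{n>h}V_n)$ as $L(0)$-decompositions, where $V_h\ne0$ is the top level of $V^-$ and $h\in\frac12\mathbb{Z}$ is its top weight. From here on $V_2$ means the weight $2$ subspace of $V^+$ and $V_h$ the weight $h$ subspace of $V^-$; $V_h\subset V^0$ if $h\in\mathbb{Z}$ and $V_h\subset V^1$ if $h\in\mathbb{Z}+1/2$. Put $V^{0,+}=V^0\cap V^+$. (4) The invariant bilinear form $(\cdot|\cdot)$ on $V$ is non-degenerate. Here $(\cdot|\cdot)$ is normalized by $(\mathbf 1|\mathbf 1)=1$ and satisfies $(Y(a,z)u|v)=(u|Y^*(a,z)v)$ with $Y^*(a,z)=Y(e^{zL(1)}z^{-2L(0)}\zeta^{L(0)+2L(0)^2}a,z^{-1})$, except that when $V^1\neq 0$ and $h\equiv1/2 \bmod 2$ one uses $\zeta^{L(0)-2L(0)^2}$ in place of $\zeta^{L(0)+2L(0)^2}$. Thus $(u|v)\mathbf 1=\epsilon_h u_{(2h-1)}v$ for $u,v\in V_h$, where $\epsilon_h=(-1)^h$ if $h\in\mathbb{Z}$ and $\epsilon_h=1$ if $h\in\mathbb{Z}+1/2$. (5) The restriction of the form to $\langle\omega\rangle$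 is non-degenerate. (6) $V$ is a direct sum of highest weight modules over the Virasoro algebra generated by $\omega$. (7) If $V_h$ forms a conformal $2t$-design (defined below) with $t\le5$, then $c$ is not a zero of $D_{2t}(c)$, where $D_2(c)=c$, $D_4(c)=c(5c+22)$, $D_6(c)=(2c-1)(7c+68)D_4(c)$, $D_8(c)=(3c+46)(5c+3)D_6(c)$, $D_{10}(c)=(11c+232)D_8(c)$. Conformal design: let $V[n]$ be the sum of the highest weight Virasoro submodules of $V$ of highest weight $n$; then $V=\bigoplus_{n\ge0}V[n]$, $V[0]=\langle\omega\rangle$, and $\pi:V\to V[0]$ is the projection. $V_h$ forms a conformal $t$-design based on $V^{0,+}$ if $\mathrm{tr}_{V_h}\mathrm{o}(a)=\mathrm{tr}_{V_h}\mathrm{o}(\pi(a))$ for all $a$ in the sum of the weight $n$ subspaces of $V^{0,+}$, $0\le n\le t$. Griess algebra: on $V_2$, $ab=a_{(1)}b$ and $(a|b)\mathbf 1=a_{(3)}b$. The totally symmetric trilinear form is $(x|y|z)=(xy|z)$ for $x,y,z\in V_2$ (so e.g. $(a^{i_0}a^{i_1}|a^{i_2}|a^{i_3}a^{i_4})$ has arguments the products $a^{i_0}a^{i_1}$, $a^{i_2}$, $a^{i_3}a^{i_4}$). The scalar $(a^0a^1a^2a^3a^4)$ is defined by $(a^0a^1a^2a^3a^4)\mathbf 1=a^0_{(3)}a^1_{(2)}a^2_{(1)}a^3_{(0)}a^4$. $\mathrm{Sym}$ of an expression is the sum, over all permutations of the indices $0,\dots,t-1$ occurring in it, of the mutually distinct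 expressions so obtained (using commutativity of multiplication of scalars and symmetry of $(x|y)$ and $(x|y|z)$): $\mathrm{Sym}(a^0|\omega)(a^1|a^2)$ has 3 terms, $\mathrm{Sym}(a^0|\omega)(a^1|\omega)(a^2|a^3)$ has 6, $\mathrm{Sym}(a^0|\omega)(a^1|a^2|a^3)$ has 4, $\mathrm{Sym}(a^0|a^1)(a^2|a^3)$ has 3, $\mathrm{Sym}(a^0|\omega)(a^1|\omega)(a^2|\omega)(a^3|a^4)$ has 10, $\mathrm{Sym}(a^0|\omega)(a^1|\omega)(a^2|a^3|a^4)$ has 10, $\mathrm{Sym}(a^0|\omega)(a^1|a^2)(a^3|a^4)$ has 15, $\mathrm{Sym}(a^0|a^1)(a^2|a^3|a^4)$ has 10. The sum ${\sum}^*$ is over the 15 mutually distinct terms $(a^{i_0}a^{i_1}|a^{i_2}|a^{i_3}a^{i_4})$ with $(i_0,\dots,i_4)$ a permutation of $(0,\dots,4)$, indexed as in the list of $F^{(5)}_{i_0i_1i_2i_3i_4}$ below. Coefficients ($*$ denotes multiplication): $F^{(3)}_0 = 8*h*d*((70*h^2+42*h+8)*c+29*h^2-57*h-2)$, $F^{(3)}_1 = -4*h*d*((14*h+4)*c^2+(-308*h^2-93*h-1)*c+170*h^2+34*h)$, $F^{(3)}_2 = h*d*(4*c^3+(-222*h-1)*c^2+(3008*h^2+102*h)*c-1496*h^2)$, $F^{(4)}_0 = 16*h*d*((1050*h^3+1260*h^2+606*h+108)*c^2+(3305*h^3-498*h^2-701*h+78)*c-251*h^3+918*h^2-829*h-6)$,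 $F^{(4)}_1 = -8*h*d*((210*h^2+162*h+36)*c^3+(-4620*h^3-3227*h^2-861*h+26)*c^2+(-5614*h^3+2915*h^2-485*h-2)*c-1334*h^3+2622*h^2+92*h)$, $F^{(4)}_2 = 2*h*d*(60*h*c^4+(-3330*h^2-523*h-487)*c^3+(45120*h^3+9648*h^2+13856*h-2336)*c^2+(36376*h^3-91186*h^2+43550*h-2232)*c-6760*h^3-47796*h^2+19756*h-696)$, $F^{(4)}_3 = 4*h*d*((42*h+36)*c^4+(-1848*h^2-1279*h+513)*c^3+(20328*h^3+13052*h^2-14654*h+2334)*c^2+(-35836*h^3+98516*h^2-43320*h+2232)*c-16700*h^3+43104*h^2-19756*h+696)$, $F^{(4)}_4 = (1/2)*h*d*((1128*h+199)*c^4+(-46392*h^2-3311*h-1768)*c^3+(497472*h^3-19488*h^2+73544*h-16440)*c^2+(351008*h^3-726256*h^2+326804*h-17160)*c-72848*h^3-344832*h^2+158048*h-5568)$, $F^{(4)}_5 = (-1/2)*h*d*(60*c^5+(-2976*h+1023)*c^4+(44184*h^2-41669*h+2850)*c^3+(-164544*h^3+426432*h^2-65116*h-716)*c^2+(-22112*h^3+23984*h^2+13092*h-1528)*c+68816*h^3-150144*h^2+25024*h)$, $F^{(4)}_6 = (1/2)*h*d*(60*c^5+(-2640*h+1311)*c^4+(29400*h^2-51901*h+6954)*c^3+(-1920*h^3+530848*h^2-182348*h+17956)*c^2+(-308800*h^3+812112*h^2-333468*h+16328)*c-64784*h^3+194688*h^2-133024*h+5568)$, $F^{(5)}_0=32*h*d*((11550*h^4+23100*h^3+20130*h^2+8580*h+1440)*c^2+(76675*h^4+30590*h^3-25615*h^2-10898*h+1608)*c+3767*h^4-18410*h^3+29929*h^2-16342*h-24)$,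 $F^{(5)}_1=-16*h*d*((2310*h^3+3366*h^2+1848*h+360)*c^3+(-50820*h^4-64063*h^3-39624*h^2-9203*h+402)*c^2+(-190058*h^4+21757*h^3+50420*h^2-8593*h-6)*c+14558*h^4-53244*h^3+48082*h^2+348*h)$, $F^{(5)}_2=(4/5)*h*d*((3300*h^2+660*h-40)*c^4+(-183150*h^3-90835*h^2-94567*h-25578)*c^3+(2481600*h^4+1334700*h^3+2540131*h^2+285789*h-163830)*c^2+(7115560*h^4-13778670*h^3+2299334*h^2+2630452*h-245456)*c+858872*h^4+1045920*h^3-6623912*h^2+2211696*h-37056)$, $F^{(5)}_3=(8/5)*h*d*((2310*h^2+3300*h+920)*c^4+(-101640*h^3-123925*h^2+2681*h+13794)*c^3+(1118040*h^4+1178540*h^3-631298*h^2-179402*h+81900)*c^2+(-228580*h^4+4993420*h^3-750692*h^2-1313196*h+122728)*c+344284*h^4-2043720*h^3+3258596*h^2-1105848*h+18528)$, $F^{(5)}_4=(1/5)*h*d*(500*c^5+(62040*h^2+7735*h+25115)*c^4+(-2551560*h^3-564175*h^2-1452063*h+94428)*c^3+(27360960*h^4+2744160*h^3+30534534*h^2-6099454*h-348380)*c^2+(64210400*h^4-208744320*h^3+91532216*h^2+3799848*h-935504)*c-909872*h^4-64093920*h^3+8306672*h^2+7635744*h-148224)$, $F^{(5)}_5=(-1/5)*h*d*((3300*h+1500)*c^5+(-163680*h^2-585*h+39235)*c^4+(2430120*h^3-2017145*h^2-1433609*h+240084)*c^3+(-9049920*h^4+31066560*h^3+13487402*h^2-7601082*h+456180)*c^2+(-41190560*h^4-16962080*h^3+49902728*h^2-9779816*h-107152)*c-808336*h^4+9987680*h^3-17678384*h^2+1778272*h+188928)$,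 $F^{(5)}_6=(1/5)*h*d*((3300*h+1500)*c^5+(-145200*h^2+25815*h+46595)*c^4+(1617000*h^3-3008545*h^2-1412161*h+350436)*c^3+(-105600*h^4+40494880*h^3+8437018*h^2-9036298*h+1111380)*c^2+(-43019200*h^4+22985280*h^3+43897192*h^2-20285384*h+874672)*c+1945936*h^4-6362080*h^3+8390384*h^2-7068512*h+337152)$, $F^{(5)}_7=(-2/5)*h*d*((660*h+460)*c^5+(-51150*h^2-33647*h+6897)*c^4+(1302180*h^3+829156*h^2-451426*h+40950)*c^3+(-10919040*h^4-7782640*h^3+9315274*h^2-2071698*h+61364)*c^2+(21416272*h^4-59346500*h^3+27298188*h^2-1866624*h+9264)*c+9686000*h^4-25000320*h^3+11458480*h^2-403680*h)$, $F^{(5)}_8=(-1/2)*h*d*(100*c^6+(-8078*h+2861)*c^5+(221174*h^2-203081*h+19684)*c^4+(-2214880*h^3+4802538*h^2-965274*h+52252)*c^3+(4236288*h^4-38346896*h^3+13282628*h^2-1695920*h+25584)*c^2+(12825792*h^4-32289856*h^3+12276272*h^2-758816*h+17536)*c-155904*h^4-1722368*h^3+4176000*h^2-215296*h)$, $F^{(5)}_{01423}=(-1/10)*h*d*(500*c^6+(-33130*h+25625)*c^5+(707230*h^2-1434751*h+485426)*c^4+(-4128560*h^3+27827338*h^2-20020070*h+4414912)*c^3+(-15989760*h^4-192127280*h^3+258582588*h^2-134080200*h+15339472)*c^2+(136946816*h^4-932999600*h^3+1000619648*h^2-291521120*h+11640256)*c+25836352*h^4-152808960*h^3+252283328*h^2-102259584*h+4475904)$,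 $F^{(5)}_{01324}=(1/10)*h*d*(500*c^6+(-35770*h+23785)*c^5+(911830*h^2-1300163*h+457838)*c^4+(-9337280*h^3+24510714*h^2-18214366*h+4251112)*c^3+(27686400*h^4-160996720*h^3+221321492*h^2-125793408*h+15094016)*c^2+(51281728*h^4-695613600*h^3+891426896*h^2-284054624*h+11603200)*c-12907648*h^4-52807680*h^3+206449408*h^2-100644864*h+4475904)$, $F^{(5)}_{12034}=(1/10)*h*d*(100*c^6+(-3150*h+5575)*c^5+(15650*h^2-148721*h+119806)*c^4+(-550800*h^3-1490922*h^2-4041146*h+949728)*c^3+(14745600*h^4+53833840*h^3+29411876*h^2-25511768*h+3284592)*c^2+(-167754624*h^4+73524400*h^3+137639360*h^2-61086944*h+2624448)*c+3115968*h^4-16839680*h^3+31808832*h^2-21690496*h+1007616)$, $F^{(5)}_{01234}=h*d*(50*c^6+(-5304*h+1238)*c^5+(204604*h^2-99615*h+13827)*c^4+(-3383208*h^3+2721160*h^2-892294*h+59250)*c^3+(20120832*h^4-26868960*h^3+17636364*h^2-3522876*h-65568)*c^2+(41237472*h^4-107859720*h^3+46229896*h^2-423632*h-256192)*c-772320*h^4-27659904*h^3+9574560*h^2+1892928*h-31488)$, $F^{(5)}_{02134}=(-1/10)*h*d*(100*c^6+(150*h+7215)*c^5+(-237790*h^2-280007*h+130072)*c^4+(5835360*h^3+1550206*h^2-5491014*h+812348)*c^3+(-38223360*h^4+30779440*h^3+63018188*h^2-27827312*h+1723824)*c^2+(-139274688*h^4-126848480*h^3+208934224*h^2-38241856*h-180160)*c+69888*h^4+19482880*h^3-41267328*h^2+3697664*h+692736)$,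 $F^{(5)}_{03214}=F^{(5)}_{04213}=(1/5)*h*d*((1650*h+820)*c^5+(-126720*h^2-65643*h+5133)*c^4+(3193080*h^3+1520564*h^2-724934*h-68690)*c^3+(-26484480*h^4-11527200*h^3+16803156*h^2-1157772*h-780384)*c^2+(14239968*h^4-100186440*h^3+35647432*h^2+11422544*h-1402304)*c-1523040*h^4+18161280*h^3-36538080*h^2+12694080*h-157440)$, $F^{(5)}_{02413}=F^{(5)}_{03412}=(-1/5)*h*d*((3630*h+5660)*c^5+(-199320*h^2-209673*h+193503)*c^4+(3472920*h^3+1907324*h^2-7596850*h+2076826)*c^3+(-18585600*h^4-196400*h^3+96084724*h^2-62800300*h+7605776)*c^2+(36408928*h^4-385775160*h^3+469619144*h^2-143863520*h+5776288)*c+13307936*h^4-72098560*h^3+115701664*h^2-50591552*h+2237952)$, $F^{(5)}_{02314}=F^{(5)}_{04312}=(1/5)*h*d*((2310*h+4740)*c^5+(-97020*h^2-142379*h+179709)*c^4+(868560*h^3+249012*h^2-6693998*h+1994926)*c^3+(3252480*h^4+15368880*h^3+77454176*h^2-58656904*h+7483048)*c^2+(-6423616*h^4-267082160*h^3+415022768*h^2-140130272*h+5757760)*c-6064064*h^4-22097920*h^3+92784704*h^2-49784192*h+2237952)$, $F^{(5)}_{04123}=F^{(5)}_{03124}=(-2/5)*h*d*(150*c^6+(-10060*h+5380)*c^5+(217020*h^2-323853*h+57123)*c^4+(-1309760*h^3+6390724*h^2-2579346*h+268402)*c^3+(-4260480*h^4-40238760*h^3+32357832*h^2-9076728*h+462936)*c^2+(-18786432*h^4-72074440*h^3+67578896*h^2-10508984*h-23120)*c-177408*h^4+2717760*h^3-5096832*h^2+655296*h+173184)$,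 $F^{(5)}_{14023}=F^{(5)}_{13024}=(1/5)*h*d*(300*c^6+(-21770*h+9940)*c^5+(560760*h^2-582063*h+109113)*c^4+(-5812600*h^3+11260884*h^2-4433758*h+605494)*c^3+(17963520*h^4-68950320*h^3+47912508*h^2-16995684*h+1706256)*c^2+(-51812832*h^4-43962440*h^3+99510360*h^2-32440512*h+1356064)*c+1168224*h^4-12725760*h^3+26344416*h^2-11383488*h+503808)$. *)

theory Defs
  imports
    Complex_Main
    "HOL-Library.Groups_Big_Fun"
    "HOL-Combinatorics.Permutations"
begin

text \<open>
  The underlying complex vector space is the whole type \<open>'v\<close>.
  \<open>mode V a n b\<close> is $a_{(n)} b$, and \<open>par V 0\<close>, \<open>par V 1\<close> are the even and odd parts
  $V^0$, $V^1$; \<open>par\<close> is only ever used at \<open>0\<close> and \<open>1\<close>.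
\<close>

record 'v vertex_structure =
  scl :: "complex \<Rightarrow> 'v \<Rightarrow> 'v"
  mode :: "'v \<Rightarrow> int \<Rightarrow> 'v \<Rightarrow> 'v"
  vac :: 'v
  conf :: 'v
  par :: "nat \<Rightarrow> 'v set"

abbreviation vsubspace :: "'v::ab_group_add vertex_structure \<Rightarrow> 'v set \<Rightarrow> bool" where
  "vsubspace V \<equiv> module.subspace (scl V)"

abbreviation vspan :: "'v::ab_group_add vertex_structure \<Rightarrow> 'v set \<Rightarrow> 'v set" where
  "vspan V \<equiv> module.span (scl V)"

abbreviation vdim :: "'v::ab_group_add vertex_structure \<Rightarrow> 'v set \<Rightarrow> nat" where
  "vdim V \<equiv> vector_space.dim (scl V)"

abbreviation vendo :: "'v::ab_group_add vertex_structure \<Rightarrow> ('v \<Rightarrow> 'v) \<Rightarrow> bool" where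
  "vendo V \<equiv> Vector_Spaces.linear (scl V) (scl V)"

abbreviation vfunctional :: "'v::ab_group_add vertex_structure \<Rightarrow> ('v \<Rightarrow> complex) \<Rightarrow> bool" where
  "vfunctional V \<equiv> Vector_Spaces.linear (scl V) (*)"

definition direct_sum ::
    "'v::ab_group_add vertex_structure \<Rightarrow> 'i set \<Rightarrow> ('i \<Rightarrow> 'v set) \<Rightarrow> 'v set \<Rightarrow> bool" where
  "direct_sum V I M U \<longleftrightarrow>
     (\<forall>i\<in>I. vsubspace V (M i)) \<and>
     U = vspan V (\<Union>i\<in>I. M i) \<and>
     (\<forall>f. (\<forall>i\<in>I. f i \<in> M i) \<and> finite {i\<in>I. f i \<noteq> 0} \<and> (\<Sum>i | i \<in> I \<and> f i \<noteq> 0. f i) = 0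
        \<longrightarrow> (\<forall>i\<in>I. f i = 0))"

definition L :: "'v::ab_group_add vertex_structure \<Rightarrow> int \<Rightarrow> 'v \<Rightarrow> 'v" where
  "L V n = mode V (conf V) (n + 1)"

definition weight_space :: "'v::ab_group_add vertex_structure \<Rightarrow> real \<Rightarrow> 'v set" where
  "weight_space V r = {v. L V 0 v = scl V (of_real r) v}"

text \<open>
  The axiom \<open>borcherds\<close> is the Borcherds identity (the component form of the Jacobi identity) with
  the usual sign for two odd vectors.  All sums in it are finitely supported by \<open>truncation\<close>,
  and \<^const>\<open>Sum_any\<close> is the sum over the support.  The odd part may have integral or
  half-integral weights.
\<close>

locale svoa =
  fixes V :: "'v::ab_group_add vertex_structure" and c :: complex
  assumes complex_space: "vector_space (scl V)"
    and par_sum: "direct_sum V {0, 1} (par V) UNIV"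
    and mode_linear_left: "\<And>n b. vendo V (\<lambda>a. mode V a n b)"
    and mode_linear_right: "\<And>a n. vendo V (mode V a n)"
    and mode_parity: "\<And>p q a b n. \<lbrakk>p \<in> {0, 1}; q \<in> {0, 1}; a \<in> par V p; b \<in> par V q\<rbrakk>
          \<Longrightarrow> mode V a n b \<in> par V ((p + q) mod 2)"
    and truncation: "\<And>a b. \<exists>N. \<forall>n\<ge>N. mode V a n b = 0"
    and vac_even: "vac V \<in> par V 0"
    and vac_mode: "\<And>n b. mode V (vac V) n b = (if n = -1 then b else 0)"
    and creation: "\<And>a. mode V a (-1) (vac V) = a"
    and creation_nonneg: "\<And>a n. 0 \<le> n \<Longrightarrow> mode V a n (vac V) = 0"
    and borcherds: "\<And>p q a b u l m n. \<lbrakk>p \<in> {0, 1}; q \<in> {0, 1}; a \<in> par V p; b \<in> par V q\<rbrakk> \<Longrightarrow>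
          Sum_any (\<lambda>i. scl V (of_int m gchoose i) (mode V (mode V a (l + int i) b) (m + n - int i) u))
        = Sum_any (\<lambda>i. scl V ((-1) ^ i * (of_int l gchoose i))
            (mode V a (m + l - int i) (mode V b (n + int i) u)
             - scl V ((-1) ^ (p * q) * (-1) powi l)
                 (mode V b (n + l - int i) (mode V a (m + int i) u))))"
    and conf_even: "conf V \<in> par V 0"
    and virasoro: "\<And>m n v. L V m (L V n v) - L V n (L V m v)
          = scl V (of_int (m - n)) (L V (m + n) v)
            + (if m + n = 0 then scl V (of_int (m ^ 3 - m) / 12 * c) v else 0)"
    and translation: "\<And>a n b. mode V (L V (-1) a) n b = scl V (- of_int n) (mode V a (n - 1) b)"
    and grading: "direct_sum V {r. 2 * r \<in> \<int>} (weight_space V) UNIV"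
    and weight_finite: "\<And>r. \<exists>S. finite S \<and> weight_space V r = vspan V S"
    and weight_bounded: "\<exists>N. \<forall>r<N. weight_space V r = {0}"

definition cft_type :: "'v::ab_group_add vertex_structure \<Rightarrow> bool" where
  "cft_type V \<longleftrightarrow> (\<forall>r<0. weight_space V r = {0}) \<and> weight_space V 0 = vspan V {vac V}"

definition svoa_involution :: "'v::ab_group_add vertex_structure \<Rightarrow> ('v \<Rightarrow> 'v) \<Rightarrow> bool" where
  "svoa_involution V g \<longleftrightarrow>
     vendo V g \<and> (\<forall>a n b. g (mode V a n b) = mode V (g a) n (g b)) \<and>
     g (vac V) = vac V \<and> g (conf V) = conf V \<and> (\<forall>p\<in>{0, 1}. g ` par V p \<subseteq> par V p) \<and>
     g \<circ> g = id \<and> g \<noteq> id"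

definition plus_part :: "('v::ab_group_add \<Rightarrow> 'v) \<Rightarrow> 'v set" where
  "plus_part g = {a. g a = a}"

definition minus_part :: "('v::ab_group_add \<Rightarrow> 'v) \<Rightarrow> 'v set" where
  "minus_part g = {a. g a = - a}"

definition griess_space :: "'v::ab_group_add vertex_structure \<Rightarrow> ('v \<Rightarrow> 'v) \<Rightarrow> 'v set" where
  "griess_space V g = weight_space V 2 \<inter> plus_part g"

definition top_space :: "'v::ab_group_add vertex_structure \<Rightarrow> ('v \<Rightarrow> 'v) \<Rightarrow> real \<Rightarrow> 'v set" where
  "top_space V g h = weight_space V h \<inter> minus_part g"

definition weight_component :: "'v::ab_group_add vertex_structure \<Rightarrow> real \<Rightarrow> 'v \<Rightarrow> 'v" where
  "weight_component V r a =
     (THE b. b \<in> weight_space V r \<and> a - b \<in> vspan V (\<Union>s\<in>-{r}. weight_space V s))"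

text \<open>
  $\mathrm{o}(a) = a_{(\mathrm{wt}(a)-1)}$ for homogeneous \<open>a\<close> of integral weight, extended linearly.
  Components of weight in $\mathbb{Z}+1/2$ have no mode of index $\mathrm{wt}-1$ and contribute 0.
\<close>

definition zero_mode :: "'v::ab_group_add vertex_structure \<Rightarrow> 'v \<Rightarrow> 'v \<Rightarrow> 'v" where
  "zero_mode V a v = Sum_any (\<lambda>n::int. mode V (weight_component V (of_int n) a) (n - 1) v)"

text \<open>Meaningful only when \<open>U\<close> is a finite-dimensional subspace that \<open>T\<close> maps into itself.\<close>

definition trace_on :: "'v::ab_group_add vertex_structure \<Rightarrow> 'v set \<Rightarrow> ('v \<Rightarrow> 'v) \<Rightarrow> complex" where
  "trace_on V U T =
     (let S = (SOME S. \<not> module.dependent (scl V) S \<and> vspan V S = U)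
      in \<Sum>b\<in>S. module.representation (scl V) S (T b) b)"

text \<open>
  \<open>adjoint_mode V s w a n\<close> is the coefficient of $z^{-n-1}$ in
  $Y^*(a,z) = Y(e^{zL(1)} z^{-2L(0)} \zeta^{L(0) + 2 s L(0)^2} a, z^{-1})$
  for \<open>a\<close> of weight \<open>w\<close>, where $\zeta^r = e^{r \pi \sqrt{-1}}$: the contribution of
  $L(1)^j a / j!$ is $z^{j-2w} \sum_m (L(1)^j a)_{(m)} z^{m+1}$.
  The sign \<open>s\<close> selects between $\zeta^{L(0)+2L(0)^2}$ and $\zeta^{L(0)-2L(0)^2}$.
\<close>

definition adjoint_mode ::
    "'v::ab_group_add vertex_structure \<Rightarrow> real \<Rightarrow> real \<Rightarrow> 'v \<Rightarrow> int \<Rightarrow> 'v \<Rightarrow> 'v" where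
  "adjoint_mode V s w a n v = scl V (cis (pi * (w + 2 * s * w\<^sup>2)))
     (Sum_any (\<lambda>j::nat. scl V (1 / fact j)
        (mode V ((L V 1 ^^ j) a) (\<lfloor>2 * w\<rfloor> - n - 2 - int j) v)))"

definition adjoint_sign :: "'v::ab_group_add vertex_structure \<Rightarrow> real \<Rightarrow> real" where
  "adjoint_sign V h = (if par V 1 \<noteq> {0} \<and> (\<exists>m::int. h = 1/2 + 2 * of_int m) then -1 else 1)"

definition invariant_form ::
    "'v::ab_group_add vertex_structure \<Rightarrow> real \<Rightarrow> ('v \<Rightarrow> 'v \<Rightarrow> complex) \<Rightarrow> bool" where
  "invariant_form V s B \<longleftrightarrow>
     (\<forall>u. vfunctional V (B u)) \<and> (\<forall>v. vfunctional V (\<lambda>u. B u v)) \<and>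
     (\<forall>w. \<forall>a \<in> weight_space V w. \<forall>n u v. B (mode V a n u) v = B u (adjoint_mode V s w a n v))"

definition nondegenerate_on :: "'v::ab_group_add set \<Rightarrow> ('v \<Rightarrow> 'v \<Rightarrow> complex) \<Rightarrow> bool" where
  "nondegenerate_on U B \<longleftrightarrow>
     (\<forall>u\<in>U. (\<forall>v\<in>U. B u v = 0) \<longrightarrow> u = 0) \<and> (\<forall>v\<in>U. (\<forall>u\<in>U. B u v = 0) \<longrightarrow> v = 0)"

text \<open>The space of the contragredient module, $\bigoplus_n (V_n)^*$.\<close>

definition restricted_dual :: "'v::ab_group_add vertex_structure \<Rightarrow> ('v \<Rightarrow> complex) set" where
  "restricted_dual V =
     {f. vfunctional V f \<and> finite {r. \<exists>v \<in> weight_space V r. f v \<noteq> 0}}"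

text \<open>
  \<open>V\<close> is self-dual if it is isomorphic, as a \<open>V\<close>-module, to its contragredient module, on which
  $a_{(n)}$ acts as the transpose of the coefficient of $z^{-n-1}$ in $Y^*(a,z)$.
\<close>

definition self_dual :: "'v::ab_group_add vertex_structure \<Rightarrow> real \<Rightarrow> bool" where
  "self_dual V s \<longleftrightarrow>
     (\<exists>\<phi> :: 'v \<Rightarrow> 'v \<Rightarrow> complex.
        bij_betw \<phi> UNIV (restricted_dual V) \<and>
        (\<forall>v. vfunctional V (\<lambda>u. \<phi> u v)) \<and>
        (\<forall>w. \<forall>a \<in> weight_space V w. \<forall>n u v.
           \<phi> (mode V a n u) v = \<phi> u (adjoint_mode V s w a n v)))"

definition virasoro_subalgebra :: "'v::ab_group_add vertex_structure \<Rightarrow> 'v set" where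
  "virasoro_subalgebra V =
     (\<lambda>S. vsubspace V S \<and> vac V \<in> S \<and> (\<forall>a\<in>S. \<forall>n. \<forall>b\<in>S. mode V a n b \<in> S)) hull {conf V}"

definition virasoro_submodule :: "'v::ab_group_add vertex_structure \<Rightarrow> 'v \<Rightarrow> 'v set" where
  "virasoro_submodule V v = (\<lambda>S. vsubspace V S \<and> (\<forall>n. \<forall>x\<in>S. L V n x \<in> S)) hull {v}"

definition highest_weight_submodule ::
    "'v::ab_group_add vertex_structure \<Rightarrow> real \<Rightarrow> 'v set \<Rightarrow> bool" where
  "highest_weight_submodule V r M \<longleftrightarrow>
     (\<exists>v. v \<noteq> 0 \<and> v \<in> weight_space V r \<and> (\<forall>n>0. L V n v = 0) \<and> M = virasoro_submodule V v)"

definition virasoro_decomposable :: "'v::ab_group_add vertex_structure \<Rightarrow> bool" where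
  "virasoro_decomposable V \<longleftrightarrow>
     (\<exists>\<M>. (\<forall>M\<in>\<M>. \<exists>r. highest_weight_submodule V r M) \<and> direct_sum V \<M> (\<lambda>M. M) UNIV)"

text \<open>
  \<open>virasoro_component V r\<close> is $V[r]$.  The projection onto $V[0]$ is along the sum of all $V[r]$ with
  $r > 0$; this sum meets $V[0]$ trivially once the invariant form is non-degenerate on $V[0]$.
\<close>

definition virasoro_component :: "'v::ab_group_add vertex_structure \<Rightarrow> real \<Rightarrow> 'v set" where
  "virasoro_component V r = vspan V (\<Union>{M. highest_weight_submodule V r M})"

definition virasoro_projection :: "'v::ab_group_add vertex_structure \<Rightarrow> 'v \<Rightarrow> 'v" where
  "virasoro_projection V a =
     (THE b. b \<in> virasoro_component V 0 \<and> a - b \<in> vspan V (\<Union>r\<in>{0<..}. virasoro_component V r))"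

definition conformal_design ::
    "'v::ab_group_add vertex_structure \<Rightarrow> ('v \<Rightarrow> 'v) \<Rightarrow> real \<Rightarrow> nat \<Rightarrow> bool" where
  "conformal_design V g h t \<longleftrightarrow>
     (\<forall>a \<in> vspan V (\<Union>n\<in>{0..t}. weight_space V (of_nat n) \<inter> par V 0 \<inter> plus_part g).
        trace_on V (top_space V g h) (zero_mode V a) =
        trace_on V (top_space V g h) (zero_mode V (virasoro_projection V a)))"

definition gprod :: "'v::ab_group_add vertex_structure \<Rightarrow> 'v \<Rightarrow> 'v \<Rightarrow> 'v" where
  "gprod V x y = mode V x 1 y"

definition vac_coeff :: "'v::ab_group_add vertex_structure \<Rightarrow> 'v \<Rightarrow> complex" where
  "vac_coeff V v = (THE s. v = scl V s (vac V))"

definition gform :: "'v::ab_group_add vertex_structure \<Rightarrow> 'v \<Rightarrow> 'v \<Rightarrow> complex" where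
  "gform V x y = vac_coeff V (mode V x 3 y)"

definition gtri :: "'v::ab_group_add vertex_structure \<Rightarrow> 'v \<Rightarrow> 'v \<Rightarrow> 'v \<Rightarrow> complex" where
  "gtri V x y z = gform V (gprod V x y) z"

definition gfive :: "'v::ab_group_add vertex_structure \<Rightarrow> 'v \<Rightarrow> 'v \<Rightarrow> 'v \<Rightarrow> 'v \<Rightarrow> 'v \<Rightarrow> complex" where
  "gfive V a b c d e = vac_coeff V (mode V a 3 (mode V b 2 (mode V c 1 (mode V d 0 e))))"

text \<open>
  The expressions to be symmetrized are products of factors $(a^i|\omega)$, $(a^i|a^j)$ and
  $(a^i|a^j|a^k)$ in which every index occurs exactly once.  Since the forms are symmetric and
  scalars commute, such an expression is determined by the set partition of $\{0,\dots,t-1\}$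
  into the index sets of its factors, and distinct expressions correspond to distinct partitions.
  So \<open>Sym V t a P\<close> is the sum over the orbit of the partition \<open>P\<close> under permutations; for example
  \<open>Sym V 3 a {{0}, {1, 2}}\<close> is $\mathrm{Sym}\,(a^0|\omega)(a^1|a^2)$.
\<close>

definition factor :: "'v::ab_group_add vertex_structure \<Rightarrow> (nat \<Rightarrow> 'v) \<Rightarrow> nat set \<Rightarrow> complex" where
  "factor V a S = (case sorted_list_of_set S of
       [i] \<Rightarrow> gform V (a i) (conf V)
     | [i, j] \<Rightarrow> gform V (a i) (a j)
     | [i, j, k] \<Rightarrow> gtri V (a i) (a j) (a k)
     | _ \<Rightarrow> undefined)"

definition Sym ::
    "'v::ab_group_add vertex_structure \<Rightarrow> nat \<Rightarrow> (nat \<Rightarrow> 'v) \<Rightarrow> nat set set \<Rightarrow> complex" where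
  "Sym V t a P = (\<Sum>Q \<in> {(\<lambda>S. \<sigma> ` S) ` P | \<sigma>. \<sigma> permutes {..<t}}. \<Prod>S\<in>Q. factor V a S)"

definition D2 :: "complex \<Rightarrow> complex" where "D2 c = c"
definition D4 :: "complex \<Rightarrow> complex" where "D4 c = c * (5 * c + 22)"
definition D6 :: "complex \<Rightarrow> complex" where "D6 c = (2 * c - 1) * (7 * c + 68) * D4 c"
definition D8 :: "complex \<Rightarrow> complex" where "D8 c = (3 * c + 46) * (5 * c + 3) * D6 c"
definition D10 :: "complex \<Rightarrow> complex" where "D10 c = (11 * c + 232) * D8 c"

definition F3_0 :: "complex \<Rightarrow> complex \<Rightarrow> complex \<Rightarrow> complex" where
  "F3_0 c d h = 8 * h * d * ((70 * h^2 + 42 * h + 8) * c + 29 * h^2 - 57 * h - 2)"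

definition F3_1 :: "complex \<Rightarrow> complex \<Rightarrow> complex \<Rightarrow> complex" where
  "F3_1 c d h = -4 * h * d * ((14 * h + 4) * c^2 + (-308 * h^2 - 93 * h - 1) * c + 170 * h^2 +
     34 * h)"

definition F3_2 :: "complex \<Rightarrow> complex \<Rightarrow> complex \<Rightarrow> complex" where
  "F3_2 c d h = h * d * (4 * c^3 + (-222 * h - 1) * c^2 + (3008 * h^2 + 102 * h) * c - 1496 *
     h^2)"

definition F4_0 :: "complex \<Rightarrow> complex \<Rightarrow> complex \<Rightarrow> complex" where
  "F4_0 c d h = 16 * h * d * ((1050 * h^3 + 1260 * h^2 + 606 * h + 108) * c^2 + (3305 * h^3 -
     498 * h^2 - 701 * h + 78) * c - 251 * h^3 + 918 * h^2 - 829 * h - 6)"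

definition F4_1 :: "complex \<Rightarrow> complex \<Rightarrow> complex \<Rightarrow> complex" where
  "F4_1 c d h = -8 * h * d * ((210 * h^2 + 162 * h + 36) * c^3 + (-4620 * h^3 - 3227 * h^2 - 861
     * h + 26) * c^2 + (-5614 * h^3 + 2915 * h^2 - 485 * h - 2) * c - 1334 * h^3 + 2622 * h^2 +
     92 * h)"

definition F4_2 :: "complex \<Rightarrow> complex \<Rightarrow> complex \<Rightarrow> complex" where
  "F4_2 c d h = 2 * h * d * (60 * h * c^4 + (-3330 * h^2 - 523 * h - 487) * c^3 + (45120 * h^3 +
     9648 * h^2 + 13856 * h - 2336) * c^2 + (36376 * h^3 - 91186 * h^2 + 43550 * h - 2232) * c -
     6760 * h^3 - 47796 * h^2 + 19756 * h - 696)"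

definition F4_3 :: "complex \<Rightarrow> complex \<Rightarrow> complex \<Rightarrow> complex" where
  "F4_3 c d h = 4 * h * d * ((42 * h + 36) * c^4 + (-1848 * h^2 - 1279 * h + 513) * c^3 + (20328
     * h^3 + 13052 * h^2 - 14654 * h + 2334) * c^2 + (-35836 * h^3 + 98516 * h^2 - 43320 * h +
     2232) * c - 16700 * h^3 + 43104 * h^2 - 19756 * h + 696)"

definition F4_4 :: "complex \<Rightarrow> complex \<Rightarrow> complex \<Rightarrow> complex" where
  "F4_4 c d h = (1 / 2) * h * d * ((1128 * h + 199) * c^4 + (-46392 * h^2 - 3311 * h - 1768) *
     c^3 + (497472 * h^3 - 19488 * h^2 + 73544 * h - 16440) * c^2 + (351008 * h^3 - 726256 * h^2
     + 326804 * h - 17160) * c - 72848 * h^3 - 344832 * h^2 + 158048 * h - 5568)"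

definition F4_5 :: "complex \<Rightarrow> complex \<Rightarrow> complex \<Rightarrow> complex" where
  "F4_5 c d h = (-1 / 2) * h * d * (60 * c^5 + (-2976 * h + 1023) * c^4 + (44184 * h^2 - 41669 *
     h + 2850) * c^3 + (-164544 * h^3 + 426432 * h^2 - 65116 * h - 716) * c^2 + (-22112 * h^3 +
     23984 * h^2 + 13092 * h - 1528) * c + 68816 * h^3 - 150144 * h^2 + 25024 * h)"

definition F4_6 :: "complex \<Rightarrow> complex \<Rightarrow> complex \<Rightarrow> complex" where
  "F4_6 c d h = (1 / 2) * h * d * (60 * c^5 + (-2640 * h + 1311) * c^4 + (29400 * h^2 - 51901 *
     h + 6954) * c^3 + (-1920 * h^3 + 530848 * h^2 - 182348 * h + 17956) * c^2 + (-308800 * h^3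
     + 812112 * h^2 - 333468 * h + 16328) * c - 64784 * h^3 + 194688 * h^2 - 133024 * h + 5568)"

definition F5_0 :: "complex \<Rightarrow> complex \<Rightarrow> complex \<Rightarrow> complex" where
  "F5_0 c d h = 32 * h * d * ((11550 * h^4 + 23100 * h^3 + 20130 * h^2 + 8580 * h + 1440) * c^2
     + (76675 * h^4 + 30590 * h^3 - 25615 * h^2 - 10898 * h + 1608) * c + 3767 * h^4 - 18410 *
     h^3 + 29929 * h^2 - 16342 * h - 24)"

definition F5_1 :: "complex \<Rightarrow> complex \<Rightarrow> complex \<Rightarrow> complex" where
  "F5_1 c d h = -16 * h * d * ((2310 * h^3 + 3366 * h^2 + 1848 * h + 360) * c^3 + (-50820 * h^4
     - 64063 * h^3 - 39624 * h^2 - 9203 * h + 402) * c^2 + (-190058 * h^4 + 21757 * h^3 + 50420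
     * h^2 - 8593 * h - 6) * c + 14558 * h^4 - 53244 * h^3 + 48082 * h^2 + 348 * h)"

definition F5_2 :: "complex \<Rightarrow> complex \<Rightarrow> complex \<Rightarrow> complex" where
  "F5_2 c d h = (4 / 5) * h * d * ((3300 * h^2 + 660 * h - 40) * c^4 + (-183150 * h^3 - 90835 *
     h^2 - 94567 * h - 25578) * c^3 + (2481600 * h^4 + 1334700 * h^3 + 2540131 * h^2 + 285789 *
     h - 163830) * c^2 + (7115560 * h^4 - 13778670 * h^3 + 2299334 * h^2 + 2630452 * h - 245456)
     * c + 858872 * h^4 + 1045920 * h^3 - 6623912 * h^2 + 2211696 * h - 37056)"

definition F5_3 :: "complex \<Rightarrow> complex \<Rightarrow> complex \<Rightarrow> complex" where
  "F5_3 c d h = (8 / 5) * h * d * ((2310 * h^2 + 3300 * h + 920) * c^4 + (-101640 * h^3 - 123925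
     * h^2 + 2681 * h + 13794) * c^3 + (1118040 * h^4 + 1178540 * h^3 - 631298 * h^2 - 179402 *
     h + 81900) * c^2 + (-228580 * h^4 + 4993420 * h^3 - 750692 * h^2 - 1313196 * h + 122728) *
     c + 344284 * h^4 - 2043720 * h^3 + 3258596 * h^2 - 1105848 * h + 18528)"

definition F5_4 :: "complex \<Rightarrow> complex \<Rightarrow> complex \<Rightarrow> complex" where
  "F5_4 c d h = (1 / 5) * h * d * (500 * c^5 + (62040 * h^2 + 7735 * h + 25115) * c^4 +
     (-2551560 * h^3 - 564175 * h^2 - 1452063 * h + 94428) * c^3 + (27360960 * h^4 + 2744160 *
     h^3 + 30534534 * h^2 - 6099454 * h - 348380) * c^2 + (64210400 * h^4 - 208744320 * h^3 +
     91532216 * h^2 + 3799848 * h - 935504) * c - 909872 * h^4 - 64093920 * h^3 + 8306672 * h^2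
     + 7635744 * h - 148224)"

definition F5_5 :: "complex \<Rightarrow> complex \<Rightarrow> complex \<Rightarrow> complex" where
  "F5_5 c d h = (-1 / 5) * h * d * ((3300 * h + 1500) * c^5 + (-163680 * h^2 - 585 * h + 39235)
     * c^4 + (2430120 * h^3 - 2017145 * h^2 - 1433609 * h + 240084) * c^3 + (-9049920 * h^4 +
     31066560 * h^3 + 13487402 * h^2 - 7601082 * h + 456180) * c^2 + (-41190560 * h^4 - 16962080
     * h^3 + 49902728 * h^2 - 9779816 * h - 107152) * c - 808336 * h^4 + 9987680 * h^3 -
     17678384 * h^2 + 1778272 * h + 188928)"

definition F5_6 :: "complex \<Rightarrow> complex \<Rightarrow> complex \<Rightarrow> complex" where
  "F5_6 c d h = (1 / 5) * h * d * ((3300 * h + 1500) * c^5 + (-145200 * h^2 + 25815 * h + 46595)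
     * c^4 + (1617000 * h^3 - 3008545 * h^2 - 1412161 * h + 350436) * c^3 + (-105600 * h^4 +
     40494880 * h^3 + 8437018 * h^2 - 9036298 * h + 1111380) * c^2 + (-43019200 * h^4 + 22985280
     * h^3 + 43897192 * h^2 - 20285384 * h + 874672) * c + 1945936 * h^4 - 6362080 * h^3 +
     8390384 * h^2 - 7068512 * h + 337152)"

definition F5_7 :: "complex \<Rightarrow> complex \<Rightarrow> complex \<Rightarrow> complex" where
  "F5_7 c d h = (-2 / 5) * h * d * ((660 * h + 460) * c^5 + (-51150 * h^2 - 33647 * h + 6897) *
     c^4 + (1302180 * h^3 + 829156 * h^2 - 451426 * h + 40950) * c^3 + (-10919040 * h^4 -
     7782640 * h^3 + 9315274 * h^2 - 2071698 * h + 61364) * c^2 + (21416272 * h^4 - 59346500 *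
     h^3 + 27298188 * h^2 - 1866624 * h + 9264) * c + 9686000 * h^4 - 25000320 * h^3 + 11458480
     * h^2 - 403680 * h)"

definition F5_8 :: "complex \<Rightarrow> complex \<Rightarrow> complex \<Rightarrow> complex" where
  "F5_8 c d h = (-1 / 2) * h * d * (100 * c^6 + (-8078 * h + 2861) * c^5 + (221174 * h^2 -
     203081 * h + 19684) * c^4 + (-2214880 * h^3 + 4802538 * h^2 - 965274 * h + 52252) * c^3 +
     (4236288 * h^4 - 38346896 * h^3 + 13282628 * h^2 - 1695920 * h + 25584) * c^2 + (12825792 *
     h^4 - 32289856 * h^3 + 12276272 * h^2 - 758816 * h + 17536) * c - 155904 * h^4 - 1722368 *
     h^3 + 4176000 * h^2 - 215296 * h)"

definition F5_01423 :: "complex \<Rightarrow> complex \<Rightarrow> complex \<Rightarrow> complex" where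
  "F5_01423 c d h = (-1 / 10) * h * d * (500 * c^6 + (-33130 * h + 25625) * c^5 + (707230 * h^2
     - 1434751 * h + 485426) * c^4 + (-4128560 * h^3 + 27827338 * h^2 - 20020070 * h + 4414912)
     * c^3 + (-15989760 * h^4 - 192127280 * h^3 + 258582588 * h^2 - 134080200 * h + 15339472) *
     c^2 + (136946816 * h^4 - 932999600 * h^3 + 1000619648 * h^2 - 291521120 * h + 11640256) * c
     + 25836352 * h^4 - 152808960 * h^3 + 252283328 * h^2 - 102259584 * h + 4475904)"

definition F5_01324 :: "complex \<Rightarrow> complex \<Rightarrow> complex \<Rightarrow> complex" where
  "F5_01324 c d h = (1 / 10) * h * d * (500 * c^6 + (-35770 * h + 23785) * c^5 + (911830 * h^2 -
     1300163 * h + 457838) * c^4 + (-9337280 * h^3 + 24510714 * h^2 - 18214366 * h + 4251112) *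
     c^3 + (27686400 * h^4 - 160996720 * h^3 + 221321492 * h^2 - 125793408 * h + 15094016) * c^2
     + (51281728 * h^4 - 695613600 * h^3 + 891426896 * h^2 - 284054624 * h + 11603200) * c -
     12907648 * h^4 - 52807680 * h^3 + 206449408 * h^2 - 100644864 * h + 4475904)"

definition F5_12034 :: "complex \<Rightarrow> complex \<Rightarrow> complex \<Rightarrow> complex" where
  "F5_12034 c d h = (1 / 10) * h * d * (100 * c^6 + (-3150 * h + 5575) * c^5 + (15650 * h^2 -
     148721 * h + 119806) * c^4 + (-550800 * h^3 - 1490922 * h^2 - 4041146 * h + 949728) * c^3 +
     (14745600 * h^4 + 53833840 * h^3 + 29411876 * h^2 - 25511768 * h + 3284592) * c^2 +
     (-167754624 * h^4 + 73524400 * h^3 + 137639360 * h^2 - 61086944 * h + 2624448) * c +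
     3115968 * h^4 - 16839680 * h^3 + 31808832 * h^2 - 21690496 * h + 1007616)"

definition F5_01234 :: "complex \<Rightarrow> complex \<Rightarrow> complex \<Rightarrow> complex" where
  "F5_01234 c d h = h * d * (50 * c^6 + (-5304 * h + 1238) * c^5 + (204604 * h^2 - 99615 * h +
     13827) * c^4 + (-3383208 * h^3 + 2721160 * h^2 - 892294 * h + 59250) * c^3 + (20120832 *
     h^4 - 26868960 * h^3 + 17636364 * h^2 - 3522876 * h - 65568) * c^2 + (41237472 * h^4 -
     107859720 * h^3 + 46229896 * h^2 - 423632 * h - 256192) * c - 772320 * h^4 - 27659904 * h^3
     + 9574560 * h^2 + 1892928 * h - 31488)"

definition F5_02134 :: "complex \<Rightarrow> complex \<Rightarrow> complex \<Rightarrow> complex" where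
  "F5_02134 c d h = (-1 / 10) * h * d * (100 * c^6 + (150 * h + 7215) * c^5 + (-237790 * h^2 -
     280007 * h + 130072) * c^4 + (5835360 * h^3 + 1550206 * h^2 - 5491014 * h + 812348) * c^3 +
     (-38223360 * h^4 + 30779440 * h^3 + 63018188 * h^2 - 27827312 * h + 1723824) * c^2 +
     (-139274688 * h^4 - 126848480 * h^3 + 208934224 * h^2 - 38241856 * h - 180160) * c + 69888
     * h^4 + 19482880 * h^3 - 41267328 * h^2 + 3697664 * h + 692736)"

definition F5_03214 :: "complex \<Rightarrow> complex \<Rightarrow> complex \<Rightarrow> complex" where
  "F5_03214 c d h = (1 / 5) * h * d * ((1650 * h + 820) * c^5 + (-126720 * h^2 - 65643 * h +
     5133) * c^4 + (3193080 * h^3 + 1520564 * h^2 - 724934 * h - 68690) * c^3 + (-26484480 * h^4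
     - 11527200 * h^3 + 16803156 * h^2 - 1157772 * h - 780384) * c^2 + (14239968 * h^4 -
     100186440 * h^3 + 35647432 * h^2 + 11422544 * h - 1402304) * c - 1523040 * h^4 + 18161280 *
     h^3 - 36538080 * h^2 + 12694080 * h - 157440)"

definition F5_02413 :: "complex \<Rightarrow> complex \<Rightarrow> complex \<Rightarrow> complex" where
  "F5_02413 c d h = (-1 / 5) * h * d * ((3630 * h + 5660) * c^5 + (-199320 * h^2 - 209673 * h +
     193503) * c^4 + (3472920 * h^3 + 1907324 * h^2 - 7596850 * h + 2076826) * c^3 + (-18585600
     * h^4 - 196400 * h^3 + 96084724 * h^2 - 62800300 * h + 7605776) * c^2 + (36408928 * h^4 -
     385775160 * h^3 + 469619144 * h^2 - 143863520 * h + 5776288) * c + 13307936 * h^4 -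
     72098560 * h^3 + 115701664 * h^2 - 50591552 * h + 2237952)"

definition F5_02314 :: "complex \<Rightarrow> complex \<Rightarrow> complex \<Rightarrow> complex" where
  "F5_02314 c d h = (1 / 5) * h * d * ((2310 * h + 4740) * c^5 + (-97020 * h^2 - 142379 * h +
     179709) * c^4 + (868560 * h^3 + 249012 * h^2 - 6693998 * h + 1994926) * c^3 + (3252480 *
     h^4 + 15368880 * h^3 + 77454176 * h^2 - 58656904 * h + 7483048) * c^2 + (-6423616 * h^4 -
     267082160 * h^3 + 415022768 * h^2 - 140130272 * h + 5757760) * c - 6064064 * h^4 - 22097920
     * h^3 + 92784704 * h^2 - 49784192 * h + 2237952)"

definition F5_04123 :: "complex \<Rightarrow> complex \<Rightarrow> complex \<Rightarrow> complex" where
  "F5_04123 c d h = (-2 / 5) * h * d * (150 * c^6 + (-10060 * h + 5380) * c^5 + (217020 * h^2 -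
     323853 * h + 57123) * c^4 + (-1309760 * h^3 + 6390724 * h^2 - 2579346 * h + 268402) * c^3 +
     (-4260480 * h^4 - 40238760 * h^3 + 32357832 * h^2 - 9076728 * h + 462936) * c^2 +
     (-18786432 * h^4 - 72074440 * h^3 + 67578896 * h^2 - 10508984 * h - 23120) * c - 177408 *
     h^4 + 2717760 * h^3 - 5096832 * h^2 + 655296 * h + 173184)"

definition F5_14023 :: "complex \<Rightarrow> complex \<Rightarrow> complex \<Rightarrow> complex" where
  "F5_14023 c d h = (1 / 5) * h * d * (300 * c^6 + (-21770 * h + 9940) * c^5 + (560760 * h^2 -
     582063 * h + 109113) * c^4 + (-5812600 * h^3 + 11260884 * h^2 - 4433758 * h + 605494) * c^3
     + (17963520 * h^4 - 68950320 * h^3 + 47912508 * h^2 - 16995684 * h + 1706256) * c^2 +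
     (-51812832 * h^4 - 43962440 * h^3 + 99510360 * h^2 - 32440512 * h + 1356064) * c + 1168224
     * h^4 - 12725760 * h^3 + 26344416 * h^2 - 11383488 * h + 503808)"

text \<open>
  The coefficients $F^{(5)}_{i_0 i_1 i_2 i_3 i_4}$ with their index tuples, one for each of the
  15 distinct terms $(a^{i_0} a^{i_1} | a^{i_2} | a^{i_3} a^{i_4})$.
\<close>

definition F5_list ::
    "((complex \<Rightarrow> complex \<Rightarrow> complex \<Rightarrow> complex) \<times> nat \<times> nat \<times> nat \<times> nat \<times> nat) list" where
  "F5_list =
    [(F5_01423, 0, 1, 4, 2, 3),
     (F5_01324, 0, 1, 3, 2, 4),
     (F5_12034, 1, 2, 0, 3, 4),
     (F5_01234, 0, 1, 2, 3, 4),
     (F5_02134, 0, 2, 1, 3, 4),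
     (F5_03214, 0, 3, 2, 1, 4), (F5_03214, 0, 4, 2, 1, 3),
     (F5_02413, 0, 2, 4, 1, 3), (F5_02413, 0, 3, 4, 1, 2),
     (F5_02314, 0, 2, 3, 1, 4), (F5_02314, 0, 4, 3, 1, 2),
     (F5_04123, 0, 4, 1, 2, 3), (F5_04123, 0, 3, 1, 2, 4),
     (F5_14023, 1, 4, 0, 2, 3), (F5_14023, 1, 3, 0, 2, 4)]"

definition sum_star ::
    "'v::ab_group_add vertex_structure \<Rightarrow> complex \<Rightarrow> complex \<Rightarrow> complex \<Rightarrow> (nat \<Rightarrow> 'v) \<Rightarrow> complex" where
  "sum_star V c d h a =
     (\<Sum>(F, i0, i1, i2, i3, i4)\<leftarrow>F5_list.
        F c d h * gtri V (gprod V (a i0) (a i1)) (a i2) (gprod V (a i3) (a i4)))"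

end

theory Submission
  imports Defs
begin

text \<open>
  On the top level \<open>V\<^sub>h\<close> Zhu's product turns a product of zero-modes into the zero-mode of a single
  vector, and the design condition kills the trace of every vector of small weight that is orthogonal
  to the Virasoro vacuum module. Decompose \<open>V\<^sub>2\<close> into \<open>\<complex>\<omega>\<close>, on which zero-modes are scalar, and the
  primary vectors. For primary \<open>a\<close>, \<open>b\<close> the traces of \<open>o(a\<^sub>(\<^sub>3\<^sub>-\<^sub>n\<^sub>) b)\<close> are \<open>(a|b)\<close> times explicit functions of
  \<open>c\<close> and \<open>h\<close>, while Zhu's relations give linear relations among them. If \<open>(a|b) \<noteq> 0\<close>, a 6-design
  therefore forces \<open>248h\<^sup>2 - (31c + 124)h + c\<^sup>2 + 7c + 4 = 0\<close>, which is what makes the formula of degree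
  three hold, and an 8-design forces \<open>h = c = 1/2\<close>, contradicting \<open>D\<^sub>6(c) \<noteq> 0\<close>. Hence an 8-design has
  \<open>V\<^sub>2 = \<complex>\<omega>\<close>, and the formulae of degrees four and five become polynomial identities in \<open>c\<close> and \<open>h\<close>.
\<close>

section \<open>Orbits of set partitions\<close>

text \<open>The conditions are overdetermined because the traces of the vectors a_(3-n) b are found
  twice: Zhu's relation is a linear recursion in n, and the design evaluates each trace from the
  projection to the vacuum module. These projections are not computed by inverting Gram matrices. A
  vector of positive weight is orthogonal to the vacuum module as soon as its images under L(1) and
  L(2) are, so an explicit candidate is verified by recursion on the weight, with all identities
  kept multiplied by D_n(c). For three primary vectors a, b, v the same argument is run relative to
  the Virasoro module generated by a. The system that fixes the descendants of b v to be subtracted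
  has determinant 5c + 44, which is no factor of D_6(c). The quadratic relation excludes its
  vanishing because h > 0, and the coefficient \<open>F3_2\<close> comes out only modulo that
  relation. The space V_2 is defined inside V^+, so its odd vectors have to be excluded before
  commutator formulas for even vectors apply. Once V_2 is a line, a symmetrization matters only
  through its number of terms, hence the orbit counts.\<close>

lemma ex_permutes_image_eq:
  assumes "finite A" "X \<subseteq> A" "Y \<subseteq> A" "card X = card Y"
  obtains p where "p permutes A" "p ` X = Y"
proof -
  have fin: "finite X" "finite Y" using assms finite_subset by auto
  obtain f where f: "bij_betw f X Y" using finite_same_card_bij[OF fin assms(4)] by auto
  have "card (A - X) = card (A - Y)" using assms fin by (simp add: card_Diff_subset)
  then obtain f' where f': "bij_betw f' (A - X) (A - Y)"
    using finite_same_card_bij[of "A - X" "A - Y"] assms(1) by auto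
  define p where "p x = (if x \<in> X then f x else if x \<in> A then f' x else x)" for x
  have "bij_betw p X Y \<longleftrightarrow> bij_betw f X Y" "bij_betw p (A - X) (A - Y) \<longleftrightarrow> bij_betw f' (A - X) (A - Y)"
    by (rule bij_betw_cong; simp add: p_def)+
  hence "bij_betw p X Y" "bij_betw p (A - X) (A - Y)" using f f' by auto
  hence "bij_betw p (X \<union> (A - X)) (Y \<union> (A - Y))" by (rule bij_betw_combine) auto
  moreover have "X \<union> (A - X) = A" "Y \<union> (A - Y) = A" using assms by auto
  ultimately have "p permutes A"
    using assms(2) by (intro bij_imp_permutes) (auto simp: p_def)
  moreover have "p ` X = Y" using \<open>bij_betw p X Y\<close> bij_betw_imp_surj_on by auto
  ultimately show ?thesis using that by blast
qed

lemma card_image_fibers: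
  assumes "finite A" "\<And>x. x \<in> A \<Longrightarrow> card {y \<in> A. f y = f x} = k"
  shows "card A = k * card (f ` A)"
proof -
  have "card A = (\<Sum>q\<in>f ` A. card {y \<in> A. f y = q})"
    using sum.group[of A "f ` A" f "\<lambda>_. 1::nat"] assms(1) by simp
  also have "\<dots> = (\<Sum>q\<in>f ` A. k)" by (rule sum.cong) (use assms(2) in auto)
  finally show ?thesis by simp
qed

text \<open>The index set of the sum in \<open>Sym\<close>. Its size is the number of terms of the
  symmetrization.\<close>

definition orbit :: "nat \<Rightarrow> nat set set \<Rightarrow> nat set set set" where
  "orbit t P = {(\<lambda>S. \<sigma> ` S) ` P | \<sigma>. \<sigma> permutes {..<t}}"

lemma permutes_image_Diff: "p permutes A \<Longrightarrow> X \<subseteq> A \<Longrightarrow> p ` (A - X) = A - p ` X"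
  by (metis image_set_diff permutes_image permutes_inj)

text \<open>The block \<open>X\<close> is the only one whose size differs from 1, so the partition
  determines \<open>X\<close>, and the orbit is in bijection with the subsets of that size.\<close>

lemma card_orbit_singletons:
  assumes "X \<subseteq> {..<t}" "card X \<noteq> 1"
  shows "card (orbit t (insert X ((\<lambda>i. {i}) ` ({..<t} - X)))) = t choose card X"
proof -
  let ?F = "\<lambda>X. insert X ((\<lambda>i. {i}) ` ({..<t} - X))"
  have image: "(\<lambda>S. p ` S) ` ?F X = ?F (p ` X)" if "p permutes {..<t}" for p
    by (simp add: image_image flip: permutes_image_Diff[OF that assms(1)])
  have "orbit t (?F X) = ?F ` {Y. Y \<subseteq> {..<t} \<and> card Y = card X}"
  proof (intro equalityI subsetI)
    fix Q assume "Q \<in> orbit t (?F X)"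
    then obtain p where p: "p permutes {..<t}" "Q = (\<lambda>S. p ` S) ` ?F X" unfolding orbit_def by auto
    have "p ` X \<subseteq> {..<t}" using image_mono[OF assms(1), of p] permutes_image[OF p(1)] by simp
    moreover have "card (p ` X) = card X" by (rule card_image[OF permutes_inj_on[OF p(1)]])
    ultimately    show "Q \<in> ?F ` {Y. Y \<subseteq> {..<t} \<and> card Y = card X}" using p(2) image[OF p(1)]
        by auto
  next
    fix Q assume "Q \<in> ?F ` {Y. Y \<subseteq> {..<t} \<and> card Y = card X}"
    then obtain Y where Y: "Y \<subseteq> {..<t}" "card Y = card X" "Q = ?F Y" by auto
    obtain p where p: "p permutes {..<t}" "p ` X = Y"
      using ex_permutes_image_eq[of "{..<t}" X Y] assms(1) Y by auto
    have "Q = (\<lambda>S. p ` S) ` ?F X" using image[OF p(1)] Y(3) p(2) by simp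
    thus "Q \<in> orbit t (?F X)" using p(1) unfolding orbit_def by blast
  qed
  moreover have "inj_on ?F {Y. Y \<subseteq> {..<t} \<and> card Y = card X}"
  proof (rule inj_onI)
    fix Y Z assume YZ: "Y \<in> {Y. Y \<subseteq> {..<t} \<and> card Y = card X}"
      "Z \<in> {Y. Y \<subseteq> {..<t} \<and> card Y = card X}" "?F Y = ?F Z"
    hence "Y \<in> ?F Z" by blast
    moreover have "card Y \<noteq> 1" using YZ assms(2) by auto
    ultimately show "Y = Z" by (auto simp: card_1_singleton_iff)
  qed
  ultimately show ?thesis by (simp add: card_image n_subsets)
qed

text \<open>The two blocks differ in size, so the one of size \<open>card X\<close> can be recovered
  from the partition.\<close>

lemma card_orbit_complement:
  assumes "X \<subseteq> {..<t}" "2 * card X \<noteq> t"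
  shows "card (orbit t {X, {..<t} - X}) = t choose card X"
proof -
  let ?F = "\<lambda>X. {X, {..<t} - X}" and ?D = "{Y. Y \<subseteq> {..<t} \<and> card Y = card X}"
  have image: "(\<lambda>S. p ` S) ` ?F X = ?F (p ` X)" if "p permutes {..<t}" for p
    using permutes_image_Diff[OF that assms(1)] by simp
  have "orbit t (?F X) = ?F ` ?D"
  proof (intro equalityI subsetI)
    fix Q assume "Q \<in> orbit t (?F X)"
    then obtain p where p: "p permutes {..<t}" "Q = (\<lambda>S. p ` S) ` ?F X" unfolding orbit_def by auto
    have "p ` X \<subseteq> {..<t}" using image_mono[OF assms(1), of p] permutes_image[OF p(1)] by simp
    moreover have "card (p ` X) = card X" by (rule card_image[OF permutes_inj_on[OF p(1)]])
    ultimately show "Q \<in> ?F ` ?D" using p(2) image[OF p(1)] by auto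
  next
    fix Q assume "Q \<in> ?F ` ?D"
    then obtain Y where Y: "Y \<subseteq> {..<t}" "card Y = card X" "Q = ?F Y" by auto
    obtain p where p: "p permutes {..<t}" "p ` X = Y"
      using ex_permutes_image_eq[of "{..<t}" X Y] assms(1) Y by auto
    have "Q = (\<lambda>S. p ` S) ` ?F X" using image[OF p(1)] Y(3) p(2) by simp
    thus "Q \<in> orbit t (?F X)" using p(1) unfolding orbit_def by blast
  qed
  moreover have "inj_on ?F ?D"
  proof (rule inj_onI)
    fix Y Z assume YZ: "Y \<in> ?D" "Z \<in> ?D" "?F Y = ?F Z"
    have "card ({..<t} - Z) = t - card X" "card X \<le> t"
      using YZ card_mono[of "{..<t}" Z] finite_subset[of Z "{..<t}"]
          by (auto simp: card_Diff_subset)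
    thus "Y = Z" using YZ assms(2) by (auto simp: doubleton_eq_iff)
  qed
  ultimately show ?thesis by (simp add: card_image n_subsets)
qed

text \<open>Each partition in the orbit arises from exactly two ordered pairs of disjoint
  two-element blocks; the factor 2 on the left avoids a division.\<close>

lemma card_orbit_two_pairs:
  assumes "X \<subseteq> {..<t}" "Y \<subseteq> {..<t} - X" "card X = 2" "card Y = 2"
  shows "2 * card (orbit t ({X, Y} \<union> (\<lambda>i. {i}) ` ({..<t} - X - Y))) =
      (t choose 2) * ((t - 2) choose 2)"
proof -
  let ?F = "\<lambda>(X, Y). {X, Y} \<union> (\<lambda>i. {i}) ` ({..<t} - X - Y)"
  let ?D = "SIGMA X:{X. X \<subseteq> {..<t} \<and> card X = 2}. {Y. Y \<subseteq> {..<t} - X \<and> card Y = 2}"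
  have image: "(\<lambda>S. p ` S) ` ?F (X, Y) = ?F (p ` X, p ` Y)" if "p permutes {..<t}" for p
  proof -
    have "p ` ({..<t} - X - Y) = {..<t} - p ` X - p ` Y"
      using permutes_inj[OF that] permutes_image[OF that] by (simp add: image_set_diff)
    thus ?thesis by (simp add: image_Un image_image flip: \<open>p ` ({..<t} - X - Y) = _\<close>)
  qed
  have "orbit t (?F (X, Y)) = ?F ` ?D"
  proof (intro equalityI subsetI)
    fix Q assume "Q \<in> orbit t (?F (X, Y))"
    then obtain p where p: "p permutes {..<t}" "Q = (\<lambda>S. p ` S) ` ?F (X, Y)" unfolding orbit_def
        by auto
    have "p ` X \<subseteq> {..<t}" using image_mono[OF assms(1), of p] permutes_image[OF p(1)] by simp
    moreover have "p ` Y \<subseteq> {..<t} - p ` X"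
      using image_mono[OF assms(2), of p] permutes_image_Diff[OF p(1) assms(1)] by simp
    moreover have "card (p ` Z) = card Z" for Z by (rule card_image[OF permutes_inj_on[OF p(1)]])
    ultimately have "(p ` X, p ` Y) \<in> ?D" using assms(3,4) by simp
    thus "Q \<in> ?F ` ?D" unfolding p(2) image[OF p(1)] by (rule imageI)
  next
    fix Q assume "Q \<in> ?F ` ?D"
    then obtain X' Y' where XY: "X' \<subseteq> {..<t}" "card X' = 2" "Y' \<subseteq> {..<t} - X'" "card Y' = 2" "Q =
        ?F (X', Y')"
      by auto
    obtain p where p: "p permutes {..<t}" "p ` X = X'"
      using ex_permutes_image_eq[of "{..<t}" X X'] assms(1,3) XY by auto
    have pY: "p ` Y \<subseteq> {..<t} - X'" "card (p ` Y) = card Y'"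
      using image_mono[OF assms(2), of p] permutes_image_Diff[OF p(1) assms(1)] p(2) assms(4) XY(4)
        card_image[OF permutes_inj_on[OF p(1)], of Y] by auto
    obtain q where q: "q permutes {..<t} - X'" "q ` p ` Y = Y'"
      using ex_permutes_image_eq[of "{..<t} - X'" "p ` Y" Y'] pY XY by auto
    \<comment> \<open>\<open>q\<close> moves only points outside \<open>X'\<close>, so composing
      with it corrects the image of \<open>Y\<close> without disturbing that of
      \<open>X\<close>.\<close>
    have "q ` X' = X'" using q(1) by (auto simp: permutes_def image_def)
    hence "(q \<circ> p) ` X = X'" "(q \<circ> p) ` Y = Y'" using p q by (auto simp: image_comp[symmetric])
    moreover have qp: "(q \<circ> p) permutes {..<t}"
      using permutes_compose[OF p(1) permutes_subset[OF q(1)]] by auto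
    ultimately have "Q = (\<lambda>S. (q \<circ> p) ` S) ` ?F (X, Y)" using image[OF qp] XY(5) by simp
    thus "Q \<in> orbit t (?F (X, Y))" using qp unfolding orbit_def by blast
  qed
  moreover have "card ?D = 2 * card (?F ` ?D)"
  proof (rule card_image_fibers)
    show "finite ?D" by (rule finite_subset[of _ "Pow {..<t} \<times> Pow {..<t}"]) auto
    fix z assume z: "z \<in> ?D"
    obtain Z W where ZW: "z = (Z, W)" by force
    have sym: "?F (W, Z) = ?F (Z, W)" for Z W
    proof -
      have "{..<t} - W - Z = {..<t} - Z - W" by blast
      thus ?thesis by (simp only: prod.case insert_commute)
    qed
    \<comment> \<open>Filtering the blocks by size recovers the unordered pair from the partition,
      so a fiber consists of a pair and its swap.\<close>
    have pairs: "{S \<in> ?F (Z, W). card S = 2} = {Z, W}" if "(Z, W) \<in> ?D" for Z W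
      using that by auto
    have *: "?F (Z', W') = ?F (Z, W) \<longleftrightarrow> (Z', W') = (Z, W) \<or> (Z', W') =
        (W, Z)" if "(Z', W') \<in> ?D" for Z' W'
    proof
      assume "?F (Z', W') = ?F (Z, W)"
      hence "{Z', W'} = {Z, W}" using pairs[OF that] pairs[of Z W] z ZW by metis
      thus "(Z', W') = (Z, W) \<or> (Z', W') = (W, Z)" by (auto simp: doubleton_eq_iff)
    qed (use sym in \<open>auto simp only: prod.inject\<close>)
    have D: "(W, Z) \<in> ?D" "(Z, W) \<in> ?D" using z ZW by auto
    have "{y \<in> ?D. ?F y = ?F z} = {(Z, W), (W, Z)}"
    proof (intro equalityI subsetI)
      fix y assume y: "y \<in> {y \<in> ?D. ?F y = ?F z}"
      obtain Z' W' where y': "y = (Z', W')" by (rule prod.exhaust)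
      have "(Z', W') \<in> ?D" "?F (Z', W') = ?F (Z, W)" using y unfolding y' ZW
          by (simp_all only: mem_Collect_eq)
      hence "(Z', W') = (Z, W) \<or> (Z', W') = (W, Z)" using *[of Z' W'] by (simp only:)
      thus "y \<in> {(Z, W), (W, Z)}" unfolding y' by (simp only: insert_iff simp_thms empty_iff)
    next
      fix y assume "y \<in> {(Z, W), (W, Z)}"
      thus "y \<in> {y \<in> ?D. ?F y = ?F z}" using D sym[of W Z] ZW by (elim insertE) simp_all
    qed
    moreover have "Z \<noteq> W" using z ZW by (cases "W = {}") auto
    ultimately show "card {y \<in> ?D. ?F y = ?F z} = 2" by simp
  qed
  moreover have "card ?D = (t choose 2) * ((t - 2) choose 2)"
  proof -
    have "card {Y. Y \<subseteq> {..<t} - Z \<and> card Y = 2} = (t - 2) choose 2" if "Z \<subseteq> {..<t}" "card Z =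
        2" for Z
      using that by (subst n_subsets) (auto simp: card_Diff_subset finite_subset)
    thus ?thesis by (subst card_SigmaI) (auto simp: n_subsets)
  qed
  ultimately show ?thesis by simp
qed

section \<open>Polynomial identities\<close>

text \<open>This is the degree four formula with every argument equal to omega: (omega|omega) = c/2,
  (omega|omega|omega) = c, (omega omega|omega omega) = 2c, and 6, 4, 3 count the terms of the three
  \<open>Sym\<close> sums. The right side is \<open>D8 c\<close> times the trace, since o(omega) is
  the scalar h on a space of dimension d.\<close>

lemma polynomial_4:
  "F4_0 c d h * (c / 2) ^ 4 + 6 * (F4_1 c d h * (c / 2) ^ 3) + 4 * (F4_2 c d h * (c / 2) * c)
    + 3 * (F4_3 c d h * (c / 2) ^ 2) + (F4_4 c d h + F4_5 c d h + F4_6 c d h) * (2 * c) =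
        D8 c * h ^ 4 * d"
  unfolding F4_0_def F4_1_def F4_2_def F4_3_def F4_4_def F4_5_def F4_6_def D8_def D6_def D4_def
  by (simp add: field_simps power_divide) algebra

text \<open>The degree five formula with every argument equal to omega. The new values are 4c for
  (omega omega|omega|omega omega) and 6c for the five-fold scalar; a coefficient shared by two index
  tuples carries the factor 2.\<close>

lemma polynomial_5:
  "F5_0 c d h * (c / 2) ^ 5 + 10 * (F5_1 c d h * (c / 2) ^ 4) + 10 * (F5_2 c d h * (c / 2) ^ 2 * c)
    + 15 * (F5_3 c d h * (c / 2) ^ 3) + 5 * ((F5_4 c d h + F5_5 c d h
        + F5_6 c d h) * (c / 2) * (2 * c))
    + 10 * (F5_7 c d h * (c / 2) * c) + F5_8 c d h * (6 * c)
    + (F5_01423 c d h + F5_01324 c d h + F5_12034 c d h + F5_01234 c d h + F5_02134 c d h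
      + 2 * (F5_03214 c d h + F5_02413 c d h + F5_02314 c d h + F5_04123 c d h
          + F5_14023 c d h)) * (4 * c)
   = D10 c * h ^ 5 * d"
  unfolding F5_0_def F5_1_def F5_2_def F5_3_def F5_4_def F5_5_def F5_6_def F5_7_def F5_8_def
    F5_01423_def F5_01324_def F5_12034_def F5_01234_def F5_02134_def F5_03214_def F5_02413_def
    F5_02314_def F5_04123_def F5_14023_def D10_def D8_def D6_def D4_def
  by (simp add: field_simps power_divide) algebra

text \<open>Multilinearity for arguments l_i omega. The coefficients are variables here, so that the
  large polynomials are not expanded a second time; \<open>expand_5\<close> serves the same
  purpose.\<close>

lemma expand_4:
  fixes c :: complex
  shows "l0 * l1 * l2 * l3 * (f0 * (c / 2) ^ 4 + 6 * (f1 * (c / 2) ^ 3) + 4 * (f2 * (c / 2) * c)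
    + 3 * (f3 * (c / 2) ^ 2) + (f4 + f5 + f6) * (2 * c)) =
        f0 * (l0 * (c / 2)) * (l1 * (c / 2)) * (l2 * (c / 2)) * (l3 * (c / 2))
    + f1 * (6 * (c / 2) ^ 3 * (l0 * l1 * l2 * l3)) + f2 * (4 * (c / 2 * c) * (l0 * l1 * l2 * l3))
        + f3 * (3 * (c / 2) ^ 2 * (l0 * l1 * l2 * l3))
    + f4 * (2 * l0 * l1 * (2 * l2 * l3) * (c / 2)) + f5 * (2 * l0 * l2 * (2 * l1 * l3) * (c / 2))
        + f6 * (2 * l0 * l3 * (2 * l1 * l2) * (c / 2))"
  by (simp add: field_simps power_divide) (simp add: eval_nat_numeral)

lemma expand_5:
  fixes c :: complex
  shows "l0 * l1 * l2 * l3 * l4 * (f0 * (c / 2) ^ 5 + 10 * (f1 * (c / 2) ^ 4)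
      + 10 * (f2 * (c / 2) ^ 2 * c)
    + 15 * (f3 * (c / 2) ^ 3) + 5 * ((f4 + f5 + f6) * (c / 2) * (2 * c))
    + 10 * (f7 * (c / 2) * c) + f8 * (6 * c) + e * (4 * c)) =
        f0 * (l0 * (c / 2)) * (l1 * (c / 2)) * (l2 * (c / 2)) * (l3 * (c / 2)) * (l4 * (c / 2))
    + f1 * (10 * (c / 2) ^ 4 * (l0 * l1 * l2 * l3 * l4))
        + f2 * (10 * ((c / 2) ^ 2 * c) * (l0 * l1 * l2 * l3 * l4))
        + f3 * (15 * (c / 2) ^ 3 * (l0 * l1 * l2 * l3 * l4))
    + f4 * (l0 * (c / 2) * (2 * l1 * l2 * (2 * l3 * l4) * (c / 2))
        + l1 * (c / 2) * (2 * l0 * l2 * (2 * l3 * l4) * (c / 2))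
        + l2 * (c / 2) * (2 * l0 * l1 * (2 * l3 * l4) * (c / 2))
        + l3 * (c / 2) * (2 * l0 * l1 * (2 * l2 * l4) * (c / 2))
        + l4 * (c / 2) * (2 * l0 * l1 * (2 * l2 * l3) * (c / 2)))
        + f5 * (l0 * (c / 2) * (2 * l1 * l3 * (2 * l2 * l4) * (c / 2))
        + l1 * (c / 2) * (2 * l0 * l3 * (2 * l2 * l4) * (c / 2))
        + l2 * (c / 2) * (2 * l0 * l3 * (2 * l1 * l4) * (c / 2))
        + l3 * (c / 2) * (2 * l0 * l2 * (2 * l1 * l4) * (c / 2))
        + l4 * (c / 2) * (2 * l0 * l2 * (2 * l1 * l3) * (c / 2)))
        + f6 * (l0 * (c / 2) * (2 * l1 * l4 * (2 * l2 * l3) * (c / 2))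
        + l1 * (c / 2) * (2 * l0 * l4 * (2 * l2 * l3) * (c / 2))
        + l2 * (c / 2) * (2 * l0 * l4 * (2 * l1 * l3) * (c / 2))
        + l3 * (c / 2) * (2 * l0 * l4 * (2 * l1 * l2) * (c / 2))
        + l4 * (c / 2) * (2 * l0 * l3 * (2 * l1 * l2) * (c / 2)))
    + f7 * (10 * (c / 2 * c) * (l0 * l1 * l2 * l3 * l4)) + f8 * (l0 * l1 * l2 * l3 * l4 * (6 * c))
        + l0 * l1 * l2 * l3 * l4 * (e * (4 * c))"
  by (simp add: field_simps power_divide) (simp add: eval_nat_numeral)

section \<open>Modes and gradings\<close>

locale graded_svoa = svoa V c
  for V :: "'v::ab_group_add vertex_structure" and c :: complex +
  fixes g :: "'v \<Rightarrow> 'v" and B :: "'v \<Rightarrow> 'v \<Rightarrow> complex" and h :: real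
  assumes cft: "cft_type V"
    and invol: "svoa_involution V g"
    and plus_sum: "direct_sum V ({0, 2} \<union> {2<..}) (\<lambda>r. weight_space V r \<inter> plus_part g) (plus_part
        g)"
    and minus_sum: "direct_sum V {h..} (\<lambda>r. weight_space V r \<inter> minus_part g) (minus_part g)"
    and top_nontrivial: "top_space V g h \<noteq> {0}"
    and half_integral: "2 * h \<in> \<int>"
    and form_inv: "invariant_form V (adjoint_sign V h) B"
    and form_norm: "B (vac V) (vac V) = 1"
    and form_nondeg: "nondegenerate_on UNIV B"
    and form_nondeg_vir: "nondegenerate_on (virasoro_subalgebra V) B"
    and decomposable: "virasoro_decomposable V"
begin

sublocale vs: vector_space "scl V"
  by (rule complex_space)

lemma linear_simps:
  assumes "vendo V f"
  shows "f (x + y) = f x + f y" "f (x - y) = f x - f y" "f (- x) = - f x"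
    "f (scl V k x) = scl V k (f x)" "f 0 = 0" "f (sum F A) = (\<Sum>i\<in>A. f (F i))"
proof -
  interpret l: Vector_Spaces.linear "scl V" "scl V" f by fact
  show "f (x + y) = f x + f y" "f (x - y) = f x - f y" "f (- x) = - f x"
    "f (scl V k x) = scl V k (f x)" "f 0 = 0" "f (sum F A) = (\<Sum>i\<in>A. f (F i))"
    by (simp_all add: l.add l.diff l.neg l.scale l.sum)
qed

lemma functional_simps:
  assumes "vfunctional V f"
  shows "f (x + y) = f x + f y" "f (x - y) = f x - f y" "f (- x) = - f x"
    "f (scl V k x) = k * f x" "f 0 = 0" "f (sum F A) = (\<Sum>i\<in>A. f (F i))"
proof -
  interpret l: Vector_Spaces.linear "scl V" "(*)" f by fact
  show "f (x + y) = f x + f y" "f (x - y) = f x - f y" "f (- x) = - f x"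
    "f (scl V k x) = k * f x" "f 0 = 0" "f (sum F A) = (\<Sum>i\<in>A. f (F i))"
    by (simp_all add: l.add l.diff l.neg l.scale l.sum)
qed

lemmas mode_left [simp] = linear_simps[OF mode_linear_left]
lemmas mode_right [simp] = linear_simps[OF mode_linear_right]

lemma L_linear: "vendo V (L V n)"
  unfolding L_def by (rule mode_linear_right)

lemmas L_simps [simp] = linear_simps[OF L_linear]

lemma g_linear: "vendo V g"
  and g_mode: "g (mode V a n b) = mode V (g a) n (g b)"
  and g_vac [simp]: "g (vac V) = vac V"
  and g_conf [simp]: "g (conf V) = conf V"
  and g_par: "p \<in> {0, 1} \<Longrightarrow> a \<in> par V p \<Longrightarrow> g a \<in> par V p"
  and g_g [simp]: "g (g a) = a"
  using invol unfolding svoa_involution_def by (auto simp: fun_eq_iff)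

lemmas g_simps [simp] = linear_simps[OF g_linear]

lemma form_functional: "vfunctional V (B u)" "vfunctional V (\<lambda>u. B u v)"
  using form_inv unfolding invariant_form_def by auto

lemmas form_right [simp] = functional_simps[OF form_functional(1)]
lemmas form_left [simp] = functional_simps[OF form_functional(2)]

text \<open>Pairing with an arbitrary \<open>z\<close> turns an identity of vectors into one of
  complex numbers, where the simplifier can collect coefficients; non-degeneracy makes this
  lossless.\<close>

lemma vector_eqI: "(\<And>z. B z x = B z y) \<Longrightarrow> x = y"
  using form_nondeg unfolding nondegenerate_on_def
  by (metis UNIV_I form_right(2) right_minus_eq)

lemma vec_zeroI: "(\<And>z. B x z = 0) \<Longrightarrow> x = 0"
  using form_nondeg unfolding nondegenerate_on_def by blast

lemma scl_eq_vac [simp]: "scl V a (vac V) = scl V b (vac V) \<longleftrightarrow> a = b"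
  by (metis form_norm form_right(4) mult_cancel_left1 mult.right_neutral)

lemma vac_nonzero [simp]: "vac V \<noteq> 0"
  using form_norm by auto

lemma vac_coeff_scl [simp]: "vac_coeff V (scl V a (vac V)) = a"
  unfolding vac_coeff_def by (rule the_equality) auto

lemma Sum_any_eq_sum:
  fixes f :: "'i \<Rightarrow> 'b::comm_monoid_add"
  assumes "finite A" "\<And>i. i \<notin> A \<Longrightarrow> f i = 0"
  shows "Sum_any f = sum f A"
  by (rule Sum_any.expand_superset) (use assms in auto)

lemma Sum_any_single:
  fixes f :: "'i \<Rightarrow> 'b::comm_monoid_add"
  assumes "\<And>i. i \<noteq> k \<Longrightarrow> f i = 0"
  shows "Sum_any f = f k"
  using Sum_any_eq_sum[of "{k}" f] assms by simp

lemma Sum_any_in_subspace: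
  assumes "vs.subspace W" "\<And>i. f i \<in> W"
  shows "Sum_any f \<in> W"
proof -
  interpret comm_monoid_set "(+)" "0::'v" ..
  show ?thesis
    \<comment> \<open>A sum with infinite support is 0 by convention, and 0 lies in \<open>W\<close>
      as well.\<close>
    by (cases "finite {i. f i \<noteq> 0}")
       (auto simp: Sum_any.expand_set assms vs.subspace_0 intro!: vs.subspace_sum)
qed

lemma par_subspace: "p \<in> {0, 1} \<Longrightarrow> vs.subspace (par V p)"
  using par_sum unfolding direct_sum_def by auto

lemma weight_subspace: "vs.subspace (weight_space V r)"
  unfolding weight_space_def
  by (rule vs.subspaceI) (auto simp: vs.scale_right_distrib mult.commute)

lemma plus_subspace: "vs.subspace (plus_part g)"
  unfolding plus_part_def by (rule vs.subspaceI) auto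

lemma span_par: "UNIV = vs.span (par V 0 \<union> par V 1)"
  using par_sum unfolding direct_sum_def by auto

lemma par_split:
  obtains a0 a1 where "a = a0 + a1" "a0 \<in> par V 0" "a1 \<in> par V 1"
proof -
  have "a \<in> vs.span (par V 0 \<union> par V 1)" using span_par by auto
  then obtain x y where "a = x + y" "x \<in> vs.span (par V 0)" "y \<in> vs.span (par V 1)"
    unfolding vs.span_Un by auto
  moreover have "vs.span (par V p) = par V p" if "p \<in> {0, 1}" for p
    using par_subspace[OF that] by simp
  ultimately show ?thesis using that by (metis insertCI)
qed

lemma par_disjoint:
  assumes "a \<in> par V 0" "a \<in> par V 1"
  shows "a = 0"
proof (rule ccontr)
  assume "a \<noteq> 0"
  let ?f = "\<lambda>i::nat. if i = 0 then a else - a"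
  have "\<forall>i\<in>{0, 1::nat}. ?f i \<in> par V i" using assms vs.subspace_neg[OF par_subspace] by auto
  moreover have "{i. i \<in> {0, 1} \<and> ?f i \<noteq> 0} = {0, 1}" using \<open>a \<noteq> 0\<close> by auto
  hence "(\<Sum>i | i \<in> {0, 1} \<and> ?f i \<noteq> 0. ?f i) = 0" by simp
  moreover have "finite {i\<in>{0, 1}. ?f i \<noteq> 0}" by simp
  ultimately have "\<forall>i\<in>{0, 1::nat}. ?f i = 0"
    using par_sum[unfolded direct_sum_def, THEN conjunct2, THEN conjunct2, rule_format, of ?f]
        by blast
  thus False using \<open>a \<noteq> 0\<close> by auto
qed

lemma L_vac [simp]: "n \<ge> -1 \<Longrightarrow> L V n (vac V) = 0"
  unfolding L_def by (rule creation_nonneg) simp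

lemma L_minus_2_vac: "L V (-2) (vac V) = conf V"
  unfolding L_def using creation[of "conf V"] by simp

text \<open>Here and in the next two lemmas the Virasoro relation for L(n) and L(-2) is evaluated on
  the vacuum, where L(-2) gives omega.\<close>

lemma conf_weight: "conf V \<in> weight_space V 2"
  using virasoro[of 0 "-2" "vac V"] by (simp add: weight_space_def L_minus_2_vac)

lemma L1_conf [simp]: "L V 1 (conf V) = 0"
  using virasoro[of 1 "-2" "vac V"] by (simp add: L_minus_2_vac)

lemma conf_conf: "mode V (conf V) 3 (conf V) = scl V (c / 2) (vac V)"
  using virasoro[of 2 "-2" "vac V"] by (simp add: L_minus_2_vac) (simp add: L_def)

lemma L_par: "p \<in> {0, 1} \<Longrightarrow> a \<in> par V p \<Longrightarrow> L V n a \<in> par V p"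
  unfolding L_def using mode_parity[of 0 p "conf V" a "n + 1"] conf_even by auto

text \<open>As omega is even, L(0) - r preserves parity. Applied to the two components of
  \<open>a\<close> it gives an even and an odd vector with sum 0, so both vanish.\<close>

lemma weight_par_split:
  assumes "a \<in> weight_space V r"
  obtains a0 a1 where "a = a0 + a1" "a0 \<in> par V 0" "a1 \<in> par V 1"
    "a0 \<in> weight_space V r" "a1 \<in> weight_space V r"
proof -
  obtain a0 a1 where a: "a = a0 + a1" "a0 \<in> par V 0" "a1 \<in> par V 1" by (rule par_split)
  let ?d = "\<lambda>x. L V 0 x - scl V (of_real r) x"
  have d: "?d x \<in> par V p" if "p \<in> {0, 1}" "x \<in> par V p" for x p
    using that L_par vs.subspace_scale[OF par_subspace] vs.subspace_diff[OF par_subspace] by auto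
  have "?d a0 + ?d a1 = 0" using assms a(1) by (simp add: weight_space_def vs.scale_right_distrib
      algebra_simps)
  hence "?d a0 = - ?d a1" by (simp add: add_eq_0_iff2)
  moreover have "- ?d a1 \<in> par V 1"
    by (rule vs.subspace_neg[OF par_subspace]) (use d[of 1 a1] a(3) in auto)
  ultimately have "?d a0 \<in> par V 1" by simp
  hence "?d a0 = 0" using d[of 0 a0] a(2) par_disjoint[of "?d a0"] by (simp del: right_minus_eq)
  moreover hence "?d a1 = 0" using \<open>?d a0 = - ?d a1\<close> by simp
  ultimately show ?thesis using that a by (auto simp: weight_space_def)
qed

section \<open>Commutators with even vectors and the weights of modes\<close>

lemma gbinomial_1_eq_0: "2 \<le> i \<Longrightarrow> (1::complex) gchoose i = 0"
  using binomial_gbinomial[of 1 i, where ?'a = complex]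
      by (cases "i = 1") (auto simp: binomial_eq_0)

text \<open>The Borcherds identity at l = 0, where the right side reduces to its term i = 0.\<close>

lemma commutator:
  assumes "p \<in> {0, 1}" "a \<in> par V 0" "b \<in> par V p"
  shows "mode V a m (mode V b n u) - mode V b n (mode V a m u)
    = Sum_any (\<lambda>i. scl V (of_int m gchoose i) (mode V (mode V a (int i) b) (m + n - int i) u))"
proof -
  have 0: "(0::complex) gchoose i = 0" if "i \<noteq> 0" for i
    using that by (cases i) auto
  have "Sum_any (\<lambda>i. scl V ((-1) ^ i * (of_int 0 gchoose i))
            (mode V a (m + 0 - int i) (mode V b (n + int i) u)
             - scl V ((-1) ^ (0 * p) * (-1) powi 0)
                 (mode V b (n + 0 - int i) (mode V a (m + int i) u))))
     = mode V a m (mode V b n u) - mode V b n (mode V a m u)"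
    by (subst Sum_any_single[of 0]) (auto simp: 0)
  thus ?thesis
    using borcherds[of 0 p a b m 0 n u] assms by simp
qed

text \<open>The last hypothesis leaves only the terms i = 0, 1, 3. It is met in two ways: by
  vanishing binomial coefficients when m = 1, and by the vanishing of L(n) b for positive n when
  \<open>b\<close> is primary.\<close>

lemma commutator_conf:
  assumes "p \<in> {0, 1}" "b \<in> par V p"
    and "\<And>i. i \<ge> 2 \<Longrightarrow> i \<noteq> 3 \<Longrightarrow> (of_int m gchoose i) = (0::complex) \<or> mode V (conf V) (int i) b = 0"
  shows "mode V (conf V) m (mode V b n u) - mode V b n (mode V (conf V) m u)
    = scl V (- of_int (m + n)) (mode V b (m + n - 1) u)
      + scl V (of_int m) (mode V (L V 0 b) (m + n - 1) u)
      + scl V (of_int m gchoose 3) (mode V (mode V (conf V) 3 b) (m + n - 3) u)"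
proof -
  let ?f = "\<lambda>i. scl V (of_int m gchoose i) (mode V (mode V (conf V) (int i) b) (m + n - int i) u)"
  have "?f i = 0" if "i \<notin> {0, 1, 3}" for i
  proof -
    have "i \<ge> 2" "i \<noteq> 3" using that by (cases i; simp; fail)+
    thus ?thesis using assms(3)[of i] by auto
  qed
  hence sum: "Sum_any ?f = sum ?f {0, 1, 3}" by (intro Sum_any_eq_sum) auto
  have modes: "mode V (conf V) 0 b = L V (-1) b" "mode V (conf V) 1 b = L V 0 b"
      by (simp_all add: L_def)
  show ?thesis using commutator[OF assms(1) conf_even assms(2), of m n u] sum
    by (simp add: translation add.assoc modes)
qed

text \<open>The commutator with L(0), which is the mode of omega of index 1, so that the binomial
  coefficients vanish beyond i = 1.\<close>

lemma mode_weight: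
  assumes "a \<in> weight_space V r" "u \<in> weight_space V s"
  shows "mode V a n u \<in> weight_space V (r + s - of_int n - 1)"
proof -
  have *: "mode V b n u \<in> weight_space V (r + s - of_int n - 1)"
    if "p \<in> {0, 1}" "b \<in> par V p" "b \<in> weight_space V r" for p b
    using commutator_conf[OF that(1,2), of 1 n u] that(3) assms(2)
      gbinomial_1_eq_0[of 3] gbinomial_1_eq_0
    by (simp add: weight_space_def L_def algebra_simps vs.scale_left_distrib
        vs.scale_left_diff_distrib)
  obtain a0 a1 where "a = a0 + a1" "a0 \<in> par V 0" "a1 \<in> par V 1"
    "a0 \<in> weight_space V r" "a1 \<in> weight_space V r"
    using weight_par_split[OF assms(1)] .
  thus ?thesis using *[of 0 a0] *[of 1 a1] by (auto intro: vs.subspace_add[OF weight_subspace])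
qed

section \<open>The invariant form and orthogonality of weight spaces\<close>

lemma adjoint_sign_cases: "adjoint_sign V h = 1 \<or> adjoint_sign V h = -1"
  unfolding adjoint_sign_def by auto

lemma form_adjoint:
  assumes "a \<in> weight_space V 2" "L V 1 a = 0"
  shows "B (mode V a n u) v = B u (mode V a (2 - n) v)"
proof -
  have 0: "(L V 1 ^^ j) a = 0" if "j \<noteq> 0" for j
  proof -
    have "(L V 1 ^^ Suc k) a = 0" for k by (induction k) (use assms(2) in auto)
    thus ?thesis using that by (cases j) auto
  qed
  \<comment> \<open>The exponent of zeta is 10 or -6 according to the sign convention, an even
    number in both cases.\<close>
  have "cis (pi * (2 + 2 * adjoint_sign V h * 2\<^sup>2)) = 1"
    using adjoint_sign_cases cis_multiple_2pi[of 5] cis_multiple_2pi[of "-3"]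
    by (auto simp: algebra_simps)
  hence "adjoint_mode V (adjoint_sign V h) 2 a n v = mode V a (2 - n) v"
    unfolding adjoint_mode_def by (subst Sum_any_single[of 0]) (simp_all add: 0)
  thus ?thesis using form_inv assms(1) unfolding invariant_form_def by auto
qed

lemma form_L: "B (L V n u) v = B u (L V (- n) v)"
  using form_adjoint[OF conf_weight L1_conf, of "n + 1" u v] by (simp add: L_def)

lemma form_weight:
  assumes "u \<in> weight_space V r" "v \<in> weight_space V s" "r \<noteq> s"
  shows "B u v = 0"
  using form_L[of 0 u v] assms by (simp add: weight_space_def)

lemma weight_neg: "r < 0 \<Longrightarrow> x \<in> weight_space V r \<Longrightarrow> x = 0"
  using cft unfolding cft_type_def by auto

lemma weight_0:
  assumes "x \<in> weight_space V 0"
  obtains k where "x = scl V k (vac V)"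
  using assms cft unfolding cft_type_def vs.span_singleton by auto

lemma vac_weight: "vac V \<in> weight_space V 0"
  by (simp add: weight_space_def)

lemma weight_span: "vs.span (\<Union>r\<in>{r. 2 * r \<in> \<int>}. weight_space V r) = UNIV"
  using grading unfolding direct_sum_def by auto

lemma form_vanishing:
  assumes "\<And>s v. v \<in> weight_space V s \<Longrightarrow> B x v = 0"
  shows "x = 0"
proof (rule vec_zeroI)
  fix z
  have "z \<in> vs.span (\<Union>r\<in>{r. 2 * r \<in> \<int>}. weight_space V r)" using weight_span by auto
  thus "B x z = 0" by (induction rule: vs.span_induct_alt) (use assms in auto)
qed

text \<open>Different weight spaces are orthogonal. Hence \<open>x\<close> pairs to 0 with all
  weights other than \<open>r\<close> by its weight, and with weight \<open>r\<close> because it is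
  also a combination of vectors of other weights.\<close>

lemma weight_independent:
  assumes x: "x \<in> weight_space V r" and span: "x \<in> vs.span (\<Union>s\<in>-{r}. weight_space V s)"
  shows "x = 0"
proof (rule form_vanishing)
  fix s v assume v: "v \<in> weight_space V s"
  show "B x v = 0"
  proof (cases "s = r")
    case True
    show ?thesis using span
    proof (induction rule: vs.span_induct_alt)
      case (step k y z)
      then obtain s' where "s' \<noteq> r" "y \<in> weight_space V s'" by auto
      thus ?case using step True v form_weight[of y s' v s] by simp
    qed simp
  qed (use form_weight x v in auto)
qed

lemma weight_component_homogeneous:
  assumes "a \<in> weight_space V s"
  shows "weight_component V r a = (if r = s then a else 0)"
  unfolding weight_component_def
proof (rule the_equality, goal_cases)
  case 1
  show ?case using assms vs.subspace_0[OF weight_subspace] vs.span_zero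
    by (auto intro!: vs.span_base)
next
  case (2 b)
  let ?e = "if r = s then a else 0"
  have e: "?e \<in> weight_space V r" using assms vs.subspace_0[OF weight_subspace] by auto
  have "a - ?e \<in> vs.span (\<Union>s\<in>-{r}. weight_space V s)"
    using assms vs.span_zero by (auto intro!: vs.span_base)
  hence "(a - ?e) - (a - b) \<in> vs.span (\<Union>s\<in>-{r}. weight_space V s)" using 2 vs.span_diff by blast
  moreover have "(a - ?e) - (a - b) = b - ?e" by simp
  ultimately have "b - ?e \<in> vs.span (\<Union>s\<in>-{r}. weight_space V s)" by metis
  moreover have "b - ?e \<in> weight_space V r" using 2 e vs.subspace_diff[OF weight_subspace] by blast
  ultimately show ?case using weight_independent[of "b - ?e" r] by simp
qed

lemma zero_mode_homogeneous:
  assumes "a \<in> weight_space V (of_int n)"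
  shows "zero_mode V a = mode V a (n - 1)"
proof
  fix v
  show "zero_mode V a v = mode V a (n - 1) v"
    unfolding zero_mode_def using weight_component_homogeneous[OF assms]
    by (subst Sum_any_single[of n]) auto
qed

lemma plus_weights:
  assumes "x \<in> weight_space V r" "x \<in> plus_part g" "r \<noteq> 0" "r < 2"
  shows "x = 0"
proof -
  have "x \<in> vs.span (\<Union>s\<in>{0, 2} \<union> {2<..}. weight_space V s \<inter> plus_part g)"
    using plus_sum assms(2) unfolding direct_sum_def by auto
  hence "x \<in> vs.span (\<Union>s\<in>-{r}. weight_space V s)"
    by (rule subsetD[OF vs.span_mono, rotated]) (use assms(3,4) in force)
  thus ?thesis using weight_independent assms(1) by blast
qed

lemma minus_weights:
  assumes "x \<in> weight_space V r" "x \<in> minus_part g" "r < h"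
  shows "x = 0"
proof -
  have "x \<in> vs.span (\<Union>s\<in>{h..}. weight_space V s \<inter> minus_part g)"
    using minus_sum assms(2) unfolding direct_sum_def by auto
  hence "x \<in> vs.span (\<Union>s\<in>-{r}. weight_space V s)"
    by (rule subsetD[OF vs.span_mono, rotated]) (use assms(3) in force)
  thus ?thesis using weight_independent assms(1) by blast
qed

section \<open>The top level and the even part of V^+\<close>

definition U :: "'v set" where "U = top_space V g h"

lemma U_iff: "u \<in> U \<longleftrightarrow> u \<in> weight_space V h \<and> g u = - u"
  unfolding U_def top_space_def minus_part_def by auto

lemma U_subspace: "vs.subspace U"
  using vs.subspace_0[OF weight_subspace] vs.subspace_add[OF weight_subspace] vs.subspace_scale[OF
      weight_subspace]
  by (intro vs.subspaceI) (auto simp: U_iff)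

text \<open>No negative weights occur, and for h = 0 a top vector would be a multiple of the vacuum,
  which is fixed by \<open>g\<close> instead of negated.\<close>

lemma h_pos: "h > 0"
proof -
  obtain u where u: "u \<in> U" "u \<noteq> 0"
    using top_nontrivial vs.subspace_0[OF U_subspace] unfolding U_def by auto
  have "h \<ge> 0" using u weight_neg[of h u] U_iff by force
  moreover have "h \<noteq> 0"
  proof
    assume "h = 0"
    then obtain k where k: "u = scl V k (vac V)" using u U_iff weight_0 by metis
    hence "scl V k (vac V) = - scl V k (vac V)" using u U_iff by (metis g_simps(4) g_vac)
    hence "scl V k (vac V) = scl V (- k) (vac V)" by simp
    hence "k = 0" by (simp only: scl_eq_vac) simp
    thus False using u k by simp
  qed
  ultimately show ?thesis by simp
qed

text \<open>Integer indices allow mode indices to be subtracted freely: by \<open>E_small\<close>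
  the space is zero in weight 1 and in negative weights.\<close>

definition E :: "int \<Rightarrow> 'v set" where
  "E n = weight_space V (of_int n) \<inter> par V 0 \<inter> plus_part g"

lemma E_subspace: "vs.subspace (E n)"
  unfolding E_def
  by (intro vs.subspace_inter weight_subspace plus_subspace par_subspace) simp

lemmas E_closed [intro] = vs.subspace_add[OF E_subspace] vs.subspace_diff[OF E_subspace]
  vs.subspace_scale[OF E_subspace] vs.subspace_neg[OF E_subspace] vs.subspace_0[OF E_subspace]

lemma E_mode: "a \<in> E p \<Longrightarrow> b \<in> E q \<Longrightarrow> r = p + q - n - 1 \<Longrightarrow> mode V a n b \<in> E r"
  using mode_weight[of a "of_int p" b "of_int q" n] mode_parity[of 0 0 a b n]
  unfolding E_def by (auto simp: plus_part_def g_mode)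

lemma E_conf: "conf V \<in> E 2" and E_vac: "vac V \<in> E 0"
  unfolding E_def using conf_weight conf_even vac_weight vac_even by (auto simp: plus_part_def)

lemma E_L: "y \<in> E n \<Longrightarrow> r = n - k \<Longrightarrow> L V k y \<in> E r"
  unfolding L_def by (rule E_mode[OF E_conf]) auto

lemma E_small:
  assumes "x \<in> E n" "n < 2" "n \<noteq> 0" shows "x = 0"
proof -
  have "x \<in> weight_space V (of_int n)" "x \<in> plus_part g" using assms(1) unfolding E_def by auto
  thus ?thesis by (rule plus_weights) (use assms in auto)
qed

lemma E_0:
  assumes "x \<in> E 0" shows "x = scl V (vac_coeff V x) (vac V)"
proof -
  obtain k where "x = scl V k (vac V)" using weight_0[of x] assms unfolding E_def by auto
  thus ?thesis by simp
qed

text \<open>The vector a_(m) u lies in V^- and has weight h + n - 1 - m, and V^- has nothing below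
  weight h.\<close>

lemma mode_U:
  assumes "a \<in> E n" "u \<in> U"
  shows "mode V a (n - 1) u \<in> U" "m \<ge> n \<Longrightarrow> mode V a m u = 0"
proof -
  have w: "mode V a k u \<in> weight_space V (h + of_int (n - 1
      - k)) \<and> mode V a k u \<in> minus_part g" for k
    using mode_weight[of a "of_int n" u h k] assms unfolding E_def U_iff
    by (auto simp: plus_part_def minus_part_def g_mode algebra_simps)
  show "mode V a (n - 1) u \<in> U" using w[of "n - 1"] unfolding U_iff minus_part_def by auto
  show "mode V a m u = 0" if "m \<ge> n"
    using w[of m] that by (intro minus_weights[of _ "h + of_int (n - 1 - m)"]) auto
qed

text \<open>Half of the Borcherds identity vanishes on the vacuum and gives skew symmetry.\<close>

lemma skew_symmetry:
  assumes "p \<in> {0, 1}" "q \<in> {0, 1}" "a \<in> par V p" "b \<in> par V q"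
  shows "Sum_any (\<lambda>i. scl V (of_int (-1) gchoose i) (mode V (mode V a (l + int i) b) (- 1
      - int i) (vac V)))
    = scl V (- ((-1) ^ (p * q) * (-1) powi l)) (mode V b l a)"
proof -
  let ?s = "(-1) ^ (p * q) * (-1) powi l :: complex"
  let ?F = "\<lambda>i. scl V ((-1) ^ i * (of_int l gchoose i))
            (mode V a (-1 + l - int i) (mode V b (0 + int i) (vac V))
             - scl V ?s (mode V b (0 + l - int i) (mode V a (-1 + int i) (vac V))))"
  have vanish: "mode V x (int i) (vac V) = 0" for x i by (rule creation_nonneg) simp
  have "?F i = 0" if i: "i \<noteq> 0" for i
  proof -
    have "mode V a (-1 + int i) (vac V) = 0" by (rule creation_nonneg) (use i in simp)
    thus ?thesis by (simp only: vanish add_0 mode_right vs.scale_zero_right diff_self)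
  qed
  hence "Sum_any ?F = ?F 0" by (rule Sum_any_single)
  also have "\<dots> = scl V (- ?s) (mode V b l a)"
    using vanish[of b 0] by (simp only: of_nat_0 add_0_right diff_0_right add_0 creation mode_right
        gbinomial_0 power_0 mult_1 vs.scale_one vs.scale_minus_left diff_0)
  finally show ?thesis using borcherds[of p q a b "-1" l 0 "vac V"] assms
      by (simp only: add_0_right)
qed

text \<open>The vector a_(n) b lies in V^+ with weight 3 - n, and V^+ is zero in weight 1 and in
  negative weights, while weight 0 is spanned by the vacuum.\<close>

lemma plus_2_props:
  assumes "a \<in> weight_space V 2" "a \<in> plus_part g" "b \<in> weight_space V 2" "b \<in> plus_part g"
  shows "mode V a 2 b = 0" "n \<ge> 4 \<Longrightarrow> mode V a n b = 0" "\<exists>k. mode V a 3 b = scl V k (vac V)"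
    "L V 1 a = 0"
proof -
  have w: "mode V x n y \<in> weight_space V (of_int (3 - n))" "mode V x n y \<in> plus_part g"
    if "x \<in> weight_space V 2" "x \<in> plus_part g" "y \<in> weight_space V 2" "y \<in> plus_part g" for x y n
    using mode_weight[of x 2 y 2 n] that by (auto simp: plus_part_def g_mode)
  show "mode V a 2 b = 0" using plus_weights[OF w[OF assms, of 2]] by simp
  show "mode V a n b = 0" if "n \<ge> 4" using weight_neg[OF _ w(1)[OF assms, of n]] that by simp
  show "\<exists>k. mode V a 3 b = scl V k (vac V)" using w(1)[OF assms, of 3] by (auto elim: weight_0)
  show "L V 1 a = 0"
    using plus_weights[OF w[OF conf_weight _ assms(1,2), of 2]] by (simp add: L_def plus_part_def)
qed

text \<open>Of the skew symmetry sum at l = 3 only i = 0 survives, and the sign (-1)^3 cancels the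
  leading minus.\<close>

lemma skew_3:
  assumes "p \<in> {0, 1}" "q \<in> {0, 1}" "a \<in> par V p" "b \<in> par V q"
    "a \<in> weight_space V 2" "a \<in> plus_part g" "b \<in> weight_space V 2" "b \<in> plus_part g"
  shows "mode V b 3 a = scl V ((-1) ^ (p * q)) (mode V a 3 b)"
proof -
  have "scl V (of_int (-1) gchoose i) (mode V (mode V a (3 + int i) b) (- 1 - int i) (vac V)) = 0"
    if "i \<noteq> 0" for i
    using plus_2_props(2)[OF assms(5-8), of "3 + int i"] that by simp
  hence "scl V ((-1) ^ (p * q)) (mode V b 3 a) = mode V a 3 b"
    using skew_symmetry[OF assms(1-4), of 3]
    by (subst (asm) Sum_any_single[of 0]) (auto simp: creation)
  hence "scl V ((-1) ^ (p * q)) (scl V ((-1) ^ (p * q)) (mode V b 3 a)) =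
      scl V ((-1) ^ (p * q)) (mode V a 3 b)"
    by simp
  thus ?thesis using assms(1,2) by (auto simp flip: power_mult_distrib)
qed

text \<open>In the skew symmetry sum at l = 1 the term i = 1 contains a_(2) b = 0, the term i = 2 a
  mode of index -3 of a multiple of the vacuum, and the later ones contain a_(n) b with n >
  3.\<close>

lemma gprod_commute:
  assumes "a \<in> E 2" "b \<in> E 2"
  shows "mode V a 1 b = mode V b 1 a"
proof -
  have ab: "a \<in> weight_space V 2" "a \<in> plus_part g" "b \<in> weight_space V 2" "b \<in> plus_part g"
    "a \<in> par V 0" "b \<in> par V 0" using assms by (auto simp: E_def)
  obtain k where k: "mode V a 3 b = scl V k (vac V)" using plus_2_props(3)[OF ab(1-4)] by auto
  have "scl V (of_int (-1) gchoose i) (mode V (mode V a (1 + int i) b) (- 1 - int i) (vac V)) = 0"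
    if "i \<noteq> 0" for i
  proof -
    consider "i = 1" | "i = 2" | "i \<ge> 3" using \<open>i \<noteq> 0\<close> by linarith
    thus ?thesis
      using plus_2_props(1)[OF ab(1-4)] plus_2_props(2)[OF ab(1-4), of "1 + int i"] k vac_mode
      by cases simp_all
  qed
  thus ?thesis
    using skew_symmetry[of 0 0 a b 1] ab
    by (subst (asm) Sum_any_single[of 0]) (auto simp: creation)
qed

lemma form_eq_mode_3:
  assumes "a \<in> weight_space V 2" "L V 1 a = 0"
  shows "B a b = B (vac V) (mode V a 3 b)"
  using form_adjoint[OF assms, of "-1" "vac V" b] by (simp add: creation)

lemma g_weight: "v \<in> weight_space V s \<Longrightarrow> g v \<in> weight_space V s"
  using g_mode[of "conf V" 1 v] by (auto simp: weight_space_def L_def)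

text \<open>Only test vectors of weight 2 matter. For the part \<open>v - g v\<close> of such a
  vector, a_(3) gives a multiple of the vacuum that \<open>g\<close> negates, hence 0, so that only
  the \<open>g\<close>-invariant part is left.\<close>

lemma form_griess_zero:
  assumes a: "a \<in> weight_space V 2" "a \<in> plus_part g"
    and zero: "\<And>b. b \<in> weight_space V 2 \<Longrightarrow> b \<in> plus_part g \<Longrightarrow> B a b = 0"
  shows "a = 0"
proof (rule form_vanishing)
  fix s v assume v: "v \<in> weight_space V s"
  show "B a v = 0"
  proof (cases "s = 2")
    case True
    let ?x = "v - g v"
    have plus: "B a (v + g v) = 0"
      using g_weight v True vs.subspace_add[OF weight_subspace]
      by (intro zero) (auto simp: plus_part_def add.commute)
    have "?x \<in> weight_space V 2" using g_weight v True vs.subspace_diff[OF weight_subspace] by auto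
    hence "mode V a 3 ?x \<in> weight_space V 0" using mode_weight[of a 2 ?x 2 3] a by simp
    then obtain j where j: "mode V a 3 ?x = scl V j (vac V)" by (rule weight_0)
    have "g (mode V a 3 ?x) = - mode V a 3 ?x"
      using a(2) by (simp add: g_mode plus_part_def algebra_simps)
    hence "scl V j (vac V) = scl V (- j) (vac V)" unfolding j by simp
    hence "j = 0" by (simp only: scl_eq_vac) simp
    hence "B a ?x = 0" using form_eq_mode_3[OF a(1) plus_2_props(4)[OF a a], of ?x] j by simp
    thus ?thesis using plus by simp
  qed (use form_weight[OF a(1) v] in auto)
qed

lemma griess_par_split:
  assumes "a \<in> weight_space V 2" "a \<in> plus_part g"
  obtains a0 a1 where "a = a0 + a1" "a0 \<in> par V 0" "a1 \<in> par V 1"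
    "a0 \<in> weight_space V 2" "a1 \<in> weight_space V 2" "a0 \<in> plus_part g" "a1 \<in> plus_part g"
proof -
  obtain a0 a1 where a01: "a = a0 + a1" "a0 \<in> par V 0" "a1 \<in> par V 1"
    "a0 \<in> weight_space V 2" "a1 \<in> weight_space V 2"
    using weight_par_split[OF assms(1)] .
  have "g a0 + g a1 = a0 + a1" using assms(2) a01(1) by (simp add: plus_part_def)
  hence eq: "g a0 - a0 = a1 - g a1" by (simp add: algebra_simps)
  have "g a0 - a0 \<in> par V 0" "a1 - g a1 \<in> par V 1"
    using a01(2,3) g_par[of 0 a0] g_par[of 1 a1] vs.subspace_diff[OF par_subspace] by auto
  hence "g a0 - a0 = 0" using eq par_disjoint by metis
  thus ?thesis using eq that[OF a01] by (simp add: plus_part_def)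
qed

text \<open>An odd vector of \<open>V\<^sub>2\<close> would be isotropic: skew symmetry makes the form alternate on odd vectors,
  while invariance makes it symmetric.\<close>

lemma griess_even: "griess_space V g = E 2"
proof -
  have "a \<in> par V 0" if a: "a \<in> weight_space V 2" "a \<in> plus_part g" for a
  proof -
    obtain a0 a1 where a01: "a = a0 + a1" "a0 \<in> par V 0" "a1 \<in> par V 1"
      "a0 \<in> weight_space V 2" "a1 \<in> weight_space V 2" "a0 \<in> plus_part g" "a1 \<in> plus_part g"
      using griess_par_split[OF a] .
    note L = plus_2_props(4)[OF a01(5,7) a01(5,7)]
    have "a1 = 0"
    proof (rule form_griess_zero[OF a01(5,7)])
      fix b assume b: "b \<in> weight_space V 2" "b \<in> plus_part g"
      obtain b0 b1 where b01: "b = b0 + b1" "b0 \<in> par V 0" "b1 \<in> par V 1"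
        "b0 \<in> weight_space V 2" "b1 \<in> weight_space V 2" "b0 \<in> plus_part g" "b1 \<in> plus_part g"
        using griess_par_split[OF b] .
      have "mode V a1 3 b0 \<in> par V 1" using mode_parity[of 1 0 a1 b0 3] a01 b01 by simp
      moreover obtain k where k: "mode V a1 3 b0 = scl V k (vac V)"
        using plus_2_props(3)[OF a01(5,7) b01(4,6)] by auto
      hence "mode V a1 3 b0 \<in> par V 0" using vac_even vs.subspace_scale[OF par_subspace] by auto
      ultimately have "mode V a1 3 b0 = 0" using par_disjoint by blast
      hence 0: "B a1 b0 = 0" using form_eq_mode_3[OF a01(5) L, of b0] by simp
      obtain k where k: "mode V a1 3 b1 = scl V k (vac V)"
        using plus_2_props(3)[OF a01(5,7) b01(5,7)] by auto
      have "B a1 b1 = B (mode V b1 3 a1) (vac V)"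
        using form_adjoint[OF b01(5) plus_2_props(4)[OF b01(5,7) b01(5,7)], of 3 a1 "vac V"]
        by (simp add: creation)
      also have "mode V b1 3 a1 = scl V (- k) (vac V)"
        using skew_3[of 1 1 a1 b1] a01 b01 k by simp
      finally have "B a1 b1 = - k" using form_norm by simp
      moreover have "B a1 b1 = k" using form_eq_mode_3[OF a01(5) L, of b1] form_norm k by simp
      ultimately show "B a1 b = 0" using 0 b01(1) by simp
    qed
    thus ?thesis using a01 by simp
  qed
  thus ?thesis unfolding griess_space_def E_def by auto
qed

section \<open>Zero-modes on the top level\<close>

text \<open>Annihilation by the other L(n) with n > 0 is automatic, since V^+ has nothing in weight
  1 or in negative weights.\<close>

definition primary :: "'v \<Rightarrow> bool" where
  "primary a \<longleftrightarrow> a \<in> E 2 \<and> L V 2 a = 0"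

lemma E_weight: "y \<in> E n \<Longrightarrow> L V 0 y = scl V (of_int n) y"
  by (simp add: E_def weight_space_def)

lemma E_L_pos: "y \<in> E n \<Longrightarrow> n < k \<Longrightarrow> L V k y = 0"
  using E_small[OF E_L[OF _ refl]] by auto

lemma L1_E_2: "a \<in> E 2 \<Longrightarrow> L V 1 a = 0"
  using E_small[OF E_L[of a 2 _ 1, OF _ refl]] by auto

text \<open>Only i = 0 and i = 1 survive in the commutator; with L(0) a = 2a their coefficients
  -(m+1+n) and 2(m+1) add up to m+1-n.\<close>

lemma L_mode_primary:
  assumes "primary a"
  shows "L V m (mode V a n u) = mode V a n (L V m u) + scl V (of_int (m + 1 - n)) (mode V a (m
      + n) u)"
proof -
  have a: "a \<in> E 2" "a \<in> par V 0" using assms by (auto simp: primary_def E_def)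
  have van: "mode V (conf V) (int i) a = 0" if "i \<ge> 2" for i
  proof -
    consider "i = 2" | "i = 3" | "i \<ge> 4" using \<open>i \<ge> 2\<close> by linarith
    thus ?thesis using L1_E_2[OF a(1)] E_L_pos[OF a(1), of "int i - 1"] assms
      by cases (simp_all add: L_def primary_def)
  qed
  have "mode V (conf V) (m + 1) (mode V a n u) - mode V a n (mode V (conf V) (m + 1) u)
     = scl V (- of_int (m + 1 + n)) (mode V a (m + 1 + n - 1) u)
      + scl V (of_int (m + 1)) (mode V (L V 0 a) (m + 1 + n - 1) u)
      + scl V (of_int (m + 1) gchoose 3) (mode V (mode V (conf V) 3 a) (m + 1 + n - 3) u)"
    by (rule commutator_conf[of 0]) (use a van in auto)
  also have "\<dots> = scl V (of_int (m + 1 - n)) (mode V a (m + n) u)"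
    using van[of 3] E_weight[OF a(1)] by (intro vector_eqI) (simp add: algebra_simps)
  finally show ?thesis by (simp add: L_def algebra_simps)
qed

lemma gbinomial_2: "(2::complex) gchoose 0 = 1" "(2::complex) gchoose 1 =
    2" "(2::complex) gchoose 2 = 1"
  "i > 2 \<Longrightarrow> (2::complex) gchoose i = 0"
proof -
  have *: "(2::complex) gchoose i = of_nat (2 choose i)" for i
    using binomial_gbinomial[of 2 i, where ?'a = complex] by (simp only: of_nat_numeral)
  show "(2::complex) gchoose 0 = 1" "(2::complex) gchoose 1 = 2" "(2::complex) gchoose 2 = 1"
    "i > 2 \<Longrightarrow> (2::complex) gchoose i = 0"
    unfolding * by (simp_all add: binomial_eq_0)
qed

text \<open>The value m = 2 is the weight of the vectors \<open>a\<close> of interest: the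
  coefficients 1, 2, 1 are those of (1+z)^2 in Zhu's products.\<close>

lemma Borcherds_m_2:
  assumes "a \<in> par V 0" "y \<in> par V 0"
  shows "mode V (mode V a l y) (2 + n) u + scl V 2 (mode V (mode V a (l + 1) y) (1 + n) u)
      + mode V (mode V a (l + 2) y) n u
    = Sum_any (\<lambda>i. scl V ((-1) ^ i * (of_int l gchoose i))
            (mode V a (2 + l - int i) (mode V y (n + int i) u)
             - scl V ((-1) powi l) (mode V y (n + l - int i) (mode V a (2 + int i) u))))"
proof -
  let ?f = "\<lambda>i. scl V (of_int 2 gchoose i) (mode V (mode V a (l + int i) y) (2 + n - int i) u)"
  have "?f i = 0" if "i \<notin> {0, 1, 2}" for i
    using that gbinomial_2(4)[of i] by (cases "i > 2") auto
  hence "Sum_any ?f = sum ?f {0, 1, 2}" by (intro Sum_any_eq_sum) auto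
  also have "\<dots> = mode V (mode V a l y) (2 + n) u + scl V 2 (mode V (mode V a (l + 1) y) (1 + n) u)
      + mode V (mode V a (l + 2) y) n u"
    using gbinomial_2 by (simp add: add.assoc)
  finally show ?thesis using borcherds[of 0 0 a y 2 l n u] assms by simp
qed

text \<open>At l = -1 the modes of \<open>a\<close> from index 2 and of \<open>y\<close> from index
  \<open>q\<close> upward kill the top level, leaving one term on the right: o(a) o(y) is the
  zero-mode of Zhu's product of a and y.\<close>

lemma zhu_product:
  assumes "a \<in> E 2" "y \<in> E q" "u \<in> U"
  shows "mode V a 1 (mode V y (q - 1) u)
    = mode V (mode V a (-1) y) (q + 1) u + scl V 2 (mode V (mode V a 0 y) q u)
      + mode V (mode V a 1 y) (q - 1) u"
proof -
  note y = mode_U(2)[OF assms(2,3)] and a = mode_U(2)[OF assms(1,3)]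
  have "a \<in> par V 0" "y \<in> par V 0" using assms by (auto simp: E_def)
  from Borcherds_m_2[OF this, of "-1" "q - 1" u] show ?thesis
    by (subst (asm) Sum_any_single[of 0]) (auto simp: a y algebra_simps)
qed

text \<open>For l at most -2 every term on the right contains a mode that kills the top level. These
  are the vectors which Zhu's algebra divides out.\<close>

lemma zhu_zero:
  assumes "a \<in> E 2" "y \<in> E q" "u \<in> U"
  shows "mode V (mode V a (- 2 - int k) y) (q + int k + 2) u
    + scl V 2 (mode V (mode V a (- 1 - int k) y) (q + int k + 1) u)
    + mode V (mode V a (- int k) y) (q + int k) u = 0"
proof -
  note y = mode_U(2)[OF assms(2,3)] and a = mode_U(2)[OF assms(1,3)]
  have "a \<in> par V 0" "y \<in> par V 0" using assms by (auto simp: E_def)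
  from Borcherds_m_2[OF this, of "- 2 - int k" "q + int k" u] show ?thesis
    by (simp add: a y algebra_simps)
qed

lemma conf_U: "u \<in> U \<Longrightarrow> mode V (conf V) 1 u = scl V (of_real h) u"
  by (simp add: U_iff weight_space_def L_def)

text \<open>The case m = 1 is translation and m = 2 is Zhu's product with omega, where o(omega) = h.
  Then \<open>zhu_zero\<close> gives f(m) = -2 f(m-1) - f(m-2), which the stated closed form
  solves.\<close>

lemma mode_L_minus:
  assumes "y \<in> E q" "u \<in> U" "m \<ge> 1"
  shows "mode V (L V (- int m) y) (q + int m - 1) u
    = scl V ((-1) ^ m * ((of_nat m - 1) * of_real h + of_int q)) (mode V y (q - 1) u)"
  using \<open>m \<ge> 1\<close>
proof (induction m rule: less_induct)
  case (less m)
  have o: "mode V (L V (-1) y) q u = scl V (- of_int q) (mode V y (q - 1) u)"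
    by (rule translation)
  consider "m = 1" | "m = 2" | k where "m = Suc (Suc (Suc k))"
    using less.prems by (metis One_nat_def Suc_le_D numeral_2_eq_2 not0_implies_Suc)
  thus ?case
  proof cases
    case 1 thus ?thesis using o by simp
  next
    case 2
    have "mode V (conf V) 1 (mode V y (q - 1) u) = scl V (of_real h) (mode V y (q - 1) u)"
      using conf_U mode_U(1)[OF assms(1,2)] by simp
    moreover have "mode V (conf V) (-1) y = L V (-2) y" "mode V (conf V) 0 y = L V (-1) y"
      "mode V (conf V) 1 y = scl V (of_int q) y"
      using E_weight[OF assms(1)] by (simp_all add: L_def)
    ultimately have "mode V (L V (-2) y) (q + 1) u =
       scl V (of_real h) (mode V y (q - 1) u) - scl V 2 (scl V (- of_int q) (mode V y (q - 1) u))
        - scl V (of_int q) (mode V y (q - 1) u)"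
      using zhu_product[OF E_conf assms(1,2)] o by (simp add: algebra_simps)
    thus ?thesis using 2
      by (simp add: algebra_simps flip: vs.scale_left_distrib vs.scale_left_diff_distrib)
  next
    case 3
    let ?B = "scl V 2 (mode V (L V (- int (Suc (Suc k))) y) (q + int (Suc (Suc k)) - 1) u)"
      and ?C = "mode V (L V (- int (Suc k)) y) (q + int (Suc k) - 1) u"
    have "mode V (L V (- int m) y) (q + int m - 1) u + ?B + ?C = 0"
      using zhu_zero[OF E_conf assms(1,2), of k] unfolding L_def 3
      by (simp add: algebra_simps minus_diff_commute)
    hence "mode V (L V (- int m) y) (q + int m - 1) u = - ?B - ?C"
      by (simp add: eq_diff_eq eq_neg_iff_add_eq_0 add_ac)
    also have "\<dots> = - scl V 2 (scl V ((-1) ^ Suc (Suc k) * ((of_nat (Suc (Suc k)) - 1) * of_real h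
        + of_int q)) (mode V y (q - 1) u))
       - scl V ((-1) ^ (Suc k) * ((of_nat (Suc k) - 1) * of_real h + of_int q)) (mode V y (q
           - 1) u)"
      using less.IH[of "Suc (Suc k)"] less.IH[of "Suc k"] 3 by simp
    also have "\<dots> = scl V ((-1) ^ m * ((of_nat m - 1) * of_real h + of_int q)) (mode V y (q - 1) u)"
      unfolding 3 by (rule vector_eqI) (simp add: algebra_simps)
    finally show ?thesis .
  qed
qed

section \<open>Traces on the top level\<close>

definition tr :: "('v \<Rightarrow> 'v) \<Rightarrow> complex" where "tr = trace_on V U"

text \<open>The choice in \<open>trace_on\<close> really selects a basis, it is finite because
  weight spaces are finite-dimensional, and it is the same one for every operator.\<close>

lemma U_basis:
  obtains S where "vs.independent S" "vs.span S = U" "finite S" "vs.dim U = card S"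
    "\<forall>T. tr T = (\<Sum>b\<in>S. vs.representation S (T b) b)"
proof -
  define S where "S = (SOME S. \<not> vs.dependent S \<and> vs.span S = U)"
  obtain S' where "vs.independent S'" "vs.span S' = U"
    using vs.maximal_independent_subset[of U] vs.span_minimal[OF _ U_subspace]
    by (metis subset_antisym)
  hence S: "vs.independent S \<and> vs.span S = U" unfolding S_def by (intro someI) auto
  obtain F where F: "finite F" "weight_space V h = vs.span F" using weight_finite by auto
  have "S \<subseteq> vs.span F" using S vs.span_superset[of S] F U_iff by auto
  hence "finite S" using vs.independent_span_bound[OF F(1)] S by auto
  moreover have "vs.dim U = card S" using S vs.dim_eq_card[of S U] vs.span_eq_iff U_subspace
      by metis
  moreover have "tr T = (\<Sum>b\<in>S. vs.representation S (T b) b)" for T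
    unfolding tr_def trace_on_def Let_def S_def ..
  ultimately show ?thesis using that S by blast
qed

text \<open>Outside the span of the basis \<open>representation\<close> is 0 by convention, so
  additivity is stated for operators that preserve the top level.\<close>

lemma
  assumes "\<And>u. u \<in> U \<Longrightarrow> f u \<in> U"
  shows tr_add: "(\<And>u. u \<in> U \<Longrightarrow> f' u \<in> U) \<Longrightarrow> tr (\<lambda>u. f u + f' u) = tr f + tr f'"
    and tr_scl: "tr (\<lambda>u. scl V k (f u)) = k * tr f"
proof -
  obtain S where S: "vs.independent S" "vs.span S = U" "finite S" "vs.dim U = card S"
    "\<forall>T. tr T = (\<Sum>b\<in>S. vs.representation S (T b) b)" by (rule U_basis)
  have SU: "b \<in> U" if "b \<in> S" for b using S(2) vs.span_base that by blast
  show "tr (\<lambda>u. scl V k (f u)) = k * tr f"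
    unfolding S(5)[rule_format] sum_distrib_left
    by (rule sum.cong) (use S assms SU in \<open>auto simp: vs.representation_scale\<close>)
  assume "\<And>u. u \<in> U \<Longrightarrow> f' u \<in> U"
  thus "tr (\<lambda>u. f u + f' u) = tr f + tr f'"
    unfolding S(5)[rule_format] sum.distrib[symmetric]
    by (intro sum.cong) (use S assms SU in \<open>auto simp: vs.representation_add\<close>)
qed

lemma tr_cong: "(\<And>u. u \<in> U \<Longrightarrow> f u = f' u) \<Longrightarrow> tr f = tr f'"
proof -
  assume *: "\<And>u. u \<in> U \<Longrightarrow> f u = f' u"
  obtain S where S: "vs.independent S" "vs.span S = U" "finite S" "vs.dim U = card S"
    "\<forall>T. tr T = (\<Sum>b\<in>S. vs.representation S (T b) b)" by (rule U_basis)
  show ?thesis unfolding S(5)[rule_format]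
  proof (rule sum.cong)
    fix b assume "b \<in> S"
    hence "b \<in> U" using S(2) vs.span_base by blast
    thus "vs.representation S (f b) b = vs.representation S (f' b) b" using * by simp
  qed simp
qed

lemma tr_scalar: "tr (\<lambda>u. scl V k u) = k * of_nat (vs.dim U)"
proof -
  obtain S where S: "vs.independent S" "vs.span S = U" "finite S" "vs.dim U = card S"
    "\<forall>T. tr T = (\<Sum>b\<in>S. vs.representation S (T b) b)" by (rule U_basis)
  have "tr (\<lambda>u. scl V k u) = (\<Sum>b\<in>S. k)" unfolding S(5)[rule_format]
    by (rule sum.cong) (use S vs.span_base in \<open>auto simp: vs.representation_scale
        vs.representation_basis\<close>)
  thus ?thesis using S by simp
qed

lemma dim_U: "vs.dim U > 0"
proof -
  obtain S where S: "vs.independent S" "vs.span S = U" "finite S" "vs.dim U = card S"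
    "\<forall>T. tr T = (\<Sum>b\<in>S. vs.representation S (T b) b)" by (rule U_basis)
  have "S \<noteq> {}" using S(2) top_nontrivial U_def by auto
  thus ?thesis using S by (simp add: card_gt_0_iff)
qed

section \<open>Virasoro modules and conformal designs\<close>

text \<open>\<open>L(-1)\<close> and \<open>L(-2)\<close> generate all \<open>L(-n)\<close>, so for a highest weight vector this is the Virasoro module.\<close>

inductive_set vir_span :: "'v \<Rightarrow> 'v set" for w where
  base: "w \<in> vir_span w"
| add: "x \<in> vir_span w \<Longrightarrow> y \<in> vir_span w \<Longrightarrow> x + y \<in> vir_span w"
| scale: "x \<in> vir_span w \<Longrightarrow> scl V k x \<in> vir_span w"
| L1: "x \<in> vir_span w \<Longrightarrow> L V (-1) x \<in> vir_span w"
| L2: "x \<in> vir_span w \<Longrightarrow> L V (-2) x \<in> vir_span w"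

lemma vir_span_subspace: "vs.subspace (vir_span w)"
  using vir_span.scale[where k = 0, OF vir_span.base[of w]]
  by (intro vs.subspaceI) (auto intro: vir_span.intros)

lemmas vir_span_closed = vs.subspace_add[OF vir_span_subspace] vs.subspace_diff[OF
    vir_span_subspace]
  vs.subspace_scale[OF vir_span_subspace] vs.subspace_0[OF vir_span_subspace]
  vs.subspace_neg[OF vir_span_subspace]

text \<open>The commutator of L(-1) and L(n+1) is -n-2 times L(n), and this factor is nonzero for n
  at most -3.\<close>

lemma vir_span_L_neg: "y \<in> vir_span w \<Longrightarrow> n < 0 \<Longrightarrow> L V n y \<in> vir_span w"
proof (induction "nat (- n)" arbitrary: n y rule: less_induct)
  case less
  consider "n = -1" | "n = -2" | "n \<le> -3" using less.prems by linarith
  thus ?case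
  proof cases
    case 3
    have "L V (n + 1) y \<in> vir_span w" "L V (n + 1) (L V (-1) y) \<in> vir_span w"
      using less 3 by (auto intro: vir_span.L1)
    hence "L V (-1) (L V (n + 1) y) - L V (n + 1) (L V (-1) y) \<in> vir_span w"
      by (intro vir_span_closed vir_span.L1)
    moreover have "L V (-1) (L V (n + 1) y) - L V (n + 1) (L V (-1) y) =
        scl V (of_int (- n - 2)) (L V n y)"
      using virasoro[of "-1" "n + 1" y] 3 by (simp add: algebra_simps)
    ultimately have "scl V (of_int (- n - 2)) (L V n y) \<in> vir_span w" by metis
    hence "scl V (1 / of_int (- n - 2)) (scl V (of_int (- n - 2)) (L V n y)) \<in> vir_span w"
      by (rule vir_span.scale)
    moreover have "(of_int (- n - 2) :: complex) \<noteq> 0" using 3 by (simp only: of_int_eq_0_iff)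
    ultimately show ?thesis by (simp del: of_int_minus of_int_diff)
  qed (use less in \<open>auto intro: vir_span.intros\<close>)
qed

lemma L_commute:
  "L V m (L V n v) = L V n (L V m v) + scl V (of_int (m - n)) (L V (m + n) v)
            + (if m + n = 0 then scl V (of_int (m ^ 3 - m) / 12 * c) v else 0)"
  using virasoro[of m n v] by (simp add: algebra_simps)

lemma vir_span_vac_L: "y \<in> vir_span (vac V) \<Longrightarrow> L V n y \<in> vir_span (vac V)"
proof (induction arbitrary: n rule: vir_span.induct)
  case base
  show ?case
    using vir_span_L_neg[OF vir_span.base, of n "vac V"] vir_span_closed(4) by (cases "n < 0") auto
next
  case (L1 x)
  show ?case unfolding L_commute[of n "-1" x]
    using L1.IH L1.hyps by (intro vir_span_closed vir_span.L1) (auto intro: vir_span_closed)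
next
  case (L2 x)
  show ?case unfolding L_commute[of n "-2" x]
    using L2.IH L2.hyps by (intro vir_span_closed vir_span.L2) (auto intro: vir_span_closed)
qed (auto intro: vir_span_closed)

lemma vir_span_vac_even: "y \<in> vir_span (vac V) \<Longrightarrow> y \<in> par V 0"
  by (induction rule: vir_span.induct)
     (auto intro: L_par vac_even vs.subspace_add[OF par_subspace] vs.subspace_scale[OF
         par_subspace])

lemma mode_conf: "mode V (conf V) n = L V (n - 1)"
  by (simp add: L_def fun_eq_iff)

text \<open>A mode of L(-2) x = omega_(-1) x is expanded by the Borcherds identity at m = 0, l = -1
  into products of modes of omega and of x.\<close>

lemma vir_span_vac_mode:
  "y \<in> vir_span (vac V) \<Longrightarrow> u \<in> vir_span (vac V) \<Longrightarrow> mode V y n u \<in> vir_span (vac V)"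
proof (induction arbitrary: n u rule: vir_span.induct)
  case base thus ?case using vac_mode vir_span_closed by auto
next
  case (L1 x) thus ?case by (simp add: translation vir_span_closed)
next
  case (L2 x)
  have "Sum_any (\<lambda>i. scl V (of_int 0 gchoose i) (mode V (mode V (conf V) (-1 + int i) x) (0 + n
      - int i) u))
     = mode V (L V (-2) x) n u"
  proof -
    have "(0::complex) gchoose i = 0" if "i \<noteq> 0" for i
      using that by (cases i) auto
    thus ?thesis by (subst Sum_any_single[of 0]) (auto simp: mode_conf)
  qed
  moreover have "Sum_any (\<lambda>i. scl V (of_int 0 gchoose i) (mode V (mode V (conf V) (-1 + int i) x) (0
      + n - int i) u))
     \<in> vir_span (vac V)"
    by (subst borcherds[of 0 0])
      (use conf_even vir_span_vac_even[OF L2.hyps] in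
        \<open>auto simp: mode_conf intro!: Sum_any_in_subspace vir_span_subspace vir_span_closed
          vir_span_vac_L L2\<close>)
  ultimately show ?case by (simp only:)
qed (auto intro: vir_span_closed)

text \<open>Makes the non-degeneracy assumed on the subalgebra generated by omega available for the
  vacuum module.\<close>

lemma virasoro_subalgebra_eq: "virasoro_subalgebra V = vir_span (vac V)"
proof
  show "virasoro_subalgebra V \<subseteq> vir_span (vac V)"
    unfolding virasoro_subalgebra_def
    using vir_span.L2[OF vir_span.base, of "vac V"] vir_span_vac_mode vir_span_subspace
    by (intro hull_minimal) (auto simp: L_minus_2_vac intro: vir_span.base)
  show "vir_span (vac V) \<subseteq> virasoro_subalgebra V"
  proof
    fix y assume "y \<in> vir_span (vac V)"
    thus "y \<in> virasoro_subalgebra V"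
      unfolding virasoro_subalgebra_def hull_def
    proof (induction rule: vir_span.induct)
      case (L1 x) thus ?case using mode_conf[of 0] by auto metis
    next
      case (L2 x) thus ?case using mode_conf[of "-1"] by auto metis
    qed (auto intro: vs.subspace_add vs.subspace_scale)
  qed
qed

text \<open>Vectors in \<open>N (vac V)\<close> have zero projection to the vacuum module, so a
  design sees nothing of them. For primary a, \<open>N a\<close> plays the corresponding role for
  products o(a) o(y).\<close>

definition N :: "'v \<Rightarrow> 'v set" where
  "N w = {x. \<forall>y\<in>vir_span w. B y x = 0}"

lemma N_subspace: "vs.subspace (N w)"
  unfolding N_def by (rule vs.subspaceI) auto

lemmas N_closed = vs.subspace_add[OF N_subspace] vs.subspace_diff[OF N_subspace]
  vs.subspace_scale[OF N_subspace] vs.subspace_0[OF N_subspace]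

text \<open>The form makes L(1) and L(2) adjoint to L(-1) and L(-2), which generate
  \<open>vir_span w\<close>. All later orthogonality statements with a recursion on the weight rest
  on this.\<close>

lemma N_I:
  assumes "B w x = 0" "L V 1 x \<in> N w" "L V 2 x \<in> N w"
  shows "x \<in> N w"
proof -
  have "B y x = 0" if "y \<in> vir_span w" for y
    using that by induction (use assms in \<open>auto simp: form_L N_def\<close>)
  thus ?thesis by (simp add: N_def)
qed

lemma N_vac_L: "x \<in> N (vac V) \<Longrightarrow> L V n x \<in> N (vac V)"
  using vir_span_vac_L by (auto simp: N_def simp flip: form_L[of "- n" _ x, simplified])

lemma highest_weight_in_N:
  assumes "r > 0" "highest_weight_submodule V r M" "x \<in> M"
  shows "x \<in> N (vac V)"
proof -
  obtain v where v: "v \<in> weight_space V r" "\<forall>n>0. L V n v = 0" "M = virasoro_submodule V v"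
    using assms(2) unfolding highest_weight_submodule_def by auto
  have "v \<in> N (vac V)"
    by (rule N_I) (use v form_weight[OF vac_weight v(1)] assms(1) N_closed(4) in auto)
  hence "virasoro_submodule V v \<subseteq> N (vac V)"
    unfolding virasoro_submodule_def
    using N_subspace N_vac_L by (intro hull_minimal) auto
  thus ?thesis using v assms by auto
qed

lemma virasoro_component_0: "virasoro_component V 0 \<subseteq> vir_span (vac V)"
  unfolding virasoro_component_def
proof (rule vs.span_minimal[OF _ vir_span_subspace], safe)
  fix x M assume "highest_weight_submodule V 0 M" "x \<in> M"
  then obtain v where v: "v \<in> weight_space V 0" "M = virasoro_submodule V v"
    unfolding highest_weight_submodule_def by auto
  obtain k where "v = scl V k (vac V)" using v(1) weight_0 by metis
  hence "v \<in> vir_span (vac V)" by (auto intro: vir_span.base vir_span_closed)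
  hence "virasoro_submodule V v \<subseteq> vir_span (vac V)"
    unfolding virasoro_submodule_def
    using vir_span_subspace vir_span_vac_L by (intro hull_minimal) auto
  thus "x \<in> vir_span (vac V)" using v \<open>x \<in> M\<close> by auto
qed

text \<open>Existence of the splitting comes from the decomposition into highest weight modules. For
  uniqueness, all components with r > 0 are orthogonal to the vacuum module, so the candidate
  \<open>b\<close> lies in that module and is orthogonal to it.\<close>

lemma virasoro_projection_N:
  assumes x: "x \<in> N (vac V)"
  shows "virasoro_projection V x = 0"
proof -
  let ?W = "vs.span (\<Union>r\<in>{0<..}. virasoro_component V r)"
  have "virasoro_component V r \<subseteq> N (vac V)" if "r > 0" for r
    unfolding virasoro_component_def
    using highest_weight_in_N[OF that] by (intro vs.span_minimal N_subspace) auto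
  hence W: "?W \<subseteq> N (vac V)" by (intro vs.span_minimal N_subspace) auto
  have unique: "b = 0" if b: "b \<in> virasoro_component V 0" "x - b \<in> ?W" for b
  proof -
    have bP: "b \<in> virasoro_subalgebra V" using b(1) virasoro_component_0 virasoro_subalgebra_eq
        by auto
    have "b \<in> N (vac V)" using N_closed(2)[OF x, of "x - b"] b(2) W by auto
    hence "B u b = 0" if "u \<in> virasoro_subalgebra V" for u
      using that virasoro_subalgebra_eq by (simp add: N_def)
    thus ?thesis using form_nondeg_vir bP unfolding nondegenerate_on_def by blast
  qed
  obtain \<M> where M: "\<forall>M\<in>\<M>. \<exists>r. highest_weight_submodule V r M" "UNIV = vs.span (\<Union>M\<in>\<M>. M)"
    using decomposable unfolding virasoro_decomposable_def direct_sum_def by auto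
  have "\<exists>b\<in>virasoro_component V 0. z - b \<in> ?W" for z
  proof -
    have "z \<in> vs.span (\<Union>M\<in>\<M>. M)" using M(2) by auto
    thus ?thesis
    proof (induction rule: vs.span_induct_alt)
      case base
      show ?case using vs.span_zero unfolding virasoro_component_def
        by (intro bexI[of _ 0]) auto
    next
      case (step k y z)
      then obtain b where b: "b \<in> virasoro_component V 0" "z - b \<in> ?W" by auto
      obtain M' r where r: "y \<in> M'" "highest_weight_submodule V r M'" using step M by auto
      have y: "y \<in> virasoro_component V r"
        unfolding virasoro_component_def by (rule vs.span_base) (use r in auto)
      have "r \<ge> 0" using r(2) weight_neg[of r] unfolding highest_weight_submodule_def
        by (meson not_le)
      then consider "r = 0" | "r > 0" by linarith
      thus ?case
      proof cases
        case 1
        hence "scl V k y + b \<in> virasoro_component V 0"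
          using b(1) y unfolding virasoro_component_def by (auto intro: vs.span_add vs.span_scale)
        moreover have "scl V k y + z - (scl V k y + b) = z - b" by simp
        ultimately show ?thesis using b(2) by metis
      next
        case 2
        have "y \<in> ?W" by (rule vs.span_base) (use y 2 in auto)
        hence "scl V k y + (z - b) \<in> ?W" using b(2) by (auto intro: vs.span_add vs.span_scale)
        moreover have "scl V k y + (z - b) = scl V k y + z - b" by simp
        ultimately show ?thesis using b(1) by metis
      qed
    qed
  qed
  then obtain b where b: "b \<in> virasoro_component V 0" "x - b \<in> ?W" by blast
  show ?thesis unfolding virasoro_projection_def
    by (rule the_equality) (use b unique unique[OF b] in auto)
qed

text \<open>The weight is an explicit argument, so that on \<open>E n\<close> the zero-mode is one
  mode and no weight components have to be taken.\<close>

definition T :: "int \<Rightarrow> 'v \<Rightarrow> complex" where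
  "T n y = tr (mode V y (n - 1))"

lemma T_add: "x \<in> E n \<Longrightarrow> y \<in> E n \<Longrightarrow> T n (x + y) = T n x + T n y"
  unfolding T_def using tr_add[of "mode V x (n - 1)" "mode V y (n - 1)"] mode_U
  by (simp flip: mode_left)

lemma T_scl: "x \<in> E n \<Longrightarrow> T n (scl V k x) = k * T n x"
  unfolding T_def using tr_scl[of "mode V x (n - 1)" k] mode_U by (simp flip: mode_left)

lemma T_diff: "x \<in> E n \<Longrightarrow> y \<in> E n \<Longrightarrow> T n (x - y) = T n x - T n y"
  using T_add[of x n "scl V (-1) y"] T_scl[of y n "-1"] E_closed(3)[of y n "-1"] by simp

lemma T_L_minus:
  "y \<in> E n \<Longrightarrow> m \<ge> 1 \<Longrightarrow> T (n + int m) (L V (- int m) y)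
     = (-1) ^ m * ((of_nat m - 1) * of_real h + of_int n) * T n y"
  unfolding T_def
  using tr_scl[of "mode V y (n - 1)"] mode_U(1) by (simp add: mode_L_minus cong: tr_cong)

lemma T_vac: "T 0 (vac V) = of_nat (vs.dim U)"
  unfolding T_def using tr_scalar[of 1] by (simp add: vac_mode cong: tr_cong)

text \<open>The projection of \<open>x\<close> is 0, hence the trace equals that of the zero-mode of
  0. The design condition enters the trace computations in this form.\<close>

lemma T_design:
  assumes "conformal_design V g h t" "x \<in> E n" "n \<ge> 0" "n \<le> int t" "x \<in> N (vac V)"
  shows "T n x = 0"
proof -
  have "x \<in> vs.span (\<Union>n\<in>{0..t}. weight_space V (of_nat n) \<inter> par V 0 \<inter> plus_part g)"
    by (rule vs.span_base) (use assms in \<open>auto simp: E_def intro!: bexI[of _ "nat n"]\<close>)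
  hence "tr (zero_mode V x) = tr (zero_mode V 0)"
    using assms(1) virasoro_projection_N[OF assms(5)]
    unfolding conformal_design_def tr_def U_def by auto
  moreover have "zero_mode V x = mode V x (n - 1)"
    by (rule zero_mode_homogeneous) (use assms in \<open>auto simp: E_def\<close>)
  moreover have "zero_mode V 0 = mode V 0 (0 - 1)"
    by (rule zero_mode_homogeneous) (simp add: weight_space_def)
  ultimately show ?thesis
    using tr_scalar[of 0] by (simp add: T_def fun_eq_iff cong: tr_cong)
qed

lemma tr_product:
  assumes "a \<in> E 2" "y \<in> E n"
  shows "tr (\<lambda>u. mode V a 1 (mode V y (n - 1) u))
    = T (n + 2) (mode V a (-1) y) + 2 * T (n + 1) (mode V a 0 y) + T n (mode V a 1 y)"
proof -
  have E: "mode V a (-1) y \<in> E (n + 2)" "mode V a 0 y \<in> E (n + 1)" "mode V a 1 y \<in> E n"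
    using assms by (auto intro: E_mode)
  have U: "u \<in> U \<Longrightarrow> mode V (mode V a (-1) y) (n + 1) u \<in> U" "u \<in> U \<Longrightarrow> mode V (mode V a 0 y) n u \<in> U"
    "u \<in> U \<Longrightarrow> mode V (mode V a 1 y) (n - 1) u \<in> U" for u
    using mode_U(1)[OF E(1), of u] mode_U(1)[OF E(2), of u] mode_U(1)[OF E(3), of u]
        by (auto simp: algebra_simps)
  have "tr (\<lambda>u. mode V a 1 (mode V y (n - 1) u)) =
     tr (\<lambda>u. (mode V (mode V a (-1) y) (n + 1) u + scl V 2 (mode V (mode V a 0 y) n u))
        + mode V (mode V a 1 y) (n - 1) u)"
    by (rule tr_cong) (rule zhu_product[OF assms])
  also have "\<dots> = tr (mode V (mode V a (-1) y) (n + 1)) + 2 * tr (mode V (mode V a 0 y) n)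
      + tr (mode V (mode V a 1 y) (n - 1))"
    using U U_subspace by (subst tr_add tr_scl; (auto intro: vs.subspace_add vs.subspace_scale)?)+
  finally show ?thesis by (simp add: T_def algebra_simps)
qed

lemma T_zhu_zero:
  assumes "a \<in> E 2" "y \<in> E n"
  shows "T (n + int k + 3) (mode V a (- 2 - int k) y) + 2 * T (n + int k + 2) (mode V a (- 1
      - int k) y)
    + T (n + int k + 1) (mode V a (- int k) y) = 0"
proof -
  have E: "mode V a (- 2 - int k) y \<in> E (n + int k + 3)" "mode V a (- 1 - int k) y \<in> E (n + int k
      + 2)"
    "mode V a (- int k) y \<in> E (n + int k + 1)"
    using assms by (auto intro!: E_mode)
  have U: "u \<in> U \<Longrightarrow> mode V (mode V a (- 2 - int k) y) (n + int k + 2) u \<in> U"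
    "u \<in> U \<Longrightarrow> mode V (mode V a (- 1 - int k) y) (n + int k + 1) u \<in> U"
    "u \<in> U \<Longrightarrow> mode V (mode V a (- int k) y) (n + int k) u \<in> U" for u
    using mode_U(1)[OF E(1), of u] mode_U(1)[OF E(2), of u] mode_U(1)[OF E(3), of u]
    by (auto simp: algebra_simps)
  have "tr (\<lambda>u. (mode V (mode V a (- 2 - int k) y) (n + int k + 2) u
       + scl V 2 (mode V (mode V a (- 1 - int k) y) (n + int k + 1) u))
        + mode V (mode V a (- int k) y) (n + int k) u) = tr (\<lambda>u. scl V 0 u)"
    by (rule tr_cong) (simp add: zhu_zero[OF assms])
  also have "\<dots> = 0" by (subst tr_scalar) simp
  also have "tr (\<lambda>u. (mode V (mode V a (- 2 - int k) y) (n + int k + 2) u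
       + scl V 2 (mode V (mode V a (- 1 - int k) y) (n + int k + 1) u))
        + mode V (mode V a (- int k) y) (n + int k) u) =
      tr (mode V (mode V a (- 2 - int k) y) (n + int k + 2))
       + 2 * tr (mode V (mode V a (- 1 - int k) y) (n + int k + 1))
       + tr (mode V (mode V a (- int k) y) (n + int k))"
    using U U_subspace by (subst tr_add tr_scl; (auto intro: vs.subspace_add vs.subspace_scale)?)+
  finally show ?thesis by (simp add: T_def algebra_simps)
qed

section \<open>Two-point functions of primary vectors\<close>

text \<open>The condition \<open>n < m\<close> orients the commutator into a terminating rewrite
  rule that moves larger indices to the right, towards the vacuum.\<close>

lemma L_move:
  assumes "n < m"
  shows "L V m (L V n v) = L V n (L V m v) + scl V (of_int (m - n)) (L V (m + n) v)
            + (if m + n = 0 then scl V (of_int (m ^ 3 - m) / 12 * c) v else 0)"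
  by (rule L_commute)

lemma E_word: "y \<in> E (n + k) \<Longrightarrow> L V k y \<in> E n"
  by (rule E_L) auto

lemma T_L:
  assumes "y \<in> E (n - m)" "m \<ge> 1"
  shows "T n (L V (- m) y) = (-1) ^ nat m * ((of_int m - 1) * of_real h + of_int (n - m)) * T (n
      - m) y"
  using T_L_minus[OF assms(1), of "nat m"] assms(2) by simp

text \<open>From here to \<open>lc8\<close>: vectors of the vacuum module given by coordinates in
  the ordered monomials indexed by partitions into parts at least 2. L(-1) is absent because it
  kills the vacuum.\<close>

definition lc2 where
  "lc2 p = scl V p (L V (-2) (vac V))"

definition lc3 where
  "lc3 p = scl V p (L V (-3) (vac V))"

definition lc4 where
  "lc4 p q = scl V p (L V (-4) (vac V)) + scl V q (L V (-2) (L V (-2) (vac V)))"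

definition lc5 where
  "lc5 p q = scl V p (L V (-5) (vac V)) + scl V q (L V (-3) (L V (-2) (vac V)))"

definition lc6 where
  "lc6 p q r s = scl V p (L V (-6) (vac V)) + scl V q (L V (-4) (L V (-2) (vac V)))
      + scl V r (L V (-3) (L V (-3) (vac V))) + scl V s (L V (-2) (L V (-2) (L V (-2) (vac V))))"

definition lc7 where
  "lc7 p q r s = scl V p (L V (-7) (vac V)) + scl V q (L V (-5) (L V (-2) (vac V)))
      + scl V r (L V (-4) (L V (-3) (vac V))) + scl V s (L V (-3) (L V (-2) (L V (-2) (vac V))))"

definition lc8 where
  "lc8 p q r s t u v = scl V p (L V (-8) (vac V)) + scl V q (L V (-6) (L V (-2) (vac V)))
      + scl V r (L V (-5) (L V (-3) (vac V))) + scl V s (L V (-4) (L V (-4) (vac V)))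
      + scl V t (L V (-4) (L V (-2) (L V (-2) (vac V))))
      + scl V u (L V (-3) (L V (-3) (L V (-2) (vac V))))
      + scl V v (L V (-2) (L V (-2) (L V (-2) (L V (-2) (vac V)))))"

lemma L1_lc3: "L V 1 (lc3 p) = lc2 (4 * p)"
  by (rule vector_eqI) (simp add: lc3_def lc2_def L_move algebra_simps)

lemma L1_lc4: "L V 1 (lc4 p q) = lc3 (5 * p + 3 * q)"
  by (rule vector_eqI) (simp add: lc4_def lc3_def L_move algebra_simps)

lemma L1_lc5: "L V 1 (lc5 p q) = lc4 (6 * p) (4 * q)"
  by (rule vector_eqI) (simp add: lc5_def lc4_def L_move algebra_simps)

lemma L1_lc6: "L V 1 (lc6 p q r s) = lc5 (7 * p + 4 * r + 6 * s) (5 * q + 8 * r + 9 * s)"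
  by (rule vector_eqI) (simp add: lc6_def lc5_def L_move algebra_simps)

lemma L1_lc7: "L V 1 (lc7 p q r s) = lc6 (8 * p) (6 * q + 4 * r) (5 * r + 3 * s) (4 * s)"
  by (rule vector_eqI) (simp add: lc7_def lc6_def L_move algebra_simps)

lemma L1_lc8: "L V 1 (lc8 p q r s t u v) = lc7 (9 * p + 5 * s + 27 * v) (7 * q + 4 * r + 4 * u
    + 24 * v) (6 * r + 10 * s + 3 * t) (5 * t + 8 * u + 18 * v)"
  by (rule vector_eqI) (simp add: lc8_def lc7_def L_move algebra_simps)

lemma L2_lc4: "L V 2 (lc4 p q) = lc2 (6 * p + (8 + c) * q)"
  by (rule vector_eqI) (simp add: lc4_def lc2_def L_move algebra_simps)

lemma L2_lc5: "L V 2 (lc5 p q) = lc3 (7 * p + (5 + c / 2) * q)"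
  by (rule vector_eqI) (simp add: lc5_def lc3_def L_move algebra_simps)

lemma L2_lc6: "L V 2 (lc6 p q r s) = lc4 (8 * p + c / 2 * q + 10 * r) (6 * q + (24
    + 3 * c / 2) * s)"
  by (rule vector_eqI) (simp add: lc6_def lc4_def L_move algebra_simps)

lemma L2_lc7: "L V 2 (lc7 p q r s) = lc5 (9 * p + c / 2 * q + 6 * r + 5 * s) (7 * q + 6 * r + (18
    + c) * s)"
  by (rule vector_eqI) (simp add: lc7_def lc5_def L_move algebra_simps)

lemma L2_lc8: "L V 2 (lc8 p q r s t u v) = lc6 (10 * p + c / 2 * q + 12 * s) (8 * q + 12 * s + (8
    + c) * t + 10 * u) (7 * r + (10 + c / 2) * u) (6 * t + (48 + 2 * c) * v)"
  by (rule vector_eqI) (simp add: lc8_def lc6_def L_move algebra_simps)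

lemma E_lc2 [simp]: "lc2 p \<in> E 2"
  by (simp add: lc2_def E_word E_vac E_closed)

lemma E_lc3 [simp]: "lc3 p \<in> E 3"
  by (simp add: lc3_def E_word E_vac E_closed)

lemma E_lc4 [simp]: "lc4 p q \<in> E 4"
  by (simp add: lc4_def E_word E_vac E_closed)

lemma E_lc5 [simp]: "lc5 p q \<in> E 5"
  by (simp add: lc5_def E_word E_vac E_closed)

lemma E_lc6 [simp]: "lc6 p q r s \<in> E 6"
  by (simp add: lc6_def E_word E_vac E_closed)

lemma E_lc7 [simp]: "lc7 p q r s \<in> E 7"
  by (simp add: lc7_def E_word E_vac E_closed)

lemma E_lc8 [simp]: "lc8 p q r s t u v \<in> E 8"
  by (simp add: lc8_def E_word E_vac E_closed)

text \<open>A monomial contributes a product: L(-m) applied in weight n gives the factor (-1)^m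
  ((m-1)h + n), and the vacuum has trace d.\<close>

lemma T_lc2: "T 2 (lc2 p) = of_nat (vs.dim U) *
  (p * ((of_real h)))"
  by (simp add: lc2_def T_add T_scl T_L T_vac E_word E_vac E_closed algebra_simps)

lemma T_lc4: "T 4 (lc4 p q) = of_nat (vs.dim U) *
  (p * ((3 * of_real h)) + q * ((of_real h + 2) * (of_real h)))"
  by (simp add: lc4_def T_add T_scl T_L T_vac E_word E_vac E_closed algebra_simps)

lemma T_lc6: "T 6 (lc6 p q r s) = of_nat (vs.dim U) *
  (p * ((5 * of_real h)) + q * ((3 * of_real h + 2) * (of_real h)) + r * ((2 * of_real h
      + 3) * (2 * of_real h)) + s * ((of_real h + 4) * (of_real h + 2) * (of_real h)))"
  by (simp add: lc6_def T_add T_scl T_L T_vac E_word E_vac E_closed algebra_simps)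

lemma T_lc8: "T 8 (lc8 p q r s t u v) = of_nat (vs.dim U) *
  (p * ((7 * of_real h)) + q * ((5 * of_real h + 2) * (of_real h)) + r * ((4 * of_real h
      + 3) * (2 * of_real h)) + s * ((3 * of_real h + 4) * (3 * of_real h)) + t * ((3 * of_real h
      + 4) * (of_real h + 2) * (of_real h)) + u * ((2 * of_real h + 5) * (2 * of_real h
      + 2) * (of_real h)) + v * ((of_real h + 6) * (of_real h + 4) * (of_real h
      + 2) * (of_real h)))"
  by (simp add: lc8_def T_add T_scl T_L T_vac E_word E_vac E_closed algebra_simps)

lemma scl_lc2: "scl V k (lc2 p) = lc2 (k * p)"
  by (simp add: lc2_def vs.scale_right_distrib)

lemma scl_lc3: "scl V k (lc3 p) = lc3 (k * p)"
  by (simp add: lc3_def vs.scale_right_distrib)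

lemma scl_lc4: "scl V k (lc4 p q) = lc4 (k * p) (k * q)"
  by (simp add: lc4_def vs.scale_right_distrib)

lemma scl_lc5: "scl V k (lc5 p q) = lc5 (k * p) (k * q)"
  by (simp add: lc5_def vs.scale_right_distrib)

lemma scl_lc6: "scl V k (lc6 p q r s) = lc6 (k * p) (k * q) (k * r) (k * s)"
  by (simp add: lc6_def vs.scale_right_distrib)

lemma scl_lc7: "scl V k (lc7 p q r s) = lc7 (k * p) (k * q) (k * r) (k * s)"
  by (simp add: lc7_def vs.scale_right_distrib)

lemma lc2_cong: "p = p' \<Longrightarrow> lc2 p = lc2 p'"
  by simp

lemma lc3_cong: "p = p' \<Longrightarrow> lc3 p = lc3 p'"
  by simp

lemma lc4_cong: "p = p' \<Longrightarrow> q = q' \<Longrightarrow> lc4 p q = lc4 p' q'"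
  by simp

lemma lc5_cong: "p = p' \<Longrightarrow> q = q' \<Longrightarrow> lc5 p q = lc5 p' q'"
  by simp

lemma lc6_cong: "p = p' \<Longrightarrow> q = q' \<Longrightarrow> r = r' \<Longrightarrow> s = s' \<Longrightarrow> lc6 p q r s = lc6 p' q' r' s'"
  by simp

lemma lc7_cong: "p = p' \<Longrightarrow> q = q' \<Longrightarrow> r = r' \<Longrightarrow> s = s' \<Longrightarrow> lc7 p q r s = lc7 p' q' r' s'"
  by simp

text \<open>
  The vector \<open>beta\<close> with index \<open>n\<close> is, up to the factor \<open>D\<^sub>n(c)\<close> (\<open>D\<^sub>n\<^sub>-\<^sub>1(c)\<close> for odd \<open>n\<close>), the projection of \<open>a\<^sub>(\<^sub>3\<^sub>-\<^sub>n\<^sub>) b\<close> to the vacuum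
  module for primary \<open>a\<close>, \<open>b\<close> with \<open>(a|b) = 1\<close>. Unscaled, these vectors solve
  \<open>L(1) \<beta>\<^sub>n = (n - 1) \<beta>\<^sub>n\<^sub>-\<^sub>1\<close> and \<open>L(2) \<beta>\<^sub>n = n \<beta>\<^sub>n\<^sub>-\<^sub>2\<close>.
\<close>

definition beta2 where
  "beta2 = lc2 4"

definition beta3 where
  "beta3 = lc3 2"

definition beta4 where
  "beta4 = lc4 (6 * c) (44)"

definition beta5 where
  "beta5 = lc5 (4 * c) (44)"

definition beta6 where
  "beta6 = lc6 (40 * c ^ 3 + 280 * c ^ 2 - 1824 * c) (368 * c ^ 2 + 1708 * c - 2992) (155 * c ^ 2
      + 1364 * c) (992 * c)"

definition beta7 where
  "beta7 = lc7 (30 * c ^ 3 + 210 * c ^ 2 - 1368 * c) (244 * c ^ 2 + 1212 * c - 2992) (186 * c ^ 2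
      + 744 * c) (1488 * c)"

definition beta8 where
  "beta8 = lc8 (350 * c ^ 5 + 7560 * c ^ 4 + 19295 * c ^ 3 - 299366 * c ^ 2
      - 289848 * c) (2600 * c ^ 4 + 48800 * c ^ 3 + 32908 * c ^ 2 - 739640 * c
      - 412896) (1855 * c ^ 4 + 37238 * c ^ 3 + 137488 * c ^ 2 + 288 * c) (840 * c ^ 4
      + 12603 * c ^ 3 + 15426 * c ^ 2 + 90936 * c) (13280 * c ^ 3 + 148400 * c ^ 2
      - 64128 * c) (11230 * c ^ 3 + 174148 * c ^ 2 + 150384 * c) (19680 * c ^ 2 + 30832 * c)"

lemma L1_beta3: "L V 1 beta3 = scl V 2 beta2"
  unfolding beta3_def beta2_def L1_lc3 scl_lc2
  by (rule lc2_cong; simp add: field_simps power_numeral_reduce)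

text \<open>The 3 is n - 1, and 5c + 22 = D_4(c)/c is the ratio of the scaling factors in weights 4
  and 3; the other factors in this family arise in the same way.\<close>

lemma L1_beta4: "L V 1 beta4 = scl V (3 * (5 * c + 22)) beta3"
  unfolding beta4_def beta3_def L1_lc4 scl_lc3
  by (rule lc3_cong; simp add: field_simps power_numeral_reduce)

lemma L1_beta5: "L V 1 beta5 = scl V 4 beta4"
  unfolding beta5_def beta4_def L1_lc5 scl_lc4
  by (rule lc4_cong; simp add: field_simps power_numeral_reduce)

lemma L1_beta6: "L V 1 beta6 = scl V (5 * ((2 * c - 1) * (7 * c + 68))) beta5"
  unfolding beta6_def beta5_def L1_lc6 scl_lc5
  by (rule lc5_cong; simp add: field_simps power_numeral_reduce)

lemma L1_beta7: "L V 1 beta7 = scl V 6 beta6"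
  unfolding beta7_def beta6_def L1_lc7 scl_lc6
  by (rule lc6_cong; simp add: field_simps power_numeral_reduce)

lemma L1_beta8: "L V 1 beta8 = scl V (7 * ((3 * c + 46) * (5 * c + 3))) beta7"
  unfolding beta8_def beta7_def L1_lc8 scl_lc7
  by (rule lc7_cong; simp add: field_simps power_numeral_reduce)

lemma L2_beta4: "L V 2 beta4 = scl V (4 * (5 * c + 22)) beta2"
  unfolding beta4_def beta2_def L2_lc4 scl_lc2
  by (rule lc2_cong; simp add: field_simps power_numeral_reduce)

lemma L2_beta5: "L V 2 beta5 = scl V (5 * (5 * c + 22)) beta3"
  unfolding beta5_def beta3_def L2_lc5 scl_lc3
  by (rule lc3_cong; simp add: field_simps power_numeral_reduce)

lemma L2_beta6: "L V 2 beta6 = scl V (6 * ((2 * c - 1) * (7 * c + 68))) beta4"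
  unfolding beta6_def beta4_def L2_lc6 scl_lc4
  by (rule lc4_cong; simp add: field_simps power_numeral_reduce)

lemma L2_beta7: "L V 2 beta7 = scl V (7 * ((2 * c - 1) * (7 * c + 68))) beta5"
  unfolding beta7_def beta5_def L2_lc7 scl_lc5
  by (rule lc5_cong; simp add: field_simps power_numeral_reduce)

lemma L2_beta8: "L V 2 beta8 = scl V (8 * ((3 * c + 46) * (5 * c + 3))) beta6"
  unfolding beta8_def beta6_def L2_lc8 scl_lc6
  by (rule lc6_cong; simp add: field_simps power_numeral_reduce)

lemma primary_E: "primary a \<Longrightarrow> a \<in> E 2"
  by (simp add: primary_def)

lemma primary_L_pos: "primary a \<Longrightarrow> n > 0 \<Longrightarrow> L V n a = 0"
  using L1_E_2[of a] E_L_pos[of a 2 n]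
  by (cases "n = 1"; cases "n = 2") (auto simp: primary_def)

lemma form_E: "x \<in> E m \<Longrightarrow> y \<in> E n \<Longrightarrow> m \<noteq> n \<Longrightarrow> B x y = 0"
  by (rule form_weight[of x "of_int m" y "of_int n"]) (auto simp: E_def)

lemma form_griess:
  assumes "a \<in> E 2" "b \<in> E 2"
  shows "mode V a 3 b = scl V (B a b) (vac V)" "B a b = gform V a b"
proof -
  have a: "a \<in> weight_space V 2" using assms by (simp add: E_def)
  have "mode V a 3 b = scl V (vac_coeff V (mode V a 3 b)) (vac V)"
    by (rule E_0) (rule E_mode[OF assms], simp)
  moreover from this have "B a b = vac_coeff V (mode V a 3 b)"
    using form_eq_mode_3[OF a L1_E_2[OF assms(1)], of b] form_norm
    by (metis form_right(4) mult.right_neutral)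
  ultimately show "mode V a 3 b = scl V (B a b) (vac V)" "B a b = gform V a b"
    by (simp_all add: gform_def)
qed

lemma N_I_E:
  assumes "x \<in> E n" "n > 0" "L V 1 x \<in> N (vac V)" "L V 2 x \<in> N (vac V)"
  shows "x \<in> N (vac V)"
  by (rule N_I) (use assms form_E[OF E_vac assms(1)] in auto)

context
  fixes a b assumes a: "primary a" and b: "primary b"
begin

lemma mode_E [simp]: "mode V a (3 - n) b \<in> E n"
  by (rule E_mode[OF primary_E[OF a] primary_E[OF b]]) simp

lemma L1_mode: "L V 1 (mode V a (3 - n) b) = scl V (of_int (n - 1)) (mode V a (4 - n) b)"
  and L2_mode: "L V 2 (mode V a (3 - n) b) = scl V (of_int n) (mode V a (5 - n) b)"
  using L_mode_primary[OF a, of 1 "3 - n" b] L_mode_primary[OF a, of 2 "3 - n" b]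
    primary_L_pos[OF b] by (simp_all add: algebra_simps)

text \<open>L(1) and L(2) send the difference in weight n to multiples of the differences in weights
  n - 1 and n - 2, so \<open>N_I_E\<close> applies. \<open>r\<close> and \<open>s\<close> are the
  ratios of the scaling factor \<open>M\<close> to those of the lower weights.\<close>

lemma two_point_step:
  assumes "n > 0" "\<beta> \<in> E n" "M = r * M'" "M = s * M''"
    "L V 1 \<beta> = scl V (of_int (n - 1) * r) \<beta>'" "L V 2 \<beta> = scl V (of_int n * s) \<beta>''"
    "scl V M' (mode V a (4 - n) b) - scl V (B a b) \<beta>' \<in> N (vac V)"
    "scl V M'' (mode V a (5 - n) b) - scl V (B a b) \<beta>'' \<in> N (vac V)"
  shows "scl V M (mode V a (3 - n) b) - scl V (B a b) \<beta> \<in> N (vac V)"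
proof (rule N_I_E[of _ n])
  show "scl V M (mode V a (3 - n) b) - scl V (B a b) \<beta> \<in> E n"
    using assms by (intro E_closed mode_E)
  have "L V 1 (scl V M (mode V a (3 - n) b) - scl V (B a b) \<beta>)
    = scl V (of_int (n - 1) * r) (scl V M' (mode V a (4 - n) b) - scl V (B a b) \<beta>')"
    by (rule vector_eqI) (simp add: assms(5) L1_mode algebra_simps, simp add: assms(3)
        algebra_simps)
  thus "L V 1 (scl V M (mode V a (3 - n) b) - scl V (B a b) \<beta>) \<in> N (vac V)"
    using assms(7) N_closed(3) by simp
  have "L V 2 (scl V M (mode V a (3 - n) b) - scl V (B a b) \<beta>)
    = scl V (of_int n * s) (scl V M'' (mode V a (5 - n) b) - scl V (B a b) \<beta>'')"
    by (rule vector_eqI) (simp add: assms(6) L2_mode algebra_simps, simp add: assms(4)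
        algebra_simps)
  thus "L V 2 (scl V M (mode V a (3 - n) b) - scl V (B a b) \<beta>) \<in> N (vac V)"
    using assms(8) N_closed(3) by simp
qed fact

lemma two_point_2: "scl V c (mode V a 1 b) - scl V (B a b) beta2 \<in> N (vac V)"
proof (rule N_I_E[of _ 2])
  show "scl V c (mode V a 1 b) - scl V (B a b) beta2 \<in> E 2"
    using mode_E[of 2] by (intro E_closed) (auto simp: beta2_def)
  have "L V 1 (scl V c (mode V a 1 b) - scl V (B a b) beta2) = 0"
    using L1_E_2[of "mode V a 1 b"] mode_E[of 2] by (simp add: beta2_def lc2_def L_minus_2_vac)
  thus "L V 1 (scl V c (mode V a 1 b) - scl V (B a b) beta2) \<in> N (vac V)"
    using N_closed(4) by simp
  have "L V 2 (scl V c (mode V a 1 b) - scl V (B a b) beta2) = 0"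
    using L2_mode[of 2] form_griess(1)[OF primary_E[OF a] primary_E[OF b]]
    by (intro vector_eqI) (simp add: beta2_def lc2_def L_move)
  thus "L V 2 (scl V c (mode V a 1 b) - scl V (B a b) beta2) \<in> N (vac V)"
    using N_closed(4) by simp
qed simp

lemma two_point_3: "scl V c (mode V a 0 b) - scl V (B a b) beta3 \<in> N (vac V)"
  \<comment> \<open>The vector two weights below is a_(2) b of weight 1, which vanishes; hence the
    candidate 0 there.\<close>
  using two_point_step[where n = 3 and \<beta> = beta3 and M = c and r = 1 and M' = c
      and \<beta>' = beta2 and s = c and M'' = 1 and \<beta>'' = 0] two_point_2 L1_beta3
    E_small[OF mode_E[of 1]] N_closed(4)
  by (simp add: beta3_def lc3_def L_move E_word E_vac E_closed)

lemma two_point_4: "scl V (D4 c) (mode V a (-1) b) - scl V (B a b) beta4 \<in> N (vac V)"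
  using two_point_step[where n = 4 and \<beta> = beta4 and M = "D4 c" and r = "5 * c + 22" and M' = "c"
      and \<beta>' = beta3 and s = "5 * c + 22" and M'' = "c" and \<beta>'' = beta2]
    two_point_3 two_point_2 L1_beta4 L2_beta4
  by (simp add: beta4_def D4_def D6_def D8_def algebra_simps)

lemma two_point_5: "scl V (D4 c) (mode V a (-2) b) - scl V (B a b) beta5 \<in> N (vac V)"
  using two_point_step[where n = 5 and \<beta> = beta5 and M = "D4 c" and r = "1" and M' = "D4 c"
      and \<beta>' = beta4 and s = "5 * c + 22" and M'' = "c" and \<beta>'' = beta3]
    two_point_4 two_point_3 L1_beta5 L2_beta5
  by (simp add: beta5_def D4_def D6_def D8_def algebra_simps)

lemma two_point_6: "scl V (D6 c) (mode V a (-3) b) - scl V (B a b) beta6 \<in> N (vac V)"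
  using two_point_step[where n = 6 and \<beta> = beta6 and M = "D6 c" and r =
      "(2 * c - 1) * (7 * c + 68)" and M' = "D4 c"
      and \<beta>' = beta5 and s = "(2 * c - 1) * (7 * c + 68)" and M'' = "D4 c" and \<beta>'' = beta4]
    two_point_5 two_point_4 L1_beta6 L2_beta6
  by (simp add: beta6_def D4_def D6_def D8_def algebra_simps)

lemma two_point_7: "scl V (D6 c) (mode V a (-4) b) - scl V (B a b) beta7 \<in> N (vac V)"
  using two_point_step[where n = 7 and \<beta> = beta7 and M = "D6 c" and r = "1" and M' = "D6 c"
      and \<beta>' = beta6 and s = "(2 * c - 1) * (7 * c + 68)" and M'' = "D4 c" and \<beta>'' = beta5]
    two_point_6 two_point_5 L1_beta7 L2_beta7
  by (simp add: beta7_def D4_def D6_def D8_def algebra_simps)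

lemma two_point_8: "scl V (D8 c) (mode V a (-5) b) - scl V (B a b) beta8 \<in> N (vac V)"
  using two_point_step[where n = 8 and \<beta> = beta8 and M = "D8 c" and r =
      "(3 * c + 46) * (5 * c + 3)" and M' = "D6 c"
      and \<beta>' = beta7 and s = "(3 * c + 46) * (5 * c + 3)" and M'' = "D6 c" and \<beta>'' = beta6]
    two_point_7 two_point_6 L1_beta8 L2_beta8
  by (simp add: beta8_def D4_def D6_def D8_def algebra_simps)

lemma T_two_point:
  assumes "conformal_design V g h t" "0 \<le> n" "n \<le> int t"
    "scl V M (mode V a (3 - n) b) - scl V (B a b) \<beta> \<in> N (vac V)" "\<beta> \<in> E n"
  shows "M * T n (mode V a (3 - n) b) = B a b * T n \<beta>"
proof -
  have "T n (scl V M (mode V a (3 - n) b) - scl V (B a b) \<beta>) = 0"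
    using assms by (intro T_design[OF assms(1)] E_closed mode_E) auto
  thus ?thesis using assms(5) by (simp add: T_diff T_scl E_closed)
qed

end

lemma conformal_design_mono:
  assumes "conformal_design V g h t" "s \<le> t"
  shows "conformal_design V g h s"
proof -
  have "vs.span (\<Union>n\<in>{0..s}. weight_space V (of_nat n) \<inter> par V 0 \<inter> plus_part g)
    \<subseteq> vs.span (\<Union>n\<in>{0..t}. weight_space V (of_nat n) \<inter> par V 0 \<inter> plus_part g)"
    using assms(2) by (intro vs.span_mono UN_mono) auto
  thus ?thesis using assms(1) unfolding conformal_design_def by blast
qed

section \<open>Relations forced by designs\<close>

lemma T_lc3: "T 3 (lc3 p) = of_nat (vs.dim U) * (- 2 * of_real h * p)"
  by (simp add: lc3_def T_scl T_L T_vac E_word E_vac E_closed)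

lemma T_two_point_values:
  assumes "primary a" "primary b"
  shows "conformal_design V g h 2 \<Longrightarrow> c * T 2 (mode V a 1 b) =
      B a b * of_nat (vs.dim U) * (4 * of_real h)"
    and "conformal_design V g h 4 \<Longrightarrow> c * T 3 (mode V a 0 b) =
        - (B a b * of_nat (vs.dim U) * (4 * of_real h))"
    and "conformal_design V g h 4 \<Longrightarrow> D4 c * T 4 (mode V a (-1) b)
      = B a b * of_nat (vs.dim U) * (18 * c * of_real h + 44 * (of_real h + 2) * of_real h)"
    and "conformal_design V g h 6 \<Longrightarrow> D6 c * T 6 (mode V a (-3) b) = B a b * T 6 beta6"
    and "conformal_design V g h 8 \<Longrightarrow> D8 c * T 8 (mode V a (-5) b) = B a b * T 8 beta8"
proof -
  note tp = two_point_2[OF assms] two_point_3[OF assms] two_point_4[OF assms] two_point_6[OF assms]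
    two_point_8[OF assms]
  show "c * T 2 (mode V a 1 b) = B a b * of_nat (vs.dim U) * (4 * of_real h)"
    if "conformal_design V g h 2"
    using T_two_point[OF assms that, of 2 c beta2] tp by (simp add: beta2_def T_lc2)
  show "c * T 3 (mode V a 0 b) = - (B a b * of_nat (vs.dim U) * (4 * of_real h))"
    if "conformal_design V g h 4"
    using T_two_point[OF assms that, of 3 c beta3] tp by (simp add: beta3_def T_lc3)
  show "D4 c * T 4 (mode V a (-1) b)
      = B a b * of_nat (vs.dim U) * (18 * c * of_real h + 44 * (of_real h + 2) * of_real h)"
    if "conformal_design V g h 4"
    using T_two_point[OF assms that, of 4 "D4 c" beta4] tp by (simp add: beta4_def T_lc4)
  show "D6 c * T 6 (mode V a (-3) b) = B a b * T 6 beta6" if "conformal_design V g h 6"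
    using T_two_point[OF assms that, of 6 "D6 c" beta6] tp by (simp add: beta6_def)
  show "D8 c * T 8 (mode V a (-5) b) = B a b * T 8 beta8" if "conformal_design V g h 8"
    using T_two_point[OF assms that, of 8 "D8 c" beta8] tp by (simp add: beta8_def)
qed

text \<open>Writing T_n for the trace in weight n, Zhu's relation reads T_(n+2) = -2 T_(n+1) - T_n,
  so T_3 and T_4 determine the later ones; weights 5 and 7 are eliminated.\<close>

lemma T_zhu_relations:
  assumes "primary a" "primary b"
  shows "T 6 (mode V a (-3) b) = 3 * T 4 (mode V a (-1) b) + 2 * T 3 (mode V a 0 b)"
    and "T 8 (mode V a (-5) b) = 5 * T 4 (mode V a (-1) b) + 4 * T 3 (mode V a 0 b)"
proof -
  note z = T_zhu_zero[OF primary_E[OF assms(1)] primary_E[OF assms(2)]]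
  have "T 5 (mode V a (-2) b) = - 2 * T 4 (mode V a (-1) b) - T 3 (mode V a 0 b)"
    using z[of 0] by (simp add: algebra_simps eq_neg_iff_add_eq_0)
  moreover have "T 6 (mode V a (-3) b) = - 2 * T 5 (mode V a (-2) b) - T 4 (mode V a (-1) b)"
    using z[of 1] by (simp add: algebra_simps eq_neg_iff_add_eq_0)
  moreover have "T 7 (mode V a (-4) b) = - 2 * T 6 (mode V a (-3) b) - T 5 (mode V a (-2) b)"
    using z[of 2] by (simp add: algebra_simps eq_neg_iff_add_eq_0)
  moreover have "T 8 (mode V a (-5) b) = - 2 * T 7 (mode V a (-4) b) - T 6 (mode V a (-3) b)"
    using z[of 3] by (simp add: algebra_simps eq_neg_iff_add_eq_0)
  ultimately show "T 6 (mode V a (-3) b) = 3 * T 4 (mode V a (-1) b) + 2 * T 3 (mode V a 0 b)"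
    "T 8 (mode V a (-5) b) = 5 * T 4 (mode V a (-1) b) + 4 * T 3 (mode V a 0 b)"
    by simp_all
qed

lemma h_nonzero: "(of_real h :: complex) \<noteq> 0"
  using h_pos by simp

text \<open>The trace in weight 6 is known both from \<open>beta6\<close> and from weights 3 and 4.
  Comparison gives the quadratic multiplied by c, h, d and (a|b), none of which is 0.\<close>

lemma six_design_relation:
  assumes "primary a" "primary b" "B a b \<noteq> 0" "conformal_design V g h 6" "D6 c \<noteq> 0"
  shows "248 * of_real h ^ 2 - (31 * c + 124) * of_real h + c ^ 2 + 7 * c + 4 = 0"
proof -
  let ?H = "of_real h :: complex" and ?d = "of_nat (vs.dim U) :: complex"
  have d4: "conformal_design V g h 4" using assms(4) conformal_design_mono by auto
  note v = T_two_point_values[OF assms(1,2)]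
  have "B a b * T 6 beta6 = D6 c * (3 * T 4 (mode V a (-1) b) + 2 * T 3 (mode V a 0 b))"
    using v(4)[OF assms(4)] T_zhu_relations(1)[OF assms(1,2)] by simp
  also have "\<dots> = (2 * c - 1) * (7 * c + 68) * (3 * (D4 c * T 4 (mode V a (-1) b))
      + 2 * (5 * c + 22) * (c * T 3 (mode V a 0 b)))"
    by (simp add: D6_def D4_def algebra_simps)
  finally have "B a b * ?d * (4 * c * ?H * (248 * ?H ^ 2 - (31 * c + 124) * ?H + c ^ 2 + 7 * c
      + 4)) = 0"
    unfolding v(2,3)[OF d4] beta6_def T_lc6 by algebra
  moreover have "c \<noteq> 0" using assms(5) by (auto simp: D6_def D4_def)
  ultimately show ?thesis using assms(3) dim_U h_nonzero by auto
qed

text \<open>Eliminating \<open>c\<close> from the relations of weights 6 and 8 leaves a polynomial in \<open>h\<close> with rational roots,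
  of which only \<open>1/2\<close> is a positive half-integer.\<close>

lemma eight_design_form_zero:
  assumes "primary a" "primary b" "conformal_design V g h 8" "D8 c \<noteq> 0"
  shows "B a b = 0"
proof (rule ccontr)
  assume k: "B a b \<noteq> 0"
  let ?H = "of_real h :: complex" and ?d = "of_nat (vs.dim U) :: complex"
  define Q where "Q = 248 * ?H ^ 2 - (31 * c + 124) * ?H + c ^ 2 + 7 * c + 4"
  define P where "P = 103 + 284 * ?H - 2737 * ?H ^ 2 - 7910 * ?H ^ 3"
  define R where "R = 212 - 2808 * ?H - 23788 * ?H ^ 2 + 2064 * ?H ^ 3 + 121520 * ?H ^ 4"
  have d: "conformal_design V g h 4" "conformal_design V g h 6"
    using assms(3) conformal_design_mono by auto
  have D: "c \<noteq> 0" "2 * c - 1 \<noteq> 0" "D6 c \<noteq> 0" using assms(4) by (auto simp: D8_def D6_def D4_def)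
  have Q: "Q = 0"
    using six_design_relation[OF assms(1,2) k d(2) D(3)] by (simp add: Q_def)
  note v = T_two_point_values[OF assms(1,2)]
  have "B a b * T 8 beta8 = D8 c * (5 * T 4 (mode V a (-1) b) + 4 * T 3 (mode V a 0 b))"
    using v(5)[OF assms(3)] T_zhu_relations(2)[OF assms(1,2)] by simp
  also have "\<dots> = (3 * c + 46) * (5 * c + 3) * (2 * c - 1) * (7 * c + 68)
      * (5 * (D4 c * T 4 (mode V a (-1) b)) + 4 * (5 * c + 22) * (c * T 3 (mode V a 0 b)))"
    by (simp add: D8_def D6_def D4_def algebra_simps)
  \<comment> \<open>The relation in weight 8 is divided by \<open>Q\<close> as a polynomial in c;
    \<open>P * c + R\<close> is the remainder.\<close>
  finally have "B a b * ?d * (c * ?H * ((350 * c ^ 2 + (5590 + 50 * ?H) * c + 3181 - 129 * ?H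
      - 490 * ?H ^ 2) * Q
      + P * c + R)) = 0"
    unfolding v(2,3)[OF d(1)] beta8_def T_lc8 Q_def P_def R_def by algebra
  hence PR: "P * c + R = 0" using k dim_U h_nonzero D(1) Q by auto
  \<comment> \<open>Multiplying by \<open>P ^ 2\<close> allows \<open>P * c\<close> to be replaced
    by \<open>- R\<close> without dividing by \<open>P\<close>; the result is the resultant of the
    two relations with respect to c.\<close>
  have "P ^ 2 * Q = 0" using Q by simp
  hence "R ^ 2 - (7 - 31 * ?H) * P * R + (4 - 124 * ?H + 248 * ?H ^ 2) * P ^ 2 = 0"
    using PR unfolding Q_def by algebra
  hence "(2 * ?H - 1) * (7 * ?H + 3) * (5 * ?H + 2) * (7 * ?H + 2) * (5 * ?H + 1) ^ 2 * (16 * ?H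
      - 1) * (5 * ?H - 11) = 0"
    unfolding P_def R_def by algebra
  hence "complex_of_real ((2 * h - 1) * (7 * h + 3) * (5 * h + 2) * (7 * h + 2) * (5 * h
      + 1) ^ 2 * (16 * h - 1) * (5 * h - 11)) = 0"
    by simp
  hence "(2 * h - 1) * (7 * h + 3) * (5 * h + 2) * (7 * h + 2) * (5 * h + 1) ^ 2 * (16 * h
      - 1) * (5 * h - 11) = 0"
    by (simp only: of_real_eq_0_iff)
  hence "2 * h = 1 \<or> 16 * h = 1 \<or> 5 * h = 11" using h_pos by auto
  moreover obtain n :: int where n: "2 * h = of_int n" using half_integral
      by (auto elim: Ints_cases)
  have "16 * h \<noteq> 1"
  proof
    assume "16 * h = 1"
    hence "of_int (8 * n) = (of_int 1 :: real)" using n by simp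
    hence "8 * n = 1" by (simp only: of_int_eq_iff)
    thus False by presburger
  qed
  moreover have "5 * h \<noteq> 11"
  proof
    assume "5 * h = 11"
    hence "of_int (5 * n) = (of_int 22 :: real)" using n by simp
    hence "5 * n = 22" by (simp only: of_int_eq_iff)
    thus False by presburger
  qed
  ultimately have "h = 1 / 2" by auto
  hence "?H = complex_of_real (1 / 2)" by (simp only:)
  hence H: "?H = 1 / 2" by simp
  \<comment> \<open>At h = 1/2 the remainder is 714 (1 - 2c), and 2c - 1 is a factor of
    D_6(c).\<close>
  have "P = - 1428" "R = 714" unfolding P_def R_def H by (simp_all add: power_divide)
  hence "2 * c - 1 = 0" using PR by simp
  thus False using D(2) by simp
qed

section \<open>Splitting V_2 into omega and primary vectors; traces of products\<close>

lemma form_sym: "a \<in> E 2 \<Longrightarrow> b \<in> E 2 \<Longrightarrow> B a b = B b a"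
  using skew_3[of 0 0 a b] form_griess[of a b] form_griess[of b a] by (simp add: E_def)

lemma L2_E_2: "a \<in> E 2 \<Longrightarrow> L V 2 a = scl V (B a (conf V)) (vac V)"
  using form_griess(1)[OF E_conf, of a] form_sym[OF E_conf, of a] by (simp add: L_def)

lemma form_conf_conf: "B (conf V) (conf V) = c / 2"
  using form_griess(1)[OF E_conf E_conf] conf_conf by simp

text \<open>L(2) a is (a|omega) times the vacuum, so the primary vectors are the orthogonal
  complement of omega in V_2.\<close>

lemma primary_iff: "primary a \<longleftrightarrow> a \<in> E 2 \<and> B a (conf V) = 0"
  unfolding primary_def using L2_E_2[of a] scl_eq_vac[of "B a (conf V)" 0] by auto

lemma primary_conf: "primary a \<Longrightarrow> B a (conf V) = 0" "primary a \<Longrightarrow> B (conf V) a = 0"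
  using primary_iff form_sym[OF E_conf] by auto

lemma primary_decomposition:
  assumes "a \<in> E 2" "c \<noteq> 0"
  obtains l a' where "a = scl V l (conf V) + a'" "primary a'"
proof
  \<comment> \<open>The coefficient is (a|omega)/(omega|omega), where (omega|omega) = c/2.\<close>
  show "a = scl V (2 * B a (conf V) / c) (conf V) + (a - scl V (2 * B a (conf V) / c) (conf V))"
      by simp
  show "primary (a - scl V (2 * B a (conf V) / c) (conf V))"
    using assms E_conf by (auto simp: primary_iff form_conf_conf)
qed

text \<open>Since the splitting of V_2 is orthogonal, the form stays non-degenerate on the primary
  vectors.\<close>

lemma primary_zero:
  assumes "primary a" "c \<noteq> 0" "\<And>b. primary b \<Longrightarrow> B a b = 0"
  shows "a = 0"
proof (rule form_griess_zero)
  show "a \<in> weight_space V 2" "a \<in> plus_part g" using primary_E[OF assms(1)] by (auto simp: E_def)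
  fix b assume "b \<in> weight_space V 2" "b \<in> plus_part g"
  hence "b \<in> E 2" using griess_even unfolding griess_space_def by auto
  then obtain l b' where b: "b = scl V l (conf V) + b'" "primary b'"
    using primary_decomposition assms(2) by metis
  thus "B a b = 0" using assms(3)[OF b(2)] primary_conf(1)[OF assms(1)] by simp
qed

lemma primary_N:
  assumes "primary a" shows "a \<in> N (vac V)"
  using N_I_E[OF primary_E[OF assms]] primary_L_pos[OF assms] N_closed(4) by simp

lemma T_primary: "primary a \<Longrightarrow> conformal_design V g h 2 \<Longrightarrow> T 2 a = 0"
  using T_design[of 2 a 2] primary_E primary_N by simp

lemma T_conf: "T 2 (conf V) = of_nat (vs.dim U) * of_real h"
  using T_lc2[of 1] by (simp add: lc2_def L_minus_2_vac)

lemma E2_U: "a \<in> E 2 \<Longrightarrow> u \<in> U \<Longrightarrow> mode V a 1 u \<in> U"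
  using mode_U(1)[of a 2 u] by simp

definition tr2 where "tr2 a b = tr (\<lambda>u. mode V a 1 (mode V b 1 u))"
definition tr3 where "tr3 a b v = tr (\<lambda>u. mode V a 1 (mode V b 1 (mode V v 1 u)))"

lemma T_2: "T 2 a = tr (mode V a 1)" by (simp add: T_def)

lemma tr2_linear:
  assumes "a \<in> E 2" "b \<in> E 2" "x \<in> E 2"
  shows "tr2 (a + b) x = tr2 a x + tr2 b x" "tr2 x (a + b) = tr2 x a + tr2 x b"
    "tr2 (scl V k a) x = k * tr2 a x" "tr2 x (scl V k a) = k * tr2 x a"
    "tr2 (conf V) x = of_real h * T 2 x" "tr2 x (conf V) = of_real h * T 2 x"
  using assms E2_U unfolding tr2_def T_2
  by (simp_all add: conf_U tr_add tr_scl cong: tr_cong)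

lemma tr3_linear:
  assumes "a \<in> E 2" "b \<in> E 2" "x \<in> E 2" "y \<in> E 2"
  shows "tr3 (a + b) x y = tr3 a x y + tr3 b x y" "tr3 x (a + b) y = tr3 x a y + tr3 x b y"
    "tr3 x y (a + b) = tr3 x y a + tr3 x y b"
    "tr3 (scl V k a) x y = k * tr3 a x y" "tr3 x (scl V k a) y = k * tr3 x a y"
    "tr3 x y (scl V k a) = k * tr3 x y a"
    "tr3 (conf V) x y = of_real h * tr2 x y" "tr3 x (conf V) y = of_real h * tr2 x y"
    "tr3 x y (conf V) = of_real h * tr2 x y"
  using assms E2_U unfolding tr2_def tr3_def
  by (simp_all add: conf_U tr_add tr_scl cong: tr_cong)

text \<open>Zhu's product gives T_4 + 2 T_3 + T_2. As T_3 and T_2 have opposite values, the last two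
  terms together are -4hd (a|b)/c.\<close>

lemma tr2_primary:
  assumes "primary a" "primary b" "conformal_design V g h 4"
  shows "c * (5 * c + 22) * tr2 a b = 2 * of_real h * of_nat (vs.dim U) * (22 * of_real h
      - c) * B a b"
proof -
  have "conformal_design V g h 2" using assms(3) conformal_design_mono by auto
  note v = T_two_point_values(1)[OF assms(1,2) this] T_two_point_values(2,3)[OF assms]
  have "tr2 a b = T 4 (mode V a (-1) b) + 2 * T 3 (mode V a 0 b) + T 2 (mode V a 1 b)"
    using tr_product[OF primary_E[OF assms(1)] primary_E[OF assms(2)]] by (simp add: tr2_def)
  hence "c * (5 * c + 22) * tr2 a b = D4 c * T 4 (mode V a (-1) b)
     + (5 * c + 22) * (2 * (c * T 3 (mode V a 0 b)) + c * T 2 (mode V a 1 b))"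
    by (simp add: D4_def algebra_simps)
  also have "\<dots> = 2 * of_real h * of_nat (vs.dim U) * (22 * of_real h - c) * B a b"
    unfolding v by algebra
  finally show ?thesis .
qed

section \<open>Three primary vectors\<close>

text \<open>These vectors are L(-1)^k a / k!; the denominators come from the commutator of L(-1)
  with a_(n), which is -n a_(n-1).\<close>

lemma primary_mode_vac:
  assumes "primary a"
  shows "mode V a n (vac V) \<in> vir_span a"
proof (cases "n \<ge> 0")
  case False
  have "mode V a (- 1 - int k) (vac V) \<in> vir_span a" for k
  proof (induction k)
    case (Suc k)
    have "scl V (of_nat k + 1) (mode V a (- 1 - int (Suc k)) (vac V)) =
        L V (-1) (mode V a (- 1 - int k) (vac V))"
      using L_mode_primary[OF assms, of "-1" "- 1 - int k" "vac V"]
      by (simp add: algebra_simps minus_diff_commute)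
    hence "scl V (1 / (of_nat k + 1)) (scl V (of_nat k + 1) (mode V a (- 1
        - int (Suc k)) (vac V))) \<in> vir_span a"
      using Suc by (auto intro: vir_span_closed vir_span.L1)
    moreover have "(of_nat k + 1 :: complex) \<noteq> 0" using of_nat_eq_0_iff[of "Suc k", where 'a =
        complex]
      by (simp add: add.commute del: of_nat_eq_0_iff)
    ultimately show ?case by simp
  qed (simp add: creation vir_span.base)
  from this[of "nat (- 1 - n)"] show ?thesis using False by simp
qed (simp add: creation_nonneg vir_span_closed)

text \<open>Moving L(-1) and L(-2) to the left past a mode of \<open>a\<close> produces only further
  modes of \<open>a\<close>.\<close>

lemma primary_mode_vir_span:
  assumes "primary a"
  shows "u \<in> vir_span (vac V) \<Longrightarrow> mode V a n u \<in> vir_span a"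
proof (induction arbitrary: n rule: vir_span.induct)
  case base show ?case by (rule primary_mode_vac[OF assms])
next
  case (L1 x)
  have "mode V a n (L V (-1) x) = L V (-1) (mode V a n x) - scl V (of_int (- n)) (mode V a (n
      - 1) x)"
    using L_mode_primary[OF assms, of "-1" n x] by (simp add: algebra_simps)
  thus ?case using L1.IH by (auto intro: vir_span_closed vir_span.L1)
next
  case (L2 x)
  have "mode V a n (L V (-2) x) = L V (-2) (mode V a n x) - scl V (of_int (- 1 - n)) (mode V a (n
      - 2) x)"
    using L_mode_primary[OF assms, of "-2" n x] by (simp add: algebra_simps)
  thus ?case using L2.IH vir_span_closed(2)[OF vir_span.L2 vir_span_closed(3)] by metis
qed (auto intro: vir_span_closed)

text \<open>Carried across the form, the mode of \<open>a\<close> acts on the vacuum module and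
  lands in the Virasoro module of \<open>a\<close>, to which \<open>y\<close> is orthogonal.\<close>

lemma primary_mode_N:
  assumes "primary a" "y \<in> N a"
  shows "mode V a n y \<in> N (vac V)"
proof -
  have "B u (mode V a n y) = 0" if "u \<in> vir_span (vac V)" for u
    using form_adjoint[of a "2 - n" u y] primary_E[OF assms(1)] L1_E_2
      primary_mode_vir_span[OF assms(1) that] assms(2) by (auto simp: E_def N_def)
  thus ?thesis by (simp add: N_def)
qed

definition Phi where "Phi a n y = tr (\<lambda>u. mode V a 1 (mode V y (n - 1) u))"

text \<open>By Zhu's product o(a) o(y) involves only a_(j) y with j = -1, 0, 1. These have weight at
  most n + 2 and are orthogonal to the vacuum module.\<close>

lemma Phi_design:
  assumes "primary a" "y \<in> E n" "y \<in> N a" "n \<ge> 0" "conformal_design V g h t" "n + 2 \<le> int t"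
  shows "Phi a n y = 0"
proof -
  have E: "mode V a (-1) y \<in> E (n + 2)" "mode V a 0 y \<in> E (n + 1)" "mode V a 1 y \<in> E n"
    using primary_E[OF assms(1)] assms(2) by (auto intro: E_mode)
  note T_design[OF assms(5) E(1)] T_design[OF assms(5) E(2)] T_design[OF assms(5) E(3)]
  thus ?thesis unfolding Phi_def tr_product[OF primary_E[OF assms(1)] assms(2)]
    using primary_mode_N[OF assms(1,3)] assms(4,6) by simp
qed

context
  fixes a assumes a: "a \<in> E 2"
begin

lemma Phi_U: "y \<in> E n \<Longrightarrow> u \<in> U \<Longrightarrow> mode V a 1 (mode V y (n - 1) u) \<in> U"
  using a E2_U mode_U(1) by auto

lemma Phi_add: "x \<in> E n \<Longrightarrow> y \<in> E n \<Longrightarrow> Phi a n (x + y) = Phi a n x + Phi a n y"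
  unfolding Phi_def by (simp add: tr_add Phi_U)

lemma Phi_scl: "x \<in> E n \<Longrightarrow> Phi a n (scl V k x) = k * Phi a n x"
  unfolding Phi_def by (simp add: tr_scl Phi_U)

lemma Phi_L_minus:
  "y \<in> E n \<Longrightarrow> m \<ge> 1 \<Longrightarrow> Phi a (n + int m) (L V (- int m) y)
     = (-1) ^ m * ((of_nat m - 1) * of_real h + of_int n) * Phi a n y"
  unfolding Phi_def
  using tr_scl[of "\<lambda>u. mode V a 1 (mode V y (n - 1) u)"] Phi_U[of y n]
  by (simp add: mode_L_minus cong: tr_cong)

end

text \<open>Subtracting suitable descendants of \<open>p = b v\<close> makes \<open>b\<^sub>(\<^sub>0\<^sub>) v\<close> and \<open>b\<^sub>(\<^sub>-\<^sub>1\<^sub>) v\<close> orthogonal to the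
  Virasoro module generated by \<open>a\<close>.\<close>

lemma tr3_primary:
  assumes p: "primary a" "primary b" "primary v" and d: "conformal_design V g h 6"
    and c: "5 * c + 44 \<noteq> 0"
  shows "2 * (5 * c + 44) * tr3 a b v = (44 * of_real h - c) * tr2 a (mode V b 1 v)"
proof -
  note E2 = primary_E[OF p(1)] primary_E[OF p(2)] primary_E[OF p(3)]
  let ?p = "mode V b 1 v"
  have pE: "?p \<in> E 2" and E3: "mode V b 0 v \<in> E 3" and E4: "mode V b (-1) v \<in> E 4"
    using E2 by (auto intro: E_mode)
  \<comment> \<open>\<open>x\<close> and \<open>y\<close> solve 10x + 3y = 3/2 and 12x + (8 + c/2)y
    = 4, the conditions under which L(1) and L(2) send \<open>?y4\<close> into \<open>N a\<close>;
    5c + 44 is the determinant.\<close>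
  define w where "w = 5 * c + 44"
  define x where "x = 3 * c / 4 / w"
  define y where "y = 22 / w"
  have e: "4 * x * (5 * c + 44) = 3 * c" "y * (5 * c + 44) = 22"
    unfolding w_def[symmetric] using c by (simp_all add: x_def y_def flip: w_def)
  have "(2 * (10 * x + 3 * y)) * (5 * c + 44) = 3 * (5 * c + 44)"
    "(2 * (12 * x) + (16 + c) * y) * (5 * c + 44) = 8 * (5 * c + 44)" using e by algebra+
  hence "2 * (10 * x + 3 * y) = 3" "2 * (12 * x) + (16 + c) * y = 8"
    using mult_right_cancel[OF c] by blast+
  hence xy: "10 * x + 3 * y = 3 / 2" "12 * x + (8 + c / 2) * y = 4"
    by (simp_all add: field_simps)
  have L1: "L V 1 (mode V b n v) = scl V (of_int (2 - n)) (mode V b (n + 1) v)"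
    "L V 2 (mode V b n v) = scl V (of_int (3 - n)) (mode V b (n + 2) v)" for n
    using L_mode_primary[OF p(2), of 1 n v] L_mode_primary[OF p(2), of 2 n v] primary_L_pos[OF p(3)]
    by (simp_all add: add.commute)
  have m2: "mode V b 2 v = 0" 
    by (rule E_small[of _ 1], rule E_mode[OF E2(2) E2(3)]) auto
  have vac_N: "vac V \<in> N a"
    by (rule N_I) (use form_E[OF E2(1) E_vac] N_closed(4) in auto)
  \<comment> \<open>Since \<open>?p\<close> need not be primary, L(-2) L(2) \<open>?p\<close> leaves
    a multiple of omega in the image of \<open>?y4\<close> under L(2).\<close>
  have conf_N: "conf V \<in> N a"
    by (rule N_I) (use primary_conf[OF p(1)] L2_E_2[OF E_conf] N_closed(3)[OF vac_N] N_closed(4) in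
        auto)
  note m3 = form_griess(1)[OF E2(2) E2(3)]
  have Lp: "L V 1 ?p = 0" "L V 0 ?p = scl V 2 ?p"
    using L1_E_2[OF pE] E_weight[OF pE] by auto
  let ?y3 = "mode V b 0 v - scl V (1 / 2) (L V (-1) ?p)"
  have y3: "?y3 \<in> E 3" using E3 pE by (simp add: E_word E_closed)
  have y3N: "?y3 \<in> N a"
  proof (rule N_I)
    show "B a ?y3 = 0" by (rule form_E[OF E2(1) y3]) simp
    have "L V 1 ?y3 = 0" "L V 2 ?y3 = 0"
      by (rule vector_eqI, simp add: L1 L_move Lp m2 m3)+
    thus "L V 1 ?y3 \<in> N a" "L V 2 ?y3 \<in> N a" using N_closed(4) by auto
  qed
  let ?y4 = "mode V b (-1) v - scl V x (L V (-1) (L V (-1) ?p)) - scl V y (L V (-2) ?p)"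
  have y4: "?y4 \<in> E 4" using E4 pE by (simp add: E_word E_closed)
  have y4N: "?y4 \<in> N a"
  proof (rule N_I)
    show "B a ?y4 = 0" by (rule form_E[OF E2(1) y4]) simp
    have "L V 1 ?y4 = scl V 3 (mode V b 0 v) - scl V (10 * x + 3 * y) (L V (-1) ?p)"
      by (rule vector_eqI) (simp add: L1 L_move Lp m2 m3 algebra_simps)
    also have "\<dots> = scl V 3 ?y3" unfolding xy by (rule vector_eqI) simp
    finally show "L V 1 ?y4 \<in> N a" using N_closed(3)[OF y3N] by simp
    have "L V 2 ?y4 = scl V 4 ?p - scl V (12 * x + (8 + c / 2) * y) ?p
        - scl V (y * 2 * B b v) (conf V)"
      by (rule vector_eqI) (simp add: L1 L_move Lp m2 m3 L_minus_2_vac algebra_simps)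
    also have "\<dots> = scl V (- y * 2 * B b v) (conf V)" unfolding xy by simp
    finally show "L V 2 ?y4 \<in> N a" by (simp only: N_closed(3)[OF conf_N])
  qed
  have P3: "Phi a 3 (mode V b 0 v) = - Phi a 2 ?p"
  proof -
    have "Phi a 3 ?y3 = 0" by (rule Phi_design[OF p(1) y3 y3N _ d]) auto
    moreover have "Phi a 3 (?y3 + scl V (1 / 2) (L V (-1) ?p)) =
        Phi a 3 ?y3 + Phi a 3 (scl V (1 / 2) (L V (-1) ?p))"
      by (rule Phi_add[OF E2(1) y3]) (use pE in \<open>simp_all add: E_word E_closed\<close>)
    moreover have "Phi a 3 (scl V (1 / 2) (L V (-1) ?p)) = 1 / 2 * Phi a 3 (L V (-1) ?p)"
      by (rule Phi_scl[OF E2(1)]) (use pE in \<open>simp_all add: E_word E_closed\<close>)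
    moreover have "Phi a 3 (L V (-1) ?p) = - 2 * Phi a 2 ?p"
      using Phi_L_minus[OF E2(1) pE, of 1] by simp
    ultimately show ?thesis by simp
  qed
  have P4: "Phi a 4 (mode V b (-1) v) = (6 * x + (of_real h + 2) * y) * Phi a 2 ?p"
  proof -
    have E: "L V (-1) (L V (-1) ?p) \<in> E 4" "L V (-2) ?p \<in> E 4" "L V (-1) ?p \<in> E 3"
      using pE by (simp_all add: E_word)
    have "mode V b (-1) v = ?y4 + (scl V x (L V (-1) (L V (-1) ?p)) + scl V y (L V (-2) ?p))"
        by simp
    hence "Phi a 4 (mode V b (-1) v) = Phi a 4 ?y4
      + (x * Phi a 4 (L V (-1) (L V (-1) ?p)) + y * Phi a 4 (L V (-2) ?p))"
      using Phi_add[OF E2(1) y4] E by (metis Phi_add[OF E2(1)] Phi_scl[OF E2(1)] E_closed(1,3))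
    moreover have "Phi a 4 ?y4 = 0" by (rule Phi_design[OF p(1) y4 y4N _ d]) auto
    moreover have "Phi a 4 (L V (-1) (L V (-1) ?p)) = 6 * Phi a 2 ?p"
      using Phi_L_minus[OF E2(1) E(3), of 1] Phi_L_minus[OF E2(1) pE, of 1] by simp
    moreover have "Phi a 4 (L V (-2) ?p) = (of_real h + 2) * Phi a 2 ?p"
      using Phi_L_minus[OF E2(1) pE, of 2] by simp
    ultimately show ?thesis by (simp add: algebra_simps)
  qed
  have "tr3 a b v = tr (\<lambda>u. mode V a 1 (mode V (mode V b (-1) v) 3 u)
      + scl V 2 (mode V a 1 (mode V (mode V b 0 v) 2 u)) + mode V a 1 (mode V ?p 1 u))"
    unfolding tr3_def using zhu_product[OF E2(2) E2(3)] by (intro tr_cong) simp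
  also have "\<dots> = Phi a 4 (mode V b (-1) v) + 2 * Phi a 3 (mode V b 0 v) + Phi a 2 ?p"
    using Phi_U[OF E2(1) E4] Phi_U[OF E2(1) E3] Phi_U[OF E2(1) pE] U_subspace
    unfolding Phi_def by (subst tr_add tr_scl; (auto intro: vs.subspace_add vs.subspace_scale)?)+
  \<comment> \<open>The - 1 is 2 (-1) + 1, from the terms of weights 3 and 2.\<close>
  also have "\<dots> = (6 * x + (of_real h + 2) * y - 1) * Phi a 2 ?p"
    unfolding P3 P4 by (simp add: algebra_simps)
  also have "Phi a 2 ?p = tr2 a ?p" by (simp add: Phi_def tr2_def)
  finally have "tr3 a b v = (6 * x + (of_real h + 2) * y - 1) * tr2 a ?p" .
  moreover have "2 * (5 * c + 44) * (6 * x + (of_real h + 2) * y - 1) = 44 * of_real h - c"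
    using e by algebra
  ultimately show ?thesis by (metis mult.assoc)
qed

section \<open>Trace formulae\<close>

lemma gform_E: "a \<in> E 2 \<Longrightarrow> b \<in> E 2 \<Longrightarrow> gform V a b = B a b"
  using form_griess(2) by simp

lemma gprod_E: "a \<in> E 2 \<Longrightarrow> b \<in> E 2 \<Longrightarrow> gprod V a b \<in> E 2"
  unfolding gprod_def by (auto intro: E_mode)

lemma mode_conf_E: "a \<in> E 2 \<Longrightarrow> mode V (conf V) 1 a = scl V 2 a" "a \<in> E 2 \<Longrightarrow> mode V a 1 (conf V) =
    scl V 2 a"
  using E_weight[of a 2] gprod_commute[OF E_conf, of a] by (simp_all add: mode_conf)

lemma form_gprod: "a \<in> E 2 \<Longrightarrow> b \<in> E 2 \<Longrightarrow> B (mode V a 1 b) v = B b (mode V a 1 v)"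
  using form_adjoint[of a 1 b v] L1_E_2[of a] by (simp add: E_def)

text \<open>The omega part of \<open>y\<close> contributes nothing on either side: o(a) has trace 0,
  and \<open>a\<close> is orthogonal to omega.\<close>

lemma tr2_primary_E:
  assumes "primary a" "y \<in> E 2" "conformal_design V g h 4" "c \<noteq> 0"
  shows "c * (5 * c + 22) * tr2 a y = 2 * of_real h * of_nat (vs.dim U) * (22 * of_real h
      - c) * B a y"
proof -
  obtain l y' where y: "y = scl V l (conf V) + y'" "primary y'"
    using primary_decomposition assms(2,4) by metis
  have "conformal_design V g h 2" using assms(3) conformal_design_mono by auto
  thus ?thesis
    using tr2_primary[OF assms(1) y(2) assms(3)] primary_E[OF assms(1)] primary_E[OF y(2)]
      T_primary[OF assms(1)] primary_conf[OF assms(1)]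
    by (simp add: y(1) tr2_linear E_conf E_closed)
qed

lemma tr3_primary_value:
  assumes p: "primary a" "primary b" "primary v" and d: "conformal_design V g h 6" and D: "D6 c \<noteq> 0"
  shows "D6 c * tr3 a b v = F3_2 c (of_nat (vs.dim U)) (of_real h) * B (mode V a 1 b) v"
proof (cases "\<exists>x y. primary x \<and> primary y \<and> B x y \<noteq> 0")
  case False
  have c: "c \<noteq> 0" using D by (auto simp: D6_def D4_def)
  \<comment> \<open>If the form vanishes on all primary vectors, then these are all 0 and both sides
    vanish.\<close>
  have "a = 0" using primary_zero[OF p(1) c] p(1) False by blast
  thus ?thesis by (simp add: tr3_def tr_scalar[of 0, simplified])
next
  case True
  let ?H = "of_real h :: complex" and ?d = "of_nat (vs.dim U) :: complex"
  have d4: "conformal_design V g h 4" using d conformal_design_mono by auto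
  have c: "c \<noteq> 0" using D by (auto simp: D6_def D4_def)
  have Q: "248 * ?H ^ 2 - (31 * c + 124) * ?H + c ^ 2 + 7 * c + 4 = 0"
    using six_design_relation True d D by blast
  have c44: "5 * c + 44 \<noteq> 0"
  proof
    assume "5 * c + 44 = 0"
    \<comment> \<open>This is 25 times the quadratic at c = -44/5; all its coefficients are
      positive, whereas h > 0.\<close>
    hence "6200 * ?H ^ 2 + 3720 * ?H + 496 = 0" using Q by algebra
    hence "complex_of_real (6200 * h ^ 2 + 3720 * h + 496) = 0" by simp
    hence "6200 * h ^ 2 + 3720 * h + 496 = 0" by (simp only: of_real_eq_0_iff)
    thus False using h_pos by (smt (verit) mult_nonneg_nonneg zero_le_power2)
  qed
  have pE: "mode V b 1 v \<in> E 2"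
    by (rule E_mode[OF primary_E[OF p(2)] primary_E[OF p(3)]]) simp
  have X: "B a (mode V b 1 v) = B (mode V a 1 b) v"
    using form_gprod[OF primary_E[OF p(2)] primary_E[OF p(1)], of v]
      gprod_commute[OF primary_E[OF p(1)] primary_E[OF p(2)]] by simp
  have "2 * (5 * c + 44) * tr3 a b v = (44 * ?H - c) * tr2 a (mode V b 1 v)"
    by (rule tr3_primary[OF p d c44])
  moreover have "c * (5 * c + 22) * tr2 a (mode V b 1 v) =
      2 * ?H * ?d * (22 * ?H - c) * B (mode V a 1 b) v"
    using tr2_primary_E[OF p(1) pE d4 c] X by simp
  ultimately have "(5 * c + 44) * (D6 c * tr3 a b v) =
      (5 * c + 44) * (F3_2 c ?d ?H * B (mode V a 1 b) v)"
    \<comment> \<open>The two sides are not equal as polynomials; they agree modulo the quadratic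
      relation \<open>Q\<close>.\<close>
    using Q unfolding D6_def D4_def F3_2_def by algebra
  thus ?thesis using c44 by simp
qed

text \<open>A partition in the orbit is determined by its singleton block, and transposing 0 with i
  reaches each choice.\<close>

lemma Sym_3: "Sym V 3 a {{0}, {1, 2}} = gform V (a 0) (conf V) * gform V (a 1) (a 2)
    + gform V (a 1) (conf V) * gform V (a 0) (a 2) + gform V (a 2) (conf V) * gform V (a 0) (a 1)"
proof -
  let ?F = "\<lambda>i. {{i}, {..<3} - {i::nat}}"
  have P: "{{0}, {1, 2::nat}} = ?F 0" by auto
  have image: "(\<lambda>S. \<sigma> ` S) ` ?F i = ?F (\<sigma> i)" if "\<sigma> permutes {..<3}" "i < 3" for \<sigma> i
    using permutes_image_Diff[OF that(1), of "{i}"] that(2) by simp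
  have "{(\<lambda>S. \<sigma> ` S) ` {{0}, {1, 2::nat}} | \<sigma>. \<sigma> permutes {..<3}} = ?F ` {..<3}"
  proof (intro equalityI subsetI)
    fix Q assume "Q \<in> {(\<lambda>S. \<sigma> ` S) ` {{0}, {1, 2::nat}} | \<sigma>. \<sigma> permutes {..<3}}"
    then obtain \<sigma> where s: "\<sigma> permutes {..<3}" "Q = (\<lambda>S. \<sigma> ` S) ` ?F 0" unfolding P by auto
    have "Q = ?F (\<sigma> 0)" using image[OF s(1), of 0] s(2) by simp
    moreover have "\<sigma> 0 < 3" using permutes_in_image[OF s(1), of 0] by simp
    ultimately show "Q \<in> ?F ` {..<3}" by blast
  next
    fix Q :: "nat set set" assume "Q \<in> ?F ` {..<3}"
    then obtain i where i: "i < 3" "Q = ?F i" by auto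
    have s: "Transposition.transpose 0 i permutes {..<3}" by (rule permutes_swap_id) (use i in auto)
    have "Q = (\<lambda>S. Transposition.transpose 0 i ` S) ` {{0}, {1, 2}}"
        using image[OF s, of 0] i unfolding P by simp
    thus "Q \<in> {(\<lambda>S. \<sigma> ` S) ` {{0}, {1, 2::nat}} | \<sigma>. \<sigma> permutes {..<3}}" using s by blast
  qed
  moreover have "inj_on ?F {..<3}"
  proof (rule inj_onI)
    fix i j :: nat assume ij: "i \<in> {..<3}" "j \<in> {..<3}" "?F i = ?F j"
    have "{i} \<in> ?F j" unfolding ij(3)[symmetric] by (rule insertI1)
    moreover have "card ({..<3} - {j}) = 2" using ij(2) by simp
    hence "{i} \<noteq> {..<3} - {j}" by (metis One_nat_def Suc_1 card_1_singleton_iff n_not_Suc_n)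
    ultimately show "i = j" by blast
  qed
  ultimately have "Sym V 3 a {{0}, {1, 2}} = (\<Sum>i<3. \<Prod>S\<in>?F i. factor V a S)"
    unfolding Sym_def by (simp add: sum.reindex)
  also have "{..<3} = {0, 1, 2::nat}" by auto
  finally have "Sym V 3 a {{0}, {1, 2}} = (\<Prod>S\<in>{{0}, {1, 2}}. factor V a S)
      + (\<Prod>S\<in>{{1}, {0, 2}}. factor V a S)
     + (\<Prod>S\<in>{{2}, {0, 1}}. factor V a S)"
    by (simp add: insert_Diff_if)
  thus ?thesis by (simp add: factor_def)
qed

text \<open>The value of \<open>factor\<close> on a block of 1, 2 or 3 indices when all arguments
  are omega.\<close>

definition block_value :: "nat \<Rightarrow> complex" where
  "block_value n = (if n = 3 then c else c / 2)"

lemma factor_scalar: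
  assumes "finite S" "card S \<in> {1, 2, 3}" "\<And>i. i \<in> S \<Longrightarrow> a i = scl V (l i) (conf V)"
  shows "factor V a S = block_value (card S) * (\<Prod>i\<in>S. l i)"
proof -
  have cc: "gform V (scl V x (conf V)) (scl V y (conf V)) = x * y * (c / 2)" for x y
    by (simp add: gform_E E_conf E_closed form_conf_conf)
  have "gform V (scl V x (conf V)) (conf V) = x * (c / 2)" for x using cc[of x 1] by simp
  moreover have "gtri V (scl V x (conf V)) (scl V y (conf V)) (scl V z (conf V)) =
      x * y * z * c" for x y z
    using cc[of "y * (x * 2)" z] by (simp add: gtri_def gprod_def mode_conf_E E_conf)
  moreover have "card S = length (sorted_list_of_set S)" "distinct (sorted_list_of_set S)"
     "S = set (sorted_list_of_set S)" using assms(1) by auto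
  ultimately show ?thesis using assms(2,3) cc
    \<comment> \<open>\<open>remdups_adj.cases\<close> serves only to split a list by length: empty,
      singleton, or at least two elements.\<close>
    by (cases "sorted_list_of_set S" rule: remdups_adj.cases; cases "tl (tl (sorted_list_of_set
        S))")
       (auto simp: factor_def block_value_def)
qed

text \<open>Permutations preserve block sizes and the blocks partition the index set, so every term
  of the orbit sum has the same value.\<close>

lemma Sym_scalar:
  assumes P: "finite P" "pairwise disjnt P" "\<Union>P = {..<t}" "\<And>S. S \<in> P \<Longrightarrow> card S \<in> {1, 2, 3}"
    and a: "\<And>i. i < t \<Longrightarrow> a i = scl V (l i) (conf V)"
  shows "Sym V t a P = of_nat (card (orbit t P)) * (\<Prod>S\<in>P. block_value (card S)) * (\<Prod>i<t. l i)"
proof -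
  have fin: "finite S" if "S \<in> P" for S using P(3) that finite_subset[of S "{..<t}"] by auto
  have "(\<Prod>S\<in>Q. factor V a S) = (\<Prod>S\<in>P. block_value (card S)) * (\<Prod>i<t. l i)" if "Q \<in> orbit t P" for Q
  proof -
    obtain \<sigma> where s: "\<sigma> permutes {..<t}" "Q = (\<lambda>S. \<sigma> ` S) ` P"
        using \<open>Q \<in> orbit t P\<close> unfolding orbit_def by auto
    have inj: "inj_on \<sigma> S" for S using permutes_inj_on[OF s(1)] .
    have "factor V a (\<sigma> ` S) = block_value (card S) * (\<Prod>i\<in>S. l (\<sigma> i))" if "S \<in> P" for S
    proof -
      have S: "S \<subseteq> {..<t}" using P(3) that by auto
      have "\<sigma> ` S \<subseteq> {..<t}" using image_mono[OF S, of \<sigma>] permutes_image[OF s(1)] by simp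
      hence "factor V a (\<sigma> ` S) = block_value (card (\<sigma> ` S)) * (\<Prod>i\<in>\<sigma> ` S. l i)"
        using P(4)[OF that] a card_image[OF inj, of S] finite_subset[OF S]
            by (intro factor_scalar) auto
      thus ?thesis using card_image[OF inj, of S] by (simp add: prod.reindex inj)
    qed
    moreover have "inj_on (\<lambda>S. \<sigma> ` S) P" by (intro inj_on_image inj)
    ultimately have "(\<Prod>S\<in>Q. factor V a S) = (\<Prod>S\<in>P. block_value (card S) * (\<Prod>i\<in>S. l (\<sigma> i)))"
      unfolding s(2) by (simp add: prod.reindex)
    also have "\<dots> = (\<Prod>S\<in>P. block_value (card S)) * (\<Prod>i\<in>\<Union>P. l (\<sigma> i))"
      using P(1,2) fin by (subst prod.Union_disjoint) (auto simp: prod.distrib pairwise_def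
          disjnt_def)
    also have "(\<Prod>i\<in>\<Union>P. l (\<sigma> i)) = (\<Prod>i<t. l i)"
      using prod.permute[OF s(1), of l] P(3) by (simp add: o_def)
    finally show ?thesis .
  qed
  thus ?thesis unfolding Sym_def orbit_def[symmetric] by simp
qed

lemma zero_mode_E2: "a \<in> E 2 \<Longrightarrow> zero_mode V a = mode V a 1"
  using zero_mode_homogeneous[of a 2] by (simp add: E_def)

lemma trace_1:
  assumes "conformal_design V g h 2" "c \<noteq> 0" "a \<in> E 2"
  shows "T 2 a = 2 * of_real h * of_nat (vs.dim U) / c * gform V a (conf V)"
proof -
  obtain l a' where a: "a = scl V l (conf V) + a'" "primary a'"
    using primary_decomposition assms(2,3) by metis
  have T: "T 2 a = l * (of_nat (vs.dim U) * of_real h)"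
    using primary_E[OF a(2)] T_primary[OF a(2) assms(1)]
    by (simp add: a(1) T_add T_scl T_conf E_conf E_closed)
  have "gform V a (conf V) = l * (c / 2)"
    using gform_E[OF assms(3) E_conf] primary_conf[OF a(2)] by (simp add: a(1) form_conf_conf)
  thus ?thesis unfolding T using assms(2) by (simp only:) simp
qed

lemma trace_2:
  assumes d: "conformal_design V g h 4" and D: "D4 c \<noteq> 0" and E: "a \<in> E 2" "b \<in> E 2"
  shows "tr2 a b = 4 * of_real h * of_nat (vs.dim U) * (5 * of_real h + 1) / (c * (5 * c + 22))
      * gform V a (conf V) * gform V b (conf V)
    + 2 * of_real h * of_nat (vs.dim U) * (22 * of_real h - c) / (c * (5 * c + 22)) * gform V a b"
proof -
  let ?H = "of_real h :: complex" and ?d = "of_nat (vs.dim U) :: complex"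
  have c: "c \<noteq> 0" "5 * c + 22 \<noteq> 0" using D by (auto simp: D4_def)
  have d2: "conformal_design V g h 2" using d conformal_design_mono by auto
  obtain l a' where a: "a = scl V l (conf V) + a'" "primary a'"
    using primary_decomposition E(1) c(1) by metis
  obtain m b' where b: "b = scl V m (conf V) + b'" "primary b'"
    using primary_decomposition E(2) c(1) by metis
  note E' = primary_E[OF a(2)] primary_E[OF b(2)]
  have "tr2 a b = l * (m * (?H * (?d * ?H))) + tr2 a' b'"
    using E' T_primary[OF a(2) d2] T_primary[OF b(2) d2]
    by (simp add: a(1) b(1) tr2_linear T_add T_scl T_conf E_conf E_closed)
  moreover have "c * (5 * c + 22) * tr2 a' b' = 2 * ?H * ?d * (22 * ?H - c) * B a' b'"
    by (rule tr2_primary[OF a(2) b(2) d])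
  moreover have "gform V a (conf V) = l * (c / 2)" "gform V b (conf V) = m * (c / 2)"
    "gform V a b = l * m * (c / 2) + B a' b'"
    using gform_E[OF E(1) E_conf] gform_E[OF E(2) E_conf] gform_E[OF E]
      primary_conf[OF a(2)] primary_conf[OF b(2)]
    by (simp_all add: a(1) b(1) form_conf_conf)
  \<comment> \<open>The omega parts satisfy the formula by themselves; the primary parts are covered
    by \<open>tr2_primary\<close>.\<close>
  moreover have "l * (m * (?H * (?d * ?H))) * (c * (5 * c + 22)) =
     4 * ?H * ?d * (5 * ?H + 1) * (l * (c / 2)) * (m * (c / 2)) + 2 * ?H * ?d * (22 * ?H
         - c) * (l * m * (c / 2))"
    by (simp add: field_simps)
  ultimately have "tr2 a b * (c * (5 * c + 22)) = 4 * ?H * ?d * (5 * ?H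
      + 1) * gform V a (conf V) * gform V b (conf V)
     + 2 * ?H * ?d * (22 * ?H - c) * gform V a b"
    by (simp only: distrib_left distrib_right mult.commute[of "tr2 a' b'"]) (simp add: add.assoc)
  moreover have "c * (5 * c + 22) \<noteq> 0" using c by simp
  ultimately have "tr2 a b = (4 * ?H * ?d * (5 * ?H + 1) * gform V a (conf V) * gform V b (conf V)
     + 2 * ?H * ?d * (22 * ?H - c) * gform V a b) / (c * (5 * c + 22))"
    by (metis nonzero_eq_divide_eq)
  thus ?thesis by (simp only: add_divide_distrib times_divide_eq_left)
qed

lemma trace_3:
  assumes d: "conformal_design V g h 6" and D: "D6 c \<noteq> 0" and E: "\<forall>i<3. a i \<in> E 2"
  shows "D6 c * tr3 (a 0) (a 1) (a 2) =
      F3_0 c (of_nat (vs.dim U)) (of_real h) * gform V (a 0) (conf V) * gform V (a 1) (conf V) *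
          gform V (a 2) (conf V)
      + F3_1 c (of_nat (vs.dim U)) (of_real h) * Sym V 3 a {{0}, {1, 2}}
      + F3_2 c (of_nat (vs.dim U)) (of_real h) * gtri V (a 0) (a 1) (a 2)"
proof -
  let ?H = "of_real h :: complex" and ?d = "of_nat (vs.dim U) :: complex"
  have c: "c \<noteq> 0" using D by (auto simp: D6_def D4_def)
  have d2: "conformal_design V g h 2" "conformal_design V g h 4" using d conformal_design_mono
      by auto
  have E2: "a 0 \<in> E 2" "a 1 \<in> E 2" "a 2 \<in> E 2" using E by auto
  obtain k x where x: "a 0 = scl V k (conf V) + x" "primary x"
    using primary_decomposition E2(1) c by metis
  obtain l y where y: "a 1 = scl V l (conf V) + y" "primary y"
    using primary_decomposition E2(2) c by metis
  obtain m z where z: "a 2 = scl V m (conf V) + z" "primary z"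
    using primary_decomposition E2(3) c by metis
  note E' = primary_E[OF x(2)] primary_E[OF y(2)] primary_E[OF z(2)]
  note pc = primary_conf[OF x(2)] primary_conf[OF y(2)] primary_conf[OF z(2)]
  have "tr3 (a 0) (a 1) (a 2) = k * l * m * ?H ^ 3 * ?d + ?H * (k * tr2 y z + l * tr2 x z
      + m * tr2 x y) + tr3 x y z"
    using E' T_primary[OF x(2) d2(1)] T_primary[OF y(2) d2(1)] T_primary[OF z(2) d2(1)]
    unfolding x(1) y(1) z(1)
    by (simp add: tr3_linear tr2_linear T_add T_scl T_conf E_conf E_closed algebra_simps
        power3_eq_cube)
  hence "D6 c * tr3 (a 0) (a 1) (a 2) = D6 c * (k * l * m * ?H ^ 3 * ?d)
     + (2 * c - 1) * (7 * c + 68) * ?H * (k * (c * (5 * c + 22) * tr2 y z) + l * (c * (5 * c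
         + 22) * tr2 x z)
        + m * (c * (5 * c + 22) * tr2 x y)) + D6 c * tr3 x y z"
    by (simp add: D6_def D4_def algebra_simps)
  also have "\<dots> = D6 c * (k * l * m * ?H ^ 3 * ?d)
     + (2 * c - 1) * (7 * c + 68) * ?H * (2 * ?H * ?d * (22 * ?H - c)) * (k * B y z + l * B x z
         + m * B x y)
     + F3_2 c ?d ?H * B (mode V x 1 y) z"
    unfolding tr2_primary[OF x(2) y(2) d2(2)] tr2_primary[OF x(2) z(2) d2(2)] tr2_primary[OF y(2)
        z(2) d2(2)]
      tr3_primary_value[OF x(2) y(2) z(2) d D] by (simp add: algebra_simps)
  finally have lhs: "D6 c * tr3 (a 0) (a 1) (a 2) = D6 c * (k * l * m * ?H ^ 3 * ?d)
     + (2 * c - 1) * (7 * c + 68) * ?H * (2 * ?H * ?d * (22 * ?H - c)) * (k * B y z + l * B x z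
         + m * B x y)
     + F3_2 c ?d ?H * B (mode V x 1 y) z" .
  have g1: "gform V (a 0) (conf V) = k * (c / 2)" "gform V (a 1) (conf V) = l * (c / 2)"
    "gform V (a 2) (conf V) = m * (c / 2)"
    using gform_E[OF E2(1) E_conf] gform_E[OF E2(2) E_conf] gform_E[OF E2(3) E_conf] pc
    unfolding x(1) y(1) z(1) by (simp_all add: form_conf_conf)
  have g2: "gform V (a 0) (a 1) = k * l * (c / 2) + B x y" "gform V (a 0) (a 2) =
      k * m * (c / 2) + B x z"
    "gform V (a 1) (a 2) = l * m * (c / 2) + B y z"
    using gform_E[OF E2(1,2)] gform_E[OF E2(1,3)] gform_E[OF E2(2,3)] pc
    unfolding x(1) y(1) z(1) by (simp_all add: form_conf_conf)
  have "B (mode V x 1 y) (conf V) = 2 * B x y"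
    using form_gprod[OF E'(1,2), of "conf V"] mode_conf_E(2)[OF E'(1)] form_sym[OF E'(1,2)] by simp
  moreover have "gtri V (a 0) (a 1) (a 2) = B (mode V (a 0) 1 (a 1)) (a 2)"
    using gform_E[OF gprod_E[OF E2(1,2)] E2(3)] by (simp add: gtri_def gprod_def)
  ultimately have g3: "gtri V (a 0) (a 1) (a 2) =
      k * l * m * c + 2 * (k * B y z + l * B x z + m * B x y) + B (mode V x 1 y) z"
    using E' pc mode_conf_E(1)[OF E_conf]
    unfolding x(1) y(1) z(1) by (simp add: mode_conf_E form_conf_conf algebra_simps)
  define w where "w = c / 2"
  \<comment> \<open>The coefficient of k l m gives the first identity, that of terms such as k (y|z)
    the second; the coefficient of (x|y|z) is \<open>F3_2\<close> on both sides.\<close>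
  have "F3_0 c ?d ?H * w ^ 3 + 3 * F3_1 c ?d ?H * w ^ 2 + F3_2 c ?d ?H * c = D6 c * ?H ^ 3 * ?d"
    "F3_1 c ?d ?H * w + 2 * F3_2 c ?d ?H = (2 * c - 1) * (7 * c + 68) * ?H * (2 * ?H * ?d * (22 * ?H
        - c))"
    unfolding F3_0_def F3_1_def F3_2_def D6_def D4_def w_def
        by (simp add: field_simps power_divide, algebra)+
  thus ?thesis unfolding lhs Sym_3 g1 g2 g3 w_def[symmetric] by algebra
qed

section \<open>Degrees four and five, with V_2 reduced to the multiples of omega\<close>

lemma eight_design_griess:
  assumes "conformal_design V g h 8" "D8 c \<noteq> 0" "a \<in> E 2"
  obtains l where "a = scl V l (conf V)"
proof -
  have c: "c \<noteq> 0" using assms(2) by (auto simp: D8_def D6_def D4_def)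
  obtain l a' where a: "a = scl V l (conf V) + a'" "primary a'"
    using primary_decomposition assms(3) c by metis
  have "a' = 0" using primary_zero[OF a(2) c] eight_design_form_zero[OF a(2) _ assms(1,2)] by blast
  thus ?thesis using that[of l] a(1) by simp
qed

lemma zero_mode_scalar: "u \<in> U \<Longrightarrow> zero_mode V (scl V l (conf V)) u = scl V (l * of_real h) u"
  using zero_mode_E2[of "scl V l (conf V)"] E_closed(3)[OF E_conf] by (simp add: conf_U)

lemma gform_scalar: "gform V (scl V x (conf V)) (conf V) = x * (c / 2)"
  "gform V (scl V x (conf V)) (scl V y (conf V)) = x * y * (c / 2)"
  using gform_E[of "scl V x (conf V)" "conf V"] gform_E[of "scl V x (conf V)" "scl V y (conf V)"]
    E_closed(3)[OF E_conf] E_conf by (simp_all add: form_conf_conf)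

lemma gprod_scalar: "gprod V (scl V x (conf V)) (scl V y (conf V)) = scl V (2 * x * y) (conf V)"
  by (simp add: gprod_def mode_conf_E E_conf algebra_simps)

lemma gtri_scalar: "gtri V (scl V x (conf V)) (scl V y (conf V)) (scl V z (conf V)) = x * y * z * c"
  by (simp add: gtri_def gprod_scalar gform_scalar)

text \<open>L(0) is 3 on L(-1) omega, L(1) L(-1) omega = 4 omega, and L(2) omega is c/2 times the
  vacuum: the product is 6c.\<close>

lemma gfive_scalar: "gfive V (scl V p (conf V)) (scl V q (conf V)) (scl V r (conf V)) (scl V s (conf
    V)) (scl V t (conf V))
  = p * q * r * s * t * (6 * c)"
proof -
  have "mode V (conf V) 3 (mode V (conf V) 2 (mode V (conf V) 1 (mode V (conf V) 0 (conf V))))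
    = L V 2 (L V 1 (L V 0 (L V (-1) (L V (-2) (vac V)))))"
    by (simp add: mode_conf L_minus_2_vac)
  also have "\<dots> = scl V (6 * c) (vac V)"
    by (rule vector_eqI) (simp add: L_move)
  finally show ?thesis by (simp add: gfive_def mult.assoc)
qed

lemma Sym_values:
  assumes a: "\<forall>i<t. a i = scl V (l i) (conf V)"
  defines "p \<equiv> \<Prod>i<t. l i"
  shows "t = 4 \<Longrightarrow> Sym V t a {{0}, {1}, {2, 3}} = 6 * (c / 2) ^ 3 * p"
    "t = 4 \<Longrightarrow> Sym V t a {{0}, {1, 2, 3}} = 4 * (c / 2 * c) * p"
    "t = 4 \<Longrightarrow> Sym V t a {{0, 1}, {2, 3}} = 3 * (c / 2) ^ 2 * p"
    "t = 5 \<Longrightarrow> Sym V t a {{0}, {1}, {2}, {3, 4}} = 10 * (c / 2) ^ 4 * p"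
    "t = 5 \<Longrightarrow> Sym V t a {{0}, {1}, {2, 3, 4}} = 10 * ((c / 2) ^ 2 * c) * p"
    "t = 5 \<Longrightarrow> Sym V t a {{0}, {1, 2}, {3, 4}} = 15 * (c / 2) ^ 3 * p"
    "t = 5 \<Longrightarrow> Sym V t a {{0, 1}, {2, 3, 4}} = 10 * (c / 2 * c) * p"
proof -
  have choose: "4 choose 2 = (6::nat)" "5 choose 2 = (10::nat)" "4 choose 3 =
      (4::nat)" "5 choose 3 = (10::nat)"
    "3 choose 2 = (3::nat)"
    by (simp_all add: numeral_eq_Suc)
  have A: "{..<4::nat} = {0, 1, 2, 3}" "{..<5::nat} = {0, 1, 2, 3, 4}" by auto
  have sing: "card (orbit t Q) = t choose k"
    if "Q = insert X ((\<lambda>i. {i}) ` ({..<t} - X))" "X \<subseteq> {..<t}" "card X = k" "k \<noteq> 1" for t Q X k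
    using card_orbit_singletons[of X t] that by simp
  have pair: "2 * card (orbit t Q) = (t choose 2) * ((t - 2) choose 2)"
    if "Q = {X, Y} \<union> (\<lambda>i. {i}) ` ({..<t} - X - Y)" "X \<subseteq> {..<t}" "Y \<subseteq> {..<t} - X" "card X =
        2" "card Y = 2" for t Q X Y
    using card_orbit_two_pairs[OF that(2-5)] that(1) by simp
  have o1: "card (orbit 4 {{0}, {1}, {2, 3}}) = 6"
    using sing[of _ "{2, 3}" 4 2] by (simp add: A choose insert_Diff_if insert_commute)
  have o2: "card (orbit 4 {{0}, {1, 2, 3}}) = 4"
    using sing[of _ "{1, 2, 3}" 4 3] by (simp add: A choose insert_Diff_if insert_commute)
  have o3: "card (orbit 4 {{0, 1}, {2, 3}}) = 3"
    using pair[of "{{0, 1}, {2, 3}}" "{0, 1}" "{2, 3}" 4] by (simp add: A choose insert_Diff_if)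
  have o4: "card (orbit 5 {{0}, {1}, {2}, {3, 4}}) = 10"
    using sing[of _ "{3, 4}" 5 2] by (simp add: A choose insert_Diff_if insert_commute)
  have o5: "card (orbit 5 {{0}, {1}, {2, 3, 4}}) = 10"
    using sing[of _ "{2, 3, 4}" 5 3] by (simp add: A choose insert_Diff_if insert_commute)
  have o6: "card (orbit 5 {{0}, {1, 2}, {3, 4}}) = 15"
    using pair[of "{{0}, {1, 2}, {3, 4}}" "{1, 2}" "{3, 4}" 5]
        by (simp add: A choose insert_Diff_if insert_commute)
  have "{{0, 1}, {2, 3, 4}} = {{0, 1}, {..<5} - {0, 1::nat}}" by (auto simp: A)
  hence o7: "card (orbit 5 {{0, 1}, {2, 3, 4}}) = 10"
    using card_orbit_complement[of "{0, 1}" 5] choose(2) by (simp add: numeral_2_eq_2)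
  note S = Sym_scalar[where a = a and l = l and t = t, OF _ _ _ _ a[rule_format]]
  show "t = 4 \<Longrightarrow> Sym V t a {{0}, {1}, {2, 3}} = 6 * (c / 2) ^ 3 * p"
    by (subst S) (auto simp del: One_nat_def simp: A o1 p_def block_value_def pairwise_def
        disjnt_def power3_eq_cube)
  show "t = 4 \<Longrightarrow> Sym V t a {{0}, {1, 2, 3}} = 4 * (c / 2 * c) * p"
    by (subst S) (auto simp del: One_nat_def simp: A o2 p_def block_value_def pairwise_def
        disjnt_def)
  show "t = 4 \<Longrightarrow> Sym V t a {{0, 1}, {2, 3}} = 3 * (c / 2) ^ 2 * p"
    by (subst S) (auto simp del: One_nat_def simp: A o3 p_def block_value_def pairwise_def
        disjnt_def doubleton_eq_iff power2_eq_square)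
  show "t = 5 \<Longrightarrow> Sym V t a {{0}, {1}, {2}, {3, 4}} = 10 * (c / 2) ^ 4 * p"
    by (subst S) (auto simp del: One_nat_def simp: A o4 p_def block_value_def pairwise_def
        disjnt_def power4_eq_xxxx)
  show "t = 5 \<Longrightarrow> Sym V t a {{0}, {1}, {2, 3, 4}} = 10 * ((c / 2) ^ 2 * c) * p"
    by (subst S) (auto simp del: One_nat_def simp: A o5 p_def block_value_def pairwise_def
        disjnt_def power2_eq_square)
  show "t = 5 \<Longrightarrow> Sym V t a {{0}, {1, 2}, {3, 4}} = 15 * (c / 2) ^ 3 * p"
    by (subst S) (auto simp del: One_nat_def simp: A o6 p_def block_value_def pairwise_def
        disjnt_def doubleton_eq_iff power3_eq_cube)
  \<comment> \<open>Distinctness keeps the product over the set of blocks from collapsing to one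
    factor.\<close>
  have "{0, 1} \<noteq> {2, 3, 4::nat}"
  proof
    assume "{0, 1} = {2, 3, 4::nat}"
    hence "0 \<in> {2, 3, 4::nat}" by (metis insertI1)
    thus False by simp
  qed
  hence v7: "(\<Prod>S\<in>{{0, 1}, {2, 3, 4::nat}}. block_value (card S)) = c / 2 * c"
    by (subst prod.insert) (simp_all add: block_value_def)
  show "t = 5 \<Longrightarrow> Sym V t a {{0, 1}, {2, 3, 4}} = 10 * (c / 2 * c) * p"
    by (subst S) (auto simp del: One_nat_def simp: A o7 v7 p_def pairwise_def disjnt_def)
qed

lemma tr_scalar_U: "(\<And>u. u \<in> U \<Longrightarrow> f u = scl V k u) \<Longrightarrow> tr f = k * of_nat (vs.dim U)"
  using tr_cong[of f "\<lambda>u. scl V k u"] tr_scalar by simp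

text \<open>Each zero-mode is the scalar l_i h on the top level, and every term on the right carries
  the same product of the l_i, which reduces the claim to \<open>polynomial_4\<close>.\<close>

lemma trace_4:
  fixes a :: "nat \<Rightarrow> 'v"
  assumes d: "conformal_design V g h 8" and D: "D8 c \<noteq> 0" and E: "\<forall>i<4. a i \<in> E 2"
  defines "H \<equiv> of_real h" and "n \<equiv> of_nat (vs.dim U)" and "w \<equiv> conf V"
  shows "D8 c * tr (zero_mode V (a 0) \<circ> zero_mode V (a 1) \<circ> zero_mode V (a 2) \<circ> zero_mode V (a 3)) =
          F4_0 c n H * gform V (a 0) w * gform V (a 1) w * gform V (a 2) w * gform V (a 3) w
           + F4_1 c n H * Sym V 4 a {{0}, {1}, {2, 3}}
           + F4_2 c n H * Sym V 4 a {{0}, {1, 2, 3}}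
           + F4_3 c n H * Sym V 4 a {{0, 1}, {2, 3}}
           + F4_4 c n H * gform V (gprod V (a 0) (a 1)) (gprod V (a 2) (a 3))
           + F4_5 c n H * gform V (gprod V (a 0) (a 2)) (gprod V (a 1) (a 3))
           + F4_6 c n H * gform V (gprod V (a 0) (a 3)) (gprod V (a 1) (a 2))"
proof -
  have "\<exists>l. i < 4 \<longrightarrow> a i = scl V l (conf V)" for i using eight_design_griess[OF d D] E by metis
  then obtain l where l: "\<forall>i<4. a i = scl V (l i) (conf V)" by metis
  define p where "p = (\<Prod>i<4. l i)"
  have "{..<4::nat} = {0, 1, 2, 3}" by auto
  hence p: "p = l 0 * l 1 * l 2 * l 3" by (simp add: p_def)
  have a: "a 0 = scl V (l 0) (conf V)" "a 1 = scl V (l 1) (conf V)" "a 2 = scl V (l 2) (conf V)"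
    "a 3 = scl V (l 3) (conf V)" using l by auto
  note S = Sym_values(1-3)[where t = 4 and a = a and l = l, OF l refl, folded p_def]
  have "tr (zero_mode V (a 0) \<circ> zero_mode V (a 1) \<circ> zero_mode V (a 2) \<circ> zero_mode V (a 3)) =
      p * H ^ 4 * n"
    unfolding n_def a
    by (rule tr_scalar_U) (simp add: zero_mode_scalar vs.subspace_scale[OF U_subspace] p H_def
        power4_eq_xxxx mult_ac)
  hence "D8 c * tr (zero_mode V (a 0) \<circ> zero_mode V (a 1) \<circ> zero_mode V (a 2) \<circ> zero_mode V (a 3))
     = p * (D8 c * H ^ 4 * n)" by simp
  also have "\<dots> = p * (F4_0 c n H * (c / 2) ^ 4 + 6 * (F4_1 c n H * (c / 2) ^ 3)
      + 4 * (F4_2 c n H * (c / 2) * c)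
    + 3 * (F4_3 c n H * (c / 2) ^ 2) + (F4_4 c n H + F4_5 c n H + F4_6 c n H) * (2 * c))"
    unfolding polynomial_4 ..
  finally show ?thesis
    unfolding S unfolding a w_def gprod_scalar gform_scalar p by (simp only: expand_4)
qed

lemma trace_5:
  fixes a :: "nat \<Rightarrow> 'v"
  assumes d: "conformal_design V g h 8" and D: "D8 c \<noteq> 0" and E: "\<forall>i<5. a i \<in> E 2"
  defines "H \<equiv> of_real h" and "n \<equiv> of_nat (vs.dim U)" and "w \<equiv> conf V"
  shows "D10 c * tr (zero_mode V (a 0) \<circ> zero_mode V (a 1) \<circ> zero_mode V (a 2) \<circ> zero_mode V (a 3) \<circ>
      zero_mode V (a 4)) =
          F5_0 c n H * gform V (a 0) w * gform V (a 1) w * gform V (a 2) w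
              * gform V (a 3) w * gform V (a 4) w
           + F5_1 c n H * Sym V 5 a {{0}, {1}, {2}, {3, 4}}
           + F5_2 c n H * Sym V 5 a {{0}, {1}, {2, 3, 4}}
           + F5_3 c n H * Sym V 5 a {{0}, {1, 2}, {3, 4}}
           + F5_4 c n H *
              (gform V (a 0) w * gform V (gprod V (a 1) (a 2)) (gprod V (a 3) (a 4))
               + gform V (a 1) w * gform V (gprod V (a 0) (a 2)) (gprod V (a 3) (a 4))
               + gform V (a 2) w * gform V (gprod V (a 0) (a 1)) (gprod V (a 3) (a 4))
               + gform V (a 3) w * gform V (gprod V (a 0) (a 1)) (gprod V (a 2) (a 4))
               + gform V (a 4) w * gform V (gprod V (a 0) (a 1)) (gprod V (a 2) (a 3)))
           + F5_5 c n H *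
              (gform V (a 0) w * gform V (gprod V (a 1) (a 3)) (gprod V (a 2) (a 4))
               + gform V (a 1) w * gform V (gprod V (a 0) (a 3)) (gprod V (a 2) (a 4))
               + gform V (a 2) w * gform V (gprod V (a 0) (a 3)) (gprod V (a 1) (a 4))
               + gform V (a 3) w * gform V (gprod V (a 0) (a 2)) (gprod V (a 1) (a 4))
               + gform V (a 4) w * gform V (gprod V (a 0) (a 2)) (gprod V (a 1) (a 3)))
           + F5_6 c n H *
              (gform V (a 0) w * gform V (gprod V (a 1) (a 4)) (gprod V (a 2) (a 3))
               + gform V (a 1) w * gform V (gprod V (a 0) (a 4)) (gprod V (a 2) (a 3))
               + gform V (a 2) w * gform V (gprod V (a 0) (a 4)) (gprod V (a 1) (a 3))
               + gform V (a 3) w * gform V (gprod V (a 0) (a 4)) (gprod V (a 1) (a 2))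
               + gform V (a 4) w * gform V (gprod V (a 0) (a 3)) (gprod V (a 1) (a 2)))
           + F5_7 c n H * Sym V 5 a {{0, 1}, {2, 3, 4}}
           + F5_8 c n H * gfive V (a 0) (a 1) (a 2) (a 3) (a 4)
           + sum_star V c n H a"
proof -
  have "\<exists>l. i < 5 \<longrightarrow> a i = scl V l (conf V)" for i using eight_design_griess[OF d D] E by metis
  then obtain l where l: "\<forall>i<5. a i = scl V (l i) (conf V)" by metis
  define p where "p = (\<Prod>i<5. l i)"
  have "{..<5::nat} = {0, 1, 2, 3, 4}" by auto
  hence p: "p = l 0 * l 1 * l 2 * l 3 * l 4" by (simp add: p_def)
  have a: "a 0 = scl V (l 0) (conf V)" "a 1 = scl V (l 1) (conf V)" "a 2 = scl V (l 2) (conf V)"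
    "a 3 = scl V (l 3) (conf V)" "a 4 = scl V (l 4) (conf V)" using l by auto
  note S = Sym_values(4-7)[where t = 5 and a = a and l = l, OF l refl, folded p_def]
  have "tr (zero_mode V (a 0) \<circ> zero_mode V (a 1) \<circ> zero_mode V (a 2) \<circ> zero_mode V (a 3) \<circ>
      zero_mode V (a 4))
      = p * H ^ 5 * n"
    unfolding n_def a
    by (rule tr_scalar_U)
      (simp add: zero_mode_scalar vs.subspace_scale[OF U_subspace] p H_def eval_nat_numeral mult_ac)
  hence "D10 c * tr (zero_mode V (a 0) \<circ> zero_mode V (a 1) \<circ> zero_mode V (a 2) \<circ> zero_mode V (a 3) \<circ>
      zero_mode V (a 4))
     = p * (D10 c * H ^ 5 * n)" by simp
  also have "\<dots> = p * (F5_0 c n H * (c / 2) ^ 5 + 10 * (F5_1 c n H * (c / 2) ^ 4)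
      + 10 * (F5_2 c n H * (c / 2) ^ 2 * c)
    + 15 * (F5_3 c n H * (c / 2) ^ 3) + 5 * ((F5_4 c n H + F5_5 c n H
        + F5_6 c n H) * (c / 2) * (2 * c))
    + 10 * (F5_7 c n H * (c / 2) * c) + F5_8 c n H * (6 * c)
    + (F5_01423 c n H + F5_01324 c n H + F5_12034 c n H + F5_01234 c n H + F5_02134 c n H
      + 2 * (F5_03214 c n H + F5_02413 c n H + F5_02314 c n H + F5_04123 c n H
          + F5_14023 c n H)) * (4 * c))"
    unfolding polynomial_5 ..
  finally have "D10 c * tr (zero_mode V (a 0) \<circ> zero_mode V (a 1) \<circ> zero_mode V (a 2) \<circ> zero_mode V
      (a 3) \<circ> zero_mode V (a 4)) = \<dots>" .
  moreover have "sum_star V c n H a = p * ((F5_01423 c n H + F5_01324 c n H + F5_12034 c n H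
      + F5_01234 c n H + F5_02134 c n H
      + 2 * (F5_03214 c n H + F5_02413 c n H + F5_02314 c n H + F5_04123 c n H
          + F5_14023 c n H)) * (4 * c))"
    unfolding sum_star_def F5_list_def p
    using a(2) by (simp add: a gprod_scalar gtri_scalar algebra_simps)
  ultimately show ?thesis
    unfolding S unfolding a w_def gprod_scalar gform_scalar gfive_scalar p by (simp only: expand_5)
qed

end

theorem theorem4p11:
  fixes V :: "'v::ab_group_add vertex_structure"
    and g :: "'v \<Rightarrow> 'v"
    and B :: "'v \<Rightarrow> 'v \<Rightarrow> complex"
    and c d H :: complex
    and h :: real
    and tr :: "('v \<Rightarrow> 'v) \<Rightarrow> complex"
    and o' :: "'v \<Rightarrow> 'v \<Rightarrow> 'v"
    and \<omega> :: 'v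
  assumes svoa: "svoa V c"
    and cft: "cft_type V"
    and invol: "svoa_involution V g"
    and a1: "self_dual V (adjoint_sign V h)"
    and a2_even: "direct_sum V (UNIV :: nat set)
          (\<lambda>n. weight_space V (of_nat n) \<inter> par V 0) (par V 0)"
    and a2_odd: "par V 1 \<noteq> {0} \<Longrightarrow> \<exists>k::nat. direct_sum V (UNIV :: nat set)
          (\<lambda>n. weight_space V (of_nat n + of_nat k / 2) \<inter> par V 1) (par V 1)"
    and a3_plus: "direct_sum V ({0, 2} \<union> {2<..})
          (\<lambda>r. weight_space V r \<inter> plus_part g) (plus_part g)"
    and a3_minus: "direct_sum V {h..} (\<lambda>r. weight_space V r \<inter> minus_part g) (minus_part g)"
    and a3_top: "top_space V g h \<noteq> {0}"
    and a3_half: "2 * h \<in> \<int>"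
    and a3_even: "h \<in> \<int> \<Longrightarrow> top_space V g h \<subseteq> par V 0"
    and a3_odd: "h \<notin> \<int> \<Longrightarrow> top_space V g h \<subseteq> par V 1"
    and a4_inv: "invariant_form V (adjoint_sign V h) B"
    and a4_norm: "B (vac V) (vac V) = 1"
    and a4_nondeg: "nondegenerate_on UNIV B"
    and a5: "nondegenerate_on (virasoro_subalgebra V) B"
    and a6: "virasoro_decomposable V"
    and a7: "conformal_design V g h 2 \<Longrightarrow> D2 c \<noteq> 0"
            "conformal_design V g h 4 \<Longrightarrow> D4 c \<noteq> 0"
            "conformal_design V g h 6 \<Longrightarrow> D6 c \<noteq> 0"
            "conformal_design V g h 8 \<Longrightarrow> D8 c \<noteq> 0"
            "conformal_design V g h 10 \<Longrightarrow> D10 c \<noteq> 0"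
    and d: "d = of_nat (vdim V (top_space V g h))"
    and H: "H = of_real h"
    and tr: "tr = trace_on V (top_space V g h)"
    and o': "o' = zero_mode V"
    and \<omega>: "\<omega> = conf V"
  shows
    "(conformal_design V g h 2 \<longrightarrow> (\<forall>a0 \<in> griess_space V g.
        tr (o' a0) = 2 * H * d / c * gform V a0 \<omega>)) \<and>
     (conformal_design V g h 4 \<longrightarrow> (\<forall>a0 \<in> griess_space V g. \<forall>a1 \<in> griess_space V g.
        tr (o' a0 \<circ> o' a1) =
          4 * H * d * (5 * H + 1) / (c * (5 * c + 22)) * gform V a0 \<omega> * gform V a1 \<omega>
          + 2 * H * d * (22 * H - c) / (c * (5 * c + 22)) * gform V a0 a1)) \<and>
     (conformal_design V g h 6 \<longrightarrow> (\<forall>a. (\<forall>i<3. a i \<in> griess_space V g) \<longrightarrow>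
        tr (o' (a 0) \<circ> o' (a 1) \<circ> o' (a 2)) = inverse (D6 c) *
          (F3_0 c d H * gform V (a 0) \<omega> * gform V (a 1) \<omega> * gform V (a 2) \<omega>
           + F3_1 c d H * Sym V 3 a {{0}, {1, 2}}
           + F3_2 c d H * gtri V (a 0) (a 1) (a 2)))) \<and>
     (conformal_design V g h 8 \<longrightarrow> (\<forall>a. (\<forall>i<4. a i \<in> griess_space V g) \<longrightarrow>
        tr (o' (a 0) \<circ> o' (a 1) \<circ> o' (a 2) \<circ> o' (a 3)) = inverse (D8 c) *
          (F4_0 c d H * gform V (a 0) \<omega> * gform V (a 1) \<omega> * gform V (a 2) \<omega> * gform V (a 3) \<omega>
           + F4_1 c d H * Sym V 4 a {{0}, {1}, {2, 3}}
           + F4_2 c d H * Sym V 4 a {{0}, {1, 2, 3}}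
           + F4_3 c d H * Sym V 4 a {{0, 1}, {2, 3}}
           + F4_4 c d H * gform V (gprod V (a 0) (a 1)) (gprod V (a 2) (a 3))
           + F4_5 c d H * gform V (gprod V (a 0) (a 2)) (gprod V (a 1) (a 3))
           + F4_6 c d H * gform V (gprod V (a 0) (a 3)) (gprod V (a 1) (a 2))))) \<and>
     (conformal_design V g h 10 \<longrightarrow> (\<forall>a. (\<forall>i<5. a i \<in> griess_space V g) \<longrightarrow>
        tr (o' (a 0) \<circ> o' (a 1) \<circ> o' (a 2) \<circ> o' (a 3) \<circ> o' (a 4)) = inverse (D10 c) *
          (F5_0 c d H * gform V (a 0) \<omega> * gform V (a 1) \<omega> * gform V (a 2) \<omega>
              * gform V (a 3) \<omega> * gform V (a 4) \<omega>
           + F5_1 c d H * Sym V 5 a {{0}, {1}, {2}, {3, 4}}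
           + F5_2 c d H * Sym V 5 a {{0}, {1}, {2, 3, 4}}
           + F5_3 c d H * Sym V 5 a {{0}, {1, 2}, {3, 4}}
           + F5_4 c d H *
              (gform V (a 0) \<omega> * gform V (gprod V (a 1) (a 2)) (gprod V (a 3) (a 4))
               + gform V (a 1) \<omega> * gform V (gprod V (a 0) (a 2)) (gprod V (a 3) (a 4))
               + gform V (a 2) \<omega> * gform V (gprod V (a 0) (a 1)) (gprod V (a 3) (a 4))
               + gform V (a 3) \<omega> * gform V (gprod V (a 0) (a 1)) (gprod V (a 2) (a 4))
               + gform V (a 4) \<omega> * gform V (gprod V (a 0) (a 1)) (gprod V (a 2) (a 3)))
           + F5_5 c d H *
              (gform V (a 0) \<omega> * gform V (gprod V (a 1) (a 3)) (gprod V (a 2) (a 4))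
               + gform V (a 1) \<omega> * gform V (gprod V (a 0) (a 3)) (gprod V (a 2) (a 4))
               + gform V (a 2) \<omega> * gform V (gprod V (a 0) (a 3)) (gprod V (a 1) (a 4))
               + gform V (a 3) \<omega> * gform V (gprod V (a 0) (a 2)) (gprod V (a 1) (a 4))
               + gform V (a 4) \<omega> * gform V (gprod V (a 0) (a 2)) (gprod V (a 1) (a 3)))
           + F5_6 c d H *
              (gform V (a 0) \<omega> * gform V (gprod V (a 1) (a 4)) (gprod V (a 2) (a 3))
               + gform V (a 1) \<omega> * gform V (gprod V (a 0) (a 4)) (gprod V (a 2) (a 3))
               + gform V (a 2) \<omega> * gform V (gprod V (a 0) (a 4)) (gprod V (a 1) (a 3))
               + gform V (a 3) \<omega> * gform V (gprod V (a 0) (a 4)) (gprod V (a 1) (a 2))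
               + gform V (a 4) \<omega> * gform V (gprod V (a 0) (a 3)) (gprod V (a 1) (a 2)))
           + F5_7 c d H * Sym V 5 a {{0, 1}, {2, 3, 4}}
           + F5_8 c d H * gfive V (a 0) (a 1) (a 2) (a 3) (a 4)
           + sum_star V c d H a)))"
proof -
  interpret graded_svoa V c g B h
    using svoa cft invol a3_plus a3_minus a3_top a3_half a4_inv a4_norm a4_nondeg a5 a6
    by (intro graded_svoa.intro graded_svoa_axioms.intro)
  have n: "d = of_nat (vs.dim U)" by (simp add: d U_def)
  have t: "tr = graded_svoa.tr V g h" unfolding assms tr_def U_def ..
  have E2: "zero_mode V x = mode V x 1" if "x \<in> E 2" for x using zero_mode_E2[OF that] .
  show ?thesis
  proof (intro conjI impI ballI allI)
    show "tr (o' a0) = 2 * H * d / c * gform V a0 \<omega>" if "conformal_design V g h 2" "a0 \<in>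
        griess_space V g" for a0
      using trace_1[of a0] that a7(1) E2 unfolding n t H o' \<omega> by (simp add: griess_even T_2 D2_def)
  next
    fix a0 a1 assume *: "conformal_design V g h 4" "a0 \<in> griess_space V g" "a1 \<in> griess_space V g"
    show "tr (o' a0 \<circ> o' a1) =
          4 * H * d * (5 * H + 1) / (c * (5 * c + 22)) * gform V a0 \<omega> * gform V a1 \<omega>
          + 2 * H * d * (22 * H - c) / (c * (5 * c + 22)) * gform V a0 a1"
      using trace_2[of a0 a1] * a7(2) E2 unfolding n t H o' \<omega>
          by (simp add: griess_even tr2_def comp_def)
  next
    fix a :: "nat \<Rightarrow> 'v" assume *: "conformal_design V g h 6" "\<forall>i<3. a i \<in> griess_space V g"
    have "tr (o' (a 0) \<circ> o' (a 1) \<circ> o' (a 2)) = tr3 (a 0) (a 1) (a 2)"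
      unfolding t o' tr3_def using *(2) E2 by (simp add: comp_def griess_even)
    thus "tr (o' (a 0) \<circ> o' (a 1) \<circ> o' (a 2)) = inverse (D6 c) *
          (F3_0 c d H * gform V (a 0) \<omega> * gform V (a 1) \<omega> * gform V (a 2) \<omega>
           + F3_1 c d H * Sym V 3 a {{0}, {1, 2}}
           + F3_2 c d H * gtri V (a 0) (a 1) (a 2))"
      unfolding n H \<omega> trace_3[OF *(1) a7(3)[OF *(1)] *(2)[unfolded griess_even], symmetric]
      using a7(3)[OF *(1)] by simp
  next
    fix a :: "nat \<Rightarrow> 'v" assume *: "conformal_design V g h 8" "\<forall>i<4. a i \<in> griess_space V g"
    show "tr (o' (a 0) \<circ> o' (a 1) \<circ> o' (a 2) \<circ> o' (a 3)) = inverse (D8 c) *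
          (F4_0 c d H * gform V (a 0) \<omega> * gform V (a 1) \<omega> * gform V (a 2) \<omega> * gform V (a 3) \<omega>
           + F4_1 c d H * Sym V 4 a {{0}, {1}, {2, 3}}
           + F4_2 c d H * Sym V 4 a {{0}, {1, 2, 3}}
           + F4_3 c d H * Sym V 4 a {{0, 1}, {2, 3}}
           + F4_4 c d H * gform V (gprod V (a 0) (a 1)) (gprod V (a 2) (a 3))
           + F4_5 c d H * gform V (gprod V (a 0) (a 2)) (gprod V (a 1) (a 3))
           + F4_6 c d H * gform V (gprod V (a 0) (a 3)) (gprod V (a 1) (a 2)))"
      unfolding n H \<omega> t o' trace_4[OF *(1) a7(4)[OF *(1)] *(2)[unfolded griess_even], symmetric]
      using a7(4)[OF *(1)] by simp
  next
    fix a :: "nat \<Rightarrow> 'v" assume *: "conformal_design V g h 10" "\<forall>i<5. a i \<in> griess_space V g"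
    \<comment> \<open>A 10-design is an 8-design, and D_8(c) divides D_10(c).\<close>
    have **: "conformal_design V g h 8" "D8 c \<noteq> 0" "D10 c \<noteq> 0" "\<forall>i<5. a i \<in> E 2"
      using conformal_design_mono[OF *(1), of 8] a7(5)[OF *(1)] *(2)
          by (auto simp: D10_def griess_even)
    show "tr (o' (a 0) \<circ> o' (a 1) \<circ> o' (a 2) \<circ> o' (a 3) \<circ> o' (a 4)) = inverse (D10 c) *
          (F5_0 c d H * gform V (a 0) \<omega> * gform V (a 1) \<omega> * gform V (a 2) \<omega>
              * gform V (a 3) \<omega> * gform V (a 4) \<omega>
           + F5_1 c d H * Sym V 5 a {{0}, {1}, {2}, {3, 4}}
           + F5_2 c d H * Sym V 5 a {{0}, {1}, {2, 3, 4}}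
           + F5_3 c d H * Sym V 5 a {{0}, {1, 2}, {3, 4}}
           + F5_4 c d H *
              (gform V (a 0) \<omega> * gform V (gprod V (a 1) (a 2)) (gprod V (a 3) (a 4))
               + gform V (a 1) \<omega> * gform V (gprod V (a 0) (a 2)) (gprod V (a 3) (a 4))
               + gform V (a 2) \<omega> * gform V (gprod V (a 0) (a 1)) (gprod V (a 3) (a 4))
               + gform V (a 3) \<omega> * gform V (gprod V (a 0) (a 1)) (gprod V (a 2) (a 4))
               + gform V (a 4) \<omega> * gform V (gprod V (a 0) (a 1)) (gprod V (a 2) (a 3)))
           + F5_5 c d H *
              (gform V (a 0) \<omega> * gform V (gprod V (a 1) (a 3)) (gprod V (a 2) (a 4))
               + gform V (a 1) \<omega> * gform V (gprod V (a 0) (a 3)) (gprod V (a 2) (a 4))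
               + gform V (a 2) \<omega> * gform V (gprod V (a 0) (a 3)) (gprod V (a 1) (a 4))
               + gform V (a 3) \<omega> * gform V (gprod V (a 0) (a 2)) (gprod V (a 1) (a 4))
               + gform V (a 4) \<omega> * gform V (gprod V (a 0) (a 2)) (gprod V (a 1) (a 3)))
           + F5_6 c d H *
              (gform V (a 0) \<omega> * gform V (gprod V (a 1) (a 4)) (gprod V (a 2) (a 3))
               + gform V (a 1) \<omega> * gform V (gprod V (a 0) (a 4)) (gprod V (a 2) (a 3))
               + gform V (a 2) \<omega> * gform V (gprod V (a 0) (a 4)) (gprod V (a 1) (a 3))
               + gform V (a 3) \<omega> * gform V (gprod V (a 0) (a 4)) (gprod V (a 1) (a 2))
               + gform V (a 4) \<omega> * gform V (gprod V (a 0) (a 3)) (gprod V (a 1) (a 2)))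
           + F5_7 c d H * Sym V 5 a {{0, 1}, {2, 3, 4}}
           + F5_8 c d H * gfive V (a 0) (a 1) (a 2) (a 3) (a 4)
           + sum_star V c d H a)"
      unfolding n H \<omega> t o' trace_5[OF **(1,2,4), symmetric] using **(3) by simp
  qed
qed

end
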